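(* Let $n\ge2$, $\lambda=(\lambda_1,\lambda_2)\in\mathbb R^2$, $\mu\in\mathbb R$ and $\delta=\mu-\lambda_1-\lambda_2$. If $\delta=1$, there exists a projectively equivariant symbol map for the elements of $\mathcal M^2_{\mathit{diff}}(\lambda,\mu)$ if and only if $\lambda=(0,0)$, in which case this symbol map is not unique.
   Context: Everything is smooth; $x^1,\dots,x^n$ are the coordinates of $\mathbb R^n$, $\partial_i=\partial/\partial x^i$. For $\lambda\in\mathbb R$, densities of weight $\lambda$ are sections of the trivial line bundle $\Delta^\lambda(\mathbb R^n)$, identified with functions $\phi$ with $L_X\phi=\sum_iX^i\partial_i\phi+\lambda(\sum_i\partial_iX^i)\phi$. $\mathcal M^2_{\mathit{diff}}(\lambda,\mu)$ is the space of bidifferential operators $T:(f,g)\mapsto\sum A_{a,b}D^afD^bg$ (finite sums of arbitrary order, $a,b$ multi-indices) from densities of weights $\lambda_1$, $\lambda_2$ to densities of weight $\mu$; the coefficients are $\delta$-densities. Module structure: $(L_XT)(f,g)=L_X(T(f,g))-T(L_Xf,g)-T(f,L_Xg)$. The total order of $T$ is the largest $|a|+|b|$ with $A_{a,b}\neq0$. $\mathcal S^{(2)}_\delta=\bigoplus_{k,l\ge0}\Gamma(\vee^kT\mathbb R^n\otimes\vee^lT\mathbb R^n\otimes\Delta^\delta(\mathbb R^n))$, viewed as polynomials in $\alpha,\beta\in\mathbb R^{n*}$ with $\delta$-densities as coefficients, with $L_XP=\sum_iX^i\partial_iP-\sum_{i,j}(\partial_jX^i)(\alpha_iD_{\alpha_j}+\beta_iD_{\beta_j})P+\delta(\sum_i\partial_iX^i)P$.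 The polynomial form of $T$ is $\sum A_{a,b}\alpha^a\beta^b\in\mathcal S^{(2)}_\delta$; its principal symbol is the homogeneous component of highest total degree of its polynomial form. $sl_{n+1}$ is the Lie algebra of vector fields spanned by $\partial_i$, $x^j\partial_i$, $x^j\sum_ix^i\partial_i$ ($1\le i,j\le n$). A projectively equivariant symbol map is a linear bijection $\sigma:\mathcal M^2_{\mathit{diff}}(\lambda,\mu)\to\mathcal S^{(2)}_\delta$ that preserves the principal symbol (for $T$ of total order $r$, $\sigma(T)$ has degree $r$ and its homogeneous component of total degree $r$ is the principal symbol of $T$) and satisfies $\sigma(L_XT)=L_X(\sigma(T))$ for all $X\in sl_{n+1}$ and all $T$. *)

theory Defs
  imports "HOL-Analysis.Analysis" "HOL-Analysis.Finite_Function_Topology"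
begin

definition partial :: "'n::finite \<Rightarrow> (real^'n \<Rightarrow> real) \<Rightarrow> real^'n \<Rightarrow> real" where
  "partial i f x = frechet_derivative f (at x) (axis i 1)"

definition smooth :: "(real^'n::finite \<Rightarrow> real) \<Rightarrow> bool" where
  "smooth f \<longleftrightarrow> (\<forall>js x. foldr partial js f differentiable (at x))"

lemma smooth_differentiable: "smooth f \<Longrightarrow> f differentiable (at x)"
  unfolding smooth_def by (metis foldr.simps(1) id_apply)

lemma smooth_partial: "smooth f \<Longrightarrow> smooth (partial i f)"
  unfolding smooth_def
proof (intro allI)
  fix js x assume "\<forall>js x. foldr partial js f differentiable (at x)"
  then have "foldr partial (js @ [i]) f differentiable (at x)" by blast
  then show "foldr partial js (partial i f) differentiable (at x)" by simp
qed

lemma has_derivative_smooth: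
  "smooth f \<Longrightarrow> (f has_derivative frechet_derivative f (at x)) (at x)"
  using smooth_differentiable frechet_derivative_works by blast

lemma partial_eqI: "(\<And>x. (f has_derivative f' x) (at x)) \<Longrightarrow> partial i f = (\<lambda>x. f' x (axis i 1))"
  unfolding partial_def by (metis frechet_derivative_at)

lemma partial_add_differentiable:
  assumes "\<And>x. f differentiable (at x)" "\<And>x. g differentiable (at x)"
  shows "partial i (\<lambda>x. f x + g x) = (\<lambda>x. partial i f x + partial i g x)"
  using assms unfolding frechet_derivative_works
  by (intro partial_eqI[THEN trans])
     (auto intro!: derivative_eq_intros simp: partial_def)

lemma partial_add:
  "smooth f \<Longrightarrow> smooth g \<Longrightarrow> partial i (\<lambda>x. f x + g x) = (\<lambda>x. partial i f x + partial i g x)"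
  by (simp add: partial_add_differentiable smooth_differentiable)

lemma partial_mult:
  "smooth f \<Longrightarrow> smooth g \<Longrightarrow>
    partial i (\<lambda>x. f x * g x) = (\<lambda>x. partial i f x * g x + f x * partial i g x)"
  by (rule partial_eqI[THEN trans])
     (auto intro!: derivative_eq_intros has_derivative_smooth simp: partial_def)

lemma partial_const: "partial i (\<lambda>x. c) = (\<lambda>x. 0)"
  by (simp add: partial_def fun_eq_iff)

lemma partial_coord: "partial i (\<lambda>x. x $ j) = (\<lambda>x. if i = j then 1 else 0)"
proof -
  have "((\<lambda>x::real^'a. x $ j) has_derivative (\<lambda>x. x $ j)) (at x)" for x
    by (rule bounded_linear_imp_has_derivative) (simp add: bounded_linear_vec_nth)
  from partial_eqI[OF this] show ?thesis by (auto simp: axis_def)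
qed

lemma smooth_const: "smooth (\<lambda>x. c)"
proof -
  have "\<exists>d. foldr partial js (\<lambda>x::real^'a. c) = (\<lambda>x. d)" for js
    by (induction js) (auto simp: partial_const)
  then show ?thesis unfolding smooth_def by (metis differentiable_const)
qed

lemma smooth_if_partials:
  assumes "\<And>x. f differentiable (at x)" "\<And>i. smooth (partial i f)"
  shows "smooth f"
  unfolding smooth_def
proof (intro allI)
  fix js x
  show "foldr partial js f differentiable (at x)"
    using assms by (cases js rule: rev_cases) (auto simp: smooth_def)
qed

lemma smooth_coord: "smooth (\<lambda>x. x $ j)"
proof (rule smooth_if_partials)
  show "(\<lambda>x::real^'a. x $ j) differentiable (at x)" for x
    by (rule bounded_linear_imp_differentiable) (simp add: bounded_linear_vec_nth)
  show "smooth (partial i (\<lambda>x::real^'a. x $ j))" for i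
    unfolding partial_coord by (rule smooth_const)
qed

lemma foldr_partial_add:
  assumes "\<And>ks x. length ks < n \<Longrightarrow> foldr partial ks f differentiable (at x)"
    and "\<And>ks x. length ks < n \<Longrightarrow> foldr partial ks g differentiable (at x)"
    and "length js \<le> n"
  shows "foldr partial js (\<lambda>x. f x + g x) = (\<lambda>x. foldr partial js f x + foldr partial js g x)"
  using assms(3) by (induction js) (simp_all add: assms(1,2) partial_add_differentiable)

lemma smooth_add: "smooth f \<Longrightarrow> smooth g \<Longrightarrow> smooth (\<lambda>x. f x + g x)"
  unfolding smooth_def
  by (auto simp: foldr_partial_add[OF _ _ order_refl] intro!: differentiable_add)

lemma smooth_mult:
  assumes "smooth f" "smooth g" shows "smooth (\<lambda>x. f x * g x)"
proof -
  have "foldr partial js (\<lambda>x. f x * g x) differentiable (at x)"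
    if "smooth f" "smooth g" for js f x and g :: "real^'a \<Rightarrow> real"
    using that
  proof (induction "length js" arbitrary: js f g x rule: less_induct)
    case less
    show ?case
    proof (cases js rule: rev_cases)
      case Nil
      with less.prems show ?thesis by (auto intro: differentiable_mult smooth_differentiable)
    next
      case (snoc ks i)
      have *: "foldr partial ls (\<lambda>x. partial i f x * g x) differentiable (at y)"
        "foldr partial ls (\<lambda>x. f x * partial i g x) differentiable (at y)"
        if "length ls < length js" for ls y
        using less.hyps[OF that] less.prems smooth_partial by blast+
      have "foldr partial js (\<lambda>x. f x * g x)
          = foldr partial ks (\<lambda>x. partial i f x * g x + f x * partial i g x)"
        using less.prems by (simp add: snoc partial_mult)
      also have "\<dots> = (\<lambda>x. foldr partial ks (\<lambda>x. partial i f x * g x) x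
          + foldr partial ks (\<lambda>x. f x * partial i g x) x)"
        by (rule foldr_partial_add[of "length js"]) (use * snoc in auto)
      finally show ?thesis using * snoc by (auto intro!: differentiable_add)
    qed
  qed
  then show ?thesis using assms unfolding smooth_def by blast
qed

lemma partial_commute:
  assumes f: "smooth f"
  shows "partial i (partial j f) = partial j (partial i f)"
proof
  fix x
  have mixed: "\<exists>s t. 0 < s \<and> s < h \<and> 0 < t \<and> t < h \<and>
      f (x + h *\<^sub>R axis a 1 + h *\<^sub>R axis b 1) - f (x + h *\<^sub>R axis a 1)
        - (f (x + h *\<^sub>R axis b 1) - f x)
      = h * h * partial b (partial a f) (x + s *\<^sub>R axis a 1 + t *\<^sub>R axis b 1)"
    if h: "0 < h" for h :: real and a b
  proof -
    have D: "((\<lambda>s. g (z + s *\<^sub>R axis c 1)) has_real_derivative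
        partial c g (z + s *\<^sub>R axis c 1)) (at s)" if "smooth g" for g z c s
    proof -
      have "((\<lambda>s. g (z + s *\<^sub>R axis c 1)) has_derivative
          (\<lambda>t. frechet_derivative g (at (z + s *\<^sub>R axis c 1)) (t *\<^sub>R axis c 1))) (at s)"
        by (rule has_derivative_compose[OF _ has_derivative_smooth[OF that]])
           (auto intro!: derivative_eq_intros)
      moreover have "linear (frechet_derivative g (at (z + s *\<^sub>R axis c 1)))"
        using that by (simp add: linear_frechet_derivative smooth_differentiable)
      ultimately show ?thesis
        by (simp add: linear_cmul partial_def has_field_derivative_def mult_commute_abs)
    qed
    define \<phi> where "\<phi> s = f ((x + h *\<^sub>R axis b 1) + s *\<^sub>R axis a 1) - f (x + s *\<^sub>R axis a 1)" for s
    have "(\<phi> has_real_derivative (partial a f ((x + h *\<^sub>R axis b 1) + s *\<^sub>R axis a 1)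
        - partial a f (x + s *\<^sub>R axis a 1))) (at s)" for s
      unfolding \<phi>_def by (intro DERIV_diff D f)
    from MVT2[OF h this] obtain s where s: "0 < s" "s < h"
      "\<phi> h - \<phi> 0 = h * (partial a f ((x + h *\<^sub>R axis b 1) + s *\<^sub>R axis a 1)
        - partial a f (x + s *\<^sub>R axis a 1))" by auto
    obtain t where t: "0 < t" "t < h"
      "partial a f ((x + s *\<^sub>R axis a 1) + h *\<^sub>R axis b 1)
        - partial a f ((x + s *\<^sub>R axis a 1) + 0 *\<^sub>R axis b 1)
      = h * partial b (partial a f) ((x + s *\<^sub>R axis a 1) + t *\<^sub>R axis b 1)"
      using MVT2[OF h D[OF smooth_partial[OF f]], of a "x + s *\<^sub>R axis a 1" b] by auto
    have "\<phi> h - \<phi> 0 = h * h * partial b (partial a f) (x + s *\<^sub>R axis a 1 + t *\<^sub>R axis b 1)"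
      using s(3) t(3) by (simp add: algebra_simps)
    with s t show ?thesis by (intro exI[of _ s] exI[of _ t]) (simp add: \<phi>_def algebra_simps)
  qed
  have close: "\<exists>h>0. \<forall>s t. 0 < s \<and> s < h \<and> 0 < t \<and> t < h \<longrightarrow>
      \<bar>g (x + s *\<^sub>R axis a 1 + t *\<^sub>R axis b 1) - g x\<bar> < e"
    if "smooth g" "0 < e" for g e a b
  proof -
    have "isCont g x"
      using smooth_differentiable[OF that(1)] differentiable_imp_continuous_within by blast
    then obtain d where d: "0 < d" "\<And>y. dist y x < d \<Longrightarrow> dist (g y) (g x) < e"
      using \<open>0 < e\<close> unfolding continuous_at_eps_delta by blast
    have "dist (x + s *\<^sub>R axis a 1 + t *\<^sub>R axis b 1) x < d"
      if "0 < s" "s < d/2" "0 < t" "t < d/2" for s t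
    proof -
      have "norm (s *\<^sub>R axis a (1::real) + t *\<^sub>R axis b 1 :: real^'a)
          \<le> norm (s *\<^sub>R axis a (1::real) :: real^'a) + norm (t *\<^sub>R axis b (1::real) :: real^'a)"
        by (rule norm_triangle_ineq)
      also have "\<dots> < d" using that by (simp add: norm_axis_1)
      finally show ?thesis by (simp add: dist_norm algebra_simps)
    qed
    with d show ?thesis by (intro exI[of _ "d/2"]) (auto simp: dist_real_def)
  qed
  let ?p = "partial i (partial j f)" and ?q = "partial j (partial i f)"
  have sm: "smooth ?p" "smooth ?q" by (simp_all add: f smooth_partial)
  show "?p x = ?q x"
  proof (rule ccontr)
    assume "?p x \<noteq> ?q x"
    then have e: "0 < \<bar>?p x - ?q x\<bar> / 2" by simp
    obtain h1 where h1: "0 < h1" "\<And>s t. 0 < s \<and> s < h1 \<and> 0 < t \<and> t < h1 \<Longrightarrow>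
        \<bar>?p (x + s *\<^sub>R axis j 1 + t *\<^sub>R axis i 1) - ?p x\<bar> < \<bar>?p x - ?q x\<bar> / 2"
      using close[OF sm(1) e, of j i] by blast
    obtain h2 where h2: "0 < h2" "\<And>s t. 0 < s \<and> s < h2 \<and> 0 < t \<and> t < h2 \<Longrightarrow>
        \<bar>?q (x + s *\<^sub>R axis i 1 + t *\<^sub>R axis j 1) - ?q x\<bar> < \<bar>?p x - ?q x\<bar> / 2"
      using close[OF sm(2) e, of i j] by blast
    define h where "h = min h1 h2"
    have h: "0 < h" "h \<le> h1" "h \<le> h2" using h1 h2 by (auto simp: h_def)
    obtain s t where st: "0 < s" "s < h" "0 < t" "t < h"
      "f (x + h *\<^sub>R axis j 1 + h *\<^sub>R axis i 1) - f (x + h *\<^sub>R axis j 1) - (f (x + h *\<^sub>R axis i 1) - f x)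
        = h * h * ?p (x + s *\<^sub>R axis j 1 + t *\<^sub>R axis i 1)"
      using mixed[OF h(1), of j i] by blast
    obtain u v where uv: "0 < u" "u < h" "0 < v" "v < h"
      "f (x + h *\<^sub>R axis i 1 + h *\<^sub>R axis j 1) - f (x + h *\<^sub>R axis i 1) - (f (x + h *\<^sub>R axis j 1) - f x)
        = h * h * ?q (x + u *\<^sub>R axis i 1 + v *\<^sub>R axis j 1)"
      using mixed[OF h(1), of i j] by blast
    have comm: "x + h *\<^sub>R axis i 1 + h *\<^sub>R axis j 1 = x + h *\<^sub>R axis j 1 + h *\<^sub>R axis i 1"
      by (simp add: algebra_simps)
    have "h * h * ?p (x + s *\<^sub>R axis j 1 + t *\<^sub>R axis i 1)
        = h * h * ?q (x + u *\<^sub>R axis i 1 + v *\<^sub>R axis j 1)"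
      using st(5) uv(5)[unfolded comm] by linarith
    with h(1) have eq: "?p (x + s *\<^sub>R axis j 1 + t *\<^sub>R axis i 1)
        = ?q (x + u *\<^sub>R axis i 1 + v *\<^sub>R axis j 1)"
      by simp
    have "\<bar>?p (x + s *\<^sub>R axis j 1 + t *\<^sub>R axis i 1) - ?p x\<bar> < \<bar>?p x - ?q x\<bar> / 2"
      using h1(2) st h by auto
    moreover have "\<bar>?q (x + u *\<^sub>R axis i 1 + v *\<^sub>R axis j 1) - ?q x\<bar> < \<bar>?p x - ?q x\<bar> / 2"
      using h2(2) uv h by auto
    moreover have "False" if "\<bar>a - p\<bar> < \<bar>p - q\<bar> / 2" "\<bar>a - q\<bar> < \<bar>p - q\<bar> / 2" for a p q :: real
      using that by (smt (verit) field_sum_of_halves)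
    ultimately show False using eq by metis
  qed
qed

typedef ('n::finite) smooth_fun = "{f :: real^'n \<Rightarrow> real. smooth f}"
  morphisms smooth_fun_apply Smooth_fun
  using smooth_const by blast

setup_lifting type_definition_smooth_fun

instantiation smooth_fun :: (finite) comm_ring_1
begin

lift_definition zero_smooth_fun :: "'a smooth_fun" is "\<lambda>x. 0" by (rule smooth_const)
lift_definition one_smooth_fun :: "'a smooth_fun" is "\<lambda>x. 1" by (rule smooth_const)
lift_definition plus_smooth_fun :: "'a smooth_fun \<Rightarrow> 'a smooth_fun \<Rightarrow> 'a smooth_fun"
  is "\<lambda>f g x. f x + g x" by (rule smooth_add)
lift_definition times_smooth_fun :: "'a smooth_fun \<Rightarrow> 'a smooth_fun \<Rightarrow> 'a smooth_fun"
  is "\<lambda>f g x. f x * g x" by (rule smooth_mult)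
lift_definition uminus_smooth_fun :: "'a smooth_fun \<Rightarrow> 'a smooth_fun"
  is "\<lambda>f x. - f x" using smooth_mult[OF smooth_const[of "-1"]] by simp
lift_definition minus_smooth_fun :: "'a smooth_fun \<Rightarrow> 'a smooth_fun \<Rightarrow> 'a smooth_fun"
  is "\<lambda>f g x. f x - g x"
  using smooth_add smooth_mult[OF smooth_const[of "-1"]] by fastforce

instance
  by standard (transfer, simp add: algebra_simps fun_eq_iff)+

end

instantiation smooth_fun :: (finite) real_algebra_1
begin

lift_definition scaleR_smooth_fun :: "real \<Rightarrow> 'a smooth_fun \<Rightarrow> 'a smooth_fun"
  is "\<lambda>c f x. c * f x" using smooth_mult[OF smooth_const] .

instance
  by standard (transfer, simp add: algebra_simps fun_eq_iff)+

end

lift_definition coord :: "'n::finite \<Rightarrow> 'n smooth_fun" is "\<lambda>i x. x $ i"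
  by (rule smooth_coord)

lift_definition pd :: "'n::finite \<Rightarrow> 'n smooth_fun \<Rightarrow> 'n smooth_fun" is partial
  by (rule smooth_partial)

lemma pd_add: "pd i (f + g) = pd i f + pd i g"
  by transfer (rule partial_add)

lemma pd_mult: "pd i (f * g) = pd i f * g + f * pd i g"
  by transfer (rule partial_mult)

lemma pd_scaleR: "pd i (c *\<^sub>R f) = c *\<^sub>R pd i f"
  by transfer (simp add: partial_mult[OF smooth_const] partial_const)

lemma pd_zero: "pd i 0 = 0"
  by transfer (rule partial_const)

lemma pd_coord: "pd i (coord j) = (if i = j then 1 else 0)"
  by (simp, intro conjI impI; transfer; simp add: partial_coord)

lemma pd_commute: "pd i (pd j f) = pd j (pd i f)"
  by transfer (rule partial_commute)

text \<open>Densities of any weight are identified with smooth functions; the weight only enters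
  through the Lie derivative.\<close>

type_synonym 'n vector_field = "('n smooth_fun, 'n) vec"

definition divergence :: "'n::finite vector_field \<Rightarrow> 'n smooth_fun" where
  "divergence X = (\<Sum>i\<in>UNIV. pd i (X $ i))"

definition lie_density :: "real \<Rightarrow> 'n::finite vector_field \<Rightarrow> 'n smooth_fun \<Rightarrow> 'n smooth_fun" where
  "lie_density l X \<phi> = (\<Sum>i\<in>UNIV. X $ i * pd i \<phi>) + l *\<^sub>R (divergence X * \<phi>)"

definition sl_fields :: "'n::finite vector_field set" where
  "sl_fields = span (range (\<lambda>i. axis i 1)
     \<union> range (\<lambda>(i, j). axis i (coord j))
     \<union> range (\<lambda>j. \<chi> i. coord j * coord i))"

text \<open>A multi-index \<open>a\<close> is the multiset containing each \<open>i\<close> with multiplicity \<open>a\<^sub>i\<close>, so that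
  \<open>size a\<close> is its order. A symbol is a polynomial in \<open>\<alpha>, \<beta>\<close> over the ring of smooth functions,
  given by the finitely supported family of its coefficients at \<open>\<alpha>\<^sup>a \<beta>\<^sup>b\<close>.\<close>

type_synonym 'n symbol = "('n multiset \<times> 'n multiset) \<Rightarrow>\<^sub>0 'n smooth_fun"
type_synonym 'n bioperator = "'n smooth_fun \<Rightarrow> 'n smooth_fun \<Rightarrow> 'n smooth_fun"

definition coeff_const :: "'n::finite smooth_fun \<Rightarrow> 'n symbol" where
  "coeff_const c = Poly_Mapping.single 0 c"

definition alpha :: "'n::finite \<Rightarrow> 'n symbol" where
  "alpha i = Poly_Mapping.single ({#i#}, {#}) 1"

definition beta :: "'n::finite \<Rightarrow> 'n symbol" where
  "beta i = Poly_Mapping.single ({#}, {#i#}) 1"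

definition d_alpha :: "'n::finite \<Rightarrow> 'n symbol \<Rightarrow> 'n symbol" where
  "d_alpha j P = (\<Sum>(a, b)\<in>Poly_Mapping.keys P.
     Poly_Mapping.single (a - {#j#}, b) (of_nat (count a j) * Poly_Mapping.lookup P (a, b)))"

definition d_beta :: "'n::finite \<Rightarrow> 'n symbol \<Rightarrow> 'n symbol" where
  "d_beta j P = (\<Sum>(a, b)\<in>Poly_Mapping.keys P.
     Poly_Mapping.single (a, b - {#j#}) (of_nat (count b j) * Poly_Mapping.lookup P (a, b)))"

definition lie_symbol :: "real \<Rightarrow> 'n::finite vector_field \<Rightarrow> 'n symbol \<Rightarrow> 'n symbol" where
  "lie_symbol \<delta> X P =
     (\<Sum>i\<in>UNIV. coeff_const (X $ i) * Poly_Mapping.map (pd i) P)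
     - (\<Sum>i\<in>UNIV. \<Sum>j\<in>UNIV. coeff_const (pd j (X $ i)) *
          (alpha i * d_alpha j P + beta i * d_beta j P))
     + \<delta> *\<^sub>R (coeff_const (divergence X) * P)"

definition total_degree :: "'n::finite symbol \<Rightarrow> nat" where
  "total_degree P = Max (insert 0 ((\<lambda>(a, b). size a + size b) ` Poly_Mapping.keys P))"

definition homogeneous_component :: "nat \<Rightarrow> 'n::finite symbol \<Rightarrow> 'n symbol" where
  "homogeneous_component r P = (\<Sum>(a, b)\<in>{(a, b) \<in> Poly_Mapping.keys P. size a + size b = r}.
     Poly_Mapping.single (a, b) (Poly_Mapping.lookup P (a, b)))"

definition multi_pd :: "'n::finite multiset \<Rightarrow> 'n smooth_fun \<Rightarrow> 'n smooth_fun" where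
  "multi_pd a f = fold_mset pd f a"

definition bidiff_op :: "'n::finite symbol \<Rightarrow> 'n bioperator" where
  "bidiff_op P f g =
     (\<Sum>(a, b)\<in>Poly_Mapping.keys P. Poly_Mapping.lookup P (a, b) * multi_pd a f * multi_pd b g)"

definition bidiff_ops :: "'n::finite bioperator set" where
  "bidiff_ops = range bidiff_op"

definition polynomial_form :: "'n::finite bioperator \<Rightarrow> 'n symbol" where
  "polynomial_form T = (THE P. bidiff_op P = T)"

text \<open>Well-definedness of the polynomial form: the coefficients of a bidifferential operator are
  recovered by evaluating it on centred monomials.\<close>

interpretation pd: comp_fun_commute pd
  by standard (simp add: fun_eq_iff pd_commute)

lemma multi_pd_empty: "multi_pd {#} f = f"
  by (simp add: multi_pd_def)

lemma multi_pd_add_mset: "multi_pd (add_mset i a) f = multi_pd a (pd i f)"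
  by (simp add: multi_pd_def pd.fold_mset_fun_left_comm)

definition centred_monomial :: "real^'n::finite \<Rightarrow> 'n multiset \<Rightarrow> 'n smooth_fun" where
  "centred_monomial p a = (\<Prod>i\<in>#a. coord i - of_real (p $ i))"

lemma pd_of_real: "pd i (of_real c) = 0"
  unfolding of_real_def pd_scaleR
  by (transfer) (simp add: partial_const)

lemma pd_diff: "pd i (f - g) = pd i f - pd i g"
  using pd_add[of i "f - g" g] by (simp add: algebra_simps)

lemma centred_monomial_add_mset:
  "centred_monomial p (add_mset j a) = (coord j - of_real (p $ j)) * centred_monomial p a"
  by (simp add: centred_monomial_def)

lemma pd_centred_monomial:
  "pd i (centred_monomial p a) = of_nat (count a i) * centred_monomial p (a - {#i#})"
proof (induction a)
  case empty
  show ?case using pd_of_real[of i 1] by (simp add: centred_monomial_def)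
next
  case (add j a)
  have step: "pd i (centred_monomial p (add_mset j a))
      = (if i = j then 1 else 0) * centred_monomial p a
        + (coord j - of_real (p $ j)) * (of_nat (count a i) * centred_monomial p (a - {#i#}))"
    unfolding centred_monomial_add_mset pd_mult add.IH pd_diff pd_coord pd_of_real by simp
  show ?case
  proof (cases "i = j")
    case True
    have "(coord i - of_real (p $ i)) * (of_nat (count a i) * centred_monomial p (a - {#i#}))
        = of_nat (count a i) * centred_monomial p a"
    proof (cases "i \<in># a")
      case True
      then obtain c where "a = add_mset i c" by (meson multi_member_split)
      then show ?thesis by (simp add: centred_monomial_add_mset mult.left_commute)
    qed (simp add: not_in_iff)
    with True show ?thesis unfolding step by (simp add: distrib_right)
  next
    case False
    then have "add_mset j a - {#i#} = add_mset j (a - {#i#})" by simp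
    with False show ?thesis
      unfolding step by (simp add: centred_monomial_add_mset mult.left_commute)
  qed
qed

lemma multi_pd_of_nat_mult: "multi_pd a (of_nat k * f) = of_nat k * multi_pd a f"
proof (induction a arbitrary: f)
  case (add i a)
  have "pd i (of_nat k * f) = of_nat k * pd i f"
    using pd_scaleR[of i "real k" f] by (simp add: scaleR_conv_of_real)
  then show ?case by (simp add: multi_pd_add_mset add)
qed (simp add: multi_pd_empty)

lemma smooth_fun_apply_simps:
  "smooth_fun_apply (f * g) x = smooth_fun_apply f x * smooth_fun_apply g x"
  "smooth_fun_apply (f + g) x = smooth_fun_apply f x + smooth_fun_apply g x"
  "smooth_fun_apply (f - g) x = smooth_fun_apply f x - smooth_fun_apply g x"
  "smooth_fun_apply 0 x = 0" "smooth_fun_apply 1 x = 1"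
  "smooth_fun_apply (c *\<^sub>R f) x = c * smooth_fun_apply f x"
  "smooth_fun_apply (coord i) x = x $ i"
  by (transfer, simp)+

lemma smooth_fun_apply_of_real: "smooth_fun_apply (of_real c) x = c"
  by (simp add: of_real_def smooth_fun_apply_simps)

lemma smooth_fun_apply_of_nat: "smooth_fun_apply (of_nat k) x = real k"
  using smooth_fun_apply_of_real[of "real k" x] by simp

lemma smooth_fun_apply_sum: "smooth_fun_apply (\<Sum>i\<in>A. f i) x = (\<Sum>i\<in>A. smooth_fun_apply (f i) x)"
  by (induction A rule: infinite_finite_induct) (simp_all add: smooth_fun_apply_simps)

lemma multi_pd_centred_monomial:
  "smooth_fun_apply (multi_pd a (centred_monomial p b)) p \<noteq> 0 \<longleftrightarrow> a = b"
proof (induction a arbitrary: b)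
  case empty
  show ?case
    by (cases b) (auto simp: multi_pd_empty centred_monomial_def smooth_fun_apply_simps
        smooth_fun_apply_of_real)
next
  case (add i a)
  have "smooth_fun_apply (multi_pd (add_mset i a) (centred_monomial p b)) p \<noteq> 0
      \<longleftrightarrow> count b i \<noteq> 0 \<and> a = b - {#i#}"
    by (simp add: multi_pd_add_mset pd_centred_monomial multi_pd_of_nat_mult
        smooth_fun_apply_simps smooth_fun_apply_of_nat add)
  also have "\<dots> \<longleftrightarrow> add_mset i a = b"
    by (auto simp: insert_DiffM)
  finally show ?case .
qed

lemma inj_bidiff_op: "inj (bidiff_op :: 'n::finite symbol \<Rightarrow> _)"
proof (rule injI)
  fix P Q :: "'n symbol"
  assume PQ: "bidiff_op P = bidiff_op Q"
  let ?m = centred_monomial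
  have ev: "smooth_fun_apply (bidiff_op P (?m p a) (?m p b)) p
      = smooth_fun_apply (Poly_Mapping.lookup P (a, b)) p
        * (smooth_fun_apply (multi_pd a (?m p a)) p * smooth_fun_apply (multi_pd b (?m p b)) p)"
    for P :: "'n symbol" and p a b
  proof -
    have "smooth_fun_apply (bidiff_op P (?m p a) (?m p b)) p
      = (\<Sum>k\<in>Poly_Mapping.keys P. smooth_fun_apply (Poly_Mapping.lookup P k) p
          * (smooth_fun_apply (multi_pd (fst k) (?m p a)) p
             * smooth_fun_apply (multi_pd (snd k) (?m p b)) p))"
      by (simp add: bidiff_op_def smooth_fun_apply_sum smooth_fun_apply_simps case_prod_beta mult.assoc)
    also have "\<dots> = (\<Sum>k\<in>Poly_Mapping.keys P. if k = (a, b) then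
        smooth_fun_apply (Poly_Mapping.lookup P (a, b)) p
        * (smooth_fun_apply (multi_pd a (?m p a)) p
           * smooth_fun_apply (multi_pd b (?m p b)) p) else 0)"
      using multi_pd_centred_monomial by (intro sum.cong) (auto simp: prod_eq_iff)
    also have "\<dots> = smooth_fun_apply (Poly_Mapping.lookup P (a, b)) p
        * (smooth_fun_apply (multi_pd a (?m p a)) p * smooth_fun_apply (multi_pd b (?m p b)) p)"
      by (simp add: smooth_fun_apply_simps in_keys_iff)
    finally show ?thesis .
  qed
  have "smooth_fun_apply (Poly_Mapping.lookup P (a, b)) p
      = smooth_fun_apply (Poly_Mapping.lookup Q (a, b)) p" for a b p
    using ev[of P p a b] ev[of Q p a b] PQ multi_pd_centred_monomial by auto
  then show "P = Q"
    by (intro poly_mapping_eqI) (metis smooth_fun_apply_inject ext surj_pair)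
qed

lemma polynomial_form_bidiff_op: "polynomial_form (bidiff_op P) = P"
  unfolding polynomial_form_def using inj_bidiff_op by (auto dest: injD)

definition total_order :: "'n::finite bioperator \<Rightarrow> nat" where
  "total_order T = total_degree (polynomial_form T)"

definition principal_symbol :: "'n::finite bioperator \<Rightarrow> 'n symbol" where
  "principal_symbol T = homogeneous_component (total_order T) (polynomial_form T)"

definition lie_op ::
    "real \<Rightarrow> real \<Rightarrow> real \<Rightarrow> 'n::finite vector_field \<Rightarrow> 'n bioperator \<Rightarrow> 'n bioperator" where
  "lie_op l1 l2 m X T = (\<lambda>f g. lie_density m X (T f g)
     - T (lie_density l1 X f) g - T f (lie_density l2 X g))"

text \<open>The map is only constrained on bidifferential operators; its values on other elements of
  the type are irrelevant. With \<open>total_order 0 = 0\<close>, preservation of the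
  principal symbol is automatic for the zero operator.\<close>

definition proj_equiv_symbol_map ::
    "real \<Rightarrow> real \<Rightarrow> real \<Rightarrow> ('n::finite bioperator \<Rightarrow> 'n symbol) \<Rightarrow> bool" where
  "proj_equiv_symbol_map l1 l2 m \<sigma> \<longleftrightarrow>
     (\<forall>S\<in>bidiff_ops. \<forall>T\<in>bidiff_ops. \<sigma> (\<lambda>f g. S f g + T f g) = \<sigma> S + \<sigma> T) \<and>
     (\<forall>c. \<forall>T\<in>bidiff_ops. \<sigma> (\<lambda>f g. c *\<^sub>R T f g) = c *\<^sub>R \<sigma> T) \<and>
     bij_betw \<sigma> bidiff_ops UNIV \<and>
     (\<forall>T\<in>bidiff_ops. total_degree (\<sigma> T) = total_order T \<and>
        homogeneous_component (total_order T) (\<sigma> T) = principal_symbol T) \<and>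
     (\<forall>X\<in>sl_fields. \<forall>T\<in>bidiff_ops. \<sigma> (lie_op l1 l2 m X T) = lie_symbol (m - l1 - l2) X (\<sigma> T))"

end

theory Submission
  imports Defs
begin

text \<open>
  Identify a bidifferential operator with its polynomial form, so that the Lie derivatives of
  operators and of symbols act on the same space of polynomials in \<open>\<alpha>, \<beta>\<close>. They agree on the
  affine fields \<open>\<partial>\<^sub>i\<close> and \<open>x\<^sup>j \<partial>\<^sub>i\<close>. On the quadratic field with components \<open>x\<^sup>h x\<^sup>i\<close> they
  differ by the defect
  \<open>(K + \<lambda>\<^sub>1 (n + 1)) D\<^bsub>\<alpha> h\<^esub> + (L + \<lambda>\<^sub>2 (n + 1)) D\<^bsub>\<beta> h\<^esub>\<close>, where \<open>K\<close> and \<open>L\<close> are the degrees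
  in \<open>\<alpha>\<close> and in \<open>\<beta>\<close>.

  Necessity. A symbol map commutes with the translations and with the Euler field, so it fixes
  the constant symbols of degree one. For \<open>\<delta> = 1\<close> the Lie derivatives of the \<open>\<alpha>\<^sub>h\<close> along the
  quadratic fields add up to zero over \<open>h\<close>, while the defects add up to the constant
  \<open>n (n + 1) \<lambda>\<^sub>1\<close>. Equivariance makes the symbol map send the first sum minus the second to the
  first sum, which is zero; it is injective, so \<open>\<lambda>\<^sub>1 = 0\<close>. In the same way \<open>\<lambda>\<^sub>2 = 0\<close>
  (\<open>symbol_map_obstruction\<close>, \<open>weights_vanish\<close>).

  Existence. For \<open>\<lambda> = (0, 0)\<close>, half the Casimir operator of the projective algebra is an
  operator \<open>C\<close> of order zero on symbols and \<open>C + G\<close> on operators, with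
  \<open>G = \<Sum>\<^sub>h defect\<^sub>h \<partial>\<^sub>h\<close>. The Lie algebra \<open>gl(2)\<close> that mixes \<open>\<alpha>\<close> and \<open>\<beta>\<close> commutes with the
  Lie derivative of symbols, and \<open>C\<close> is expressed by its Casimir operator; on the component of
  degree \<open>d\<close> that belongs to the Young diagram with rows \<open>(d - j, j)\<close> it is the scalar
  \<open>d\<^sup>2 - d - j (d + 1 - j)\<close>. A derivative in \<open>\<alpha>\<close> or \<open>\<beta>\<close> removes one box from the diagram, and
  this lowers the eigenvalue strictly, except for the steps \<open>(1, 1) \<rightarrow> (1, 0) \<rightarrow> (0, 0)\<close>. On those
  two diagrams the defect vanishes, because \<open>\<lambda> = (0, 0)\<close>. Hence \<open>G\<close> strictly lowers the
  eigenvalue of \<open>C\<close> (\<open>defect_lowers\<close>), every eigenvector of \<open>C\<close> has a unique correction of lower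
  degree and lower eigenvalue to an eigenvector of \<open>C + G\<close>, and uniqueness makes the map \<open>Q\<close>
  that takes a symbol to its correction equivariant (\<open>intertwining_correction\<close>). Its inverse is
  a symbol map.

  Non-uniqueness. For \<open>\<delta> = 1\<close> the divergence, applied to the part of degree one in \<open>\<alpha>\<close>, is an
  equivariant map \<open>N\<close> into degree zero (\<open>divergence_intertwiner\<close>); the inverse of
  \<open>Q \<circ> (1 + N)\<close> is a second symbol map.
\<close>

section \<open>Linear operators on symbols\<close>

lemma lookup_scaleR:
  "Poly_Mapping.lookup (c *\<^sub>R P) k = c *\<^sub>R Poly_Mapping.lookup P k"
proof -
  have "finite {i. c *\<^sub>R Poly_Mapping.lookup P i \<noteq> 0}"
    by (rule finite_subset[of _ "Poly_Mapping.keys P"]) (auto simp: in_keys_iff)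
  then show ?thesis by (simp add: scaleR_poly_mapping_def)
qed

lemma scaleR_single: "c *\<^sub>R Poly_Mapping.single k f = Poly_Mapping.single k (c *\<^sub>R f)"
  by (rule poly_mapping_eqI) (simp add: lookup_scaleR lookup_single when_def)

lemma symbol_sum_singles:
  "P = (\<Sum>k\<in>Poly_Mapping.keys P. Poly_Mapping.single k (Poly_Mapping.lookup P k))"
  by (rule poly_mapping_eqI) (simp add: lookup_sum lookup_single when_def in_keys_iff)

lemma linear_symbol_eqI:
  fixes F G :: "'n::finite symbol \<Rightarrow> 'b::real_vector"
  assumes "linear F" "linear G"
    and "\<And>a b f. F (Poly_Mapping.single (a, b) f) = G (Poly_Mapping.single (a, b) f)"
  shows "F P = G P"
proof -
  have "F (\<Sum>k\<in>Poly_Mapping.keys P. Poly_Mapping.single k (Poly_Mapping.lookup P k))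
      = G (\<Sum>k\<in>Poly_Mapping.keys P. Poly_Mapping.single k (Poly_Mapping.lookup P k))"
    unfolding linear_sum[OF assms(1)] linear_sum[OF assms(2)]
    by (intro sum.cong refl) (metis assms(3) surj_pair)
  then show ?thesis by (simp add: symbol_sum_singles[symmetric])
qed

text \<open>The operators of the proof form a noncommutative real algebra. As a type of its own it makes
  their relations identities between ring elements, open to distributivity and to a calculus of
  commutators, without sums over arguments.\<close>

typedef ('n::finite) symbol_endo = "{F :: 'n symbol \<Rightarrow> 'n symbol. linear F}"
  morphisms act Endo
  using linear_zero by blast

setup_lifting type_definition_symbol_endo

lemma linear_act: "linear (act F)"
  using act by simp

instantiation symbol_endo :: (finite) real_algebra_1
begin

lift_definition zero_symbol_endo :: "'a symbol_endo" is "\<lambda>P. 0" by (rule linear_zero)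
lift_definition one_symbol_endo :: "'a symbol_endo" is "\<lambda>P. P" by (rule linear_ident)
lift_definition plus_symbol_endo :: "'a symbol_endo \<Rightarrow> 'a symbol_endo \<Rightarrow> 'a symbol_endo"
  is "\<lambda>F G P. F P + G P" by (rule linear_compose_add)
lift_definition minus_symbol_endo :: "'a symbol_endo \<Rightarrow> 'a symbol_endo \<Rightarrow> 'a symbol_endo"
  is "\<lambda>F G P. F P - G P" by (rule linear_compose_sub)
lift_definition uminus_symbol_endo :: "'a symbol_endo \<Rightarrow> 'a symbol_endo"
  is "\<lambda>F P. - F P" by (rule linear_compose_neg)
lift_definition scaleR_symbol_endo :: "real \<Rightarrow> 'a symbol_endo \<Rightarrow> 'a symbol_endo"
  is "\<lambda>c F P. c *\<^sub>R F P" by (rule linear_compose_scale_right)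
lift_definition times_symbol_endo :: "'a symbol_endo \<Rightarrow> 'a symbol_endo \<Rightarrow> 'a symbol_endo"
  is "\<lambda>F G P. F (G P)" using linear_compose[unfolded o_def] by blast

instance
proof
  show "(0::'a symbol_endo) \<noteq> 1"
    by transfer (metis zero_neq_one)
qed (simp_all add: act_inject[symmetric] fun_eq_iff plus_symbol_endo.rep_eq times_symbol_endo.rep_eq
    one_symbol_endo.rep_eq zero_symbol_endo.rep_eq minus_symbol_endo.rep_eq uminus_symbol_endo.rep_eq
    scaleR_symbol_endo.rep_eq linear_act linear_add[OF linear_act] linear_cmul[OF linear_act]
    algebra_simps)

end

lemmas act_add = linear_add[OF linear_act] and act_diff = linear_diff[OF linear_act]
  and act_scaleR = linear_cmul[OF linear_act] and act_sum_right = linear_sum[OF linear_act]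
  and act_zero = linear_0[OF linear_act]

lemma act_simps:
  "act 0 P = 0" "act 1 P = P" "act (F + G) P = act F P + act G P"
  "act (F - G) P = act F P - act G P" "act (- F) P = - act F P"
  "act (c *\<^sub>R F) P = c *\<^sub>R act F P" "act (F * G) P = act F (act G P)"
  by (simp_all add: plus_symbol_endo.rep_eq times_symbol_endo.rep_eq one_symbol_endo.rep_eq
    zero_symbol_endo.rep_eq minus_symbol_endo.rep_eq uminus_symbol_endo.rep_eq scaleR_symbol_endo.rep_eq)

lemma act_of_real: "act (of_real c) P = c *\<^sub>R P"
  by (simp add: of_real_def act_simps)

lemma act_of_nat: "act (of_nat k) P = real k *\<^sub>R P"
  using act_of_real[of "real k"] by simp

lemma act_sum: "act (\<Sum>i\<in>I. F i) P = (\<Sum>i\<in>I. act (F i) P)"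
  by (induction I rule: infinite_finite_induct) (simp_all add: act_simps)

lemma symbol_endo_eqI:
  "(\<And>a b f. act F (Poly_Mapping.single (a, b) f) = act G (Poly_Mapping.single (a, b) f)) \<Longrightarrow> F = G"
  by (metis act_inject ext linear_act linear_symbol_eqI)

lemma sum_keys_superset:
  fixes h :: "'k \<Rightarrow> 'v::zero \<Rightarrow> 'w::real_vector"
  assumes "\<And>k. h k 0 = 0" "finite I" "Poly_Mapping.keys P \<subseteq> I"
  shows "(\<Sum>k\<in>Poly_Mapping.keys P. h k (Poly_Mapping.lookup P k)) = (\<Sum>k\<in>I. h k (Poly_Mapping.lookup P k))"
  using assms by (intro sum.mono_neutral_left) (auto simp: in_keys_iff)

text \<open>The shape of all maps that are defined monomial by monomial: derivatives in the fibre
  variables and the evaluation of a symbol as an operator.\<close>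

lemma linear_keys_sum:
  fixes h :: "'k \<Rightarrow> 'v::real_vector \<Rightarrow> 'w::real_vector"
  assumes "\<And>k. linear (h k)"
  shows "linear (\<lambda>P. \<Sum>k\<in>Poly_Mapping.keys P. h k (Poly_Mapping.lookup P k))"
proof (rule linearI)
  note h0 = linear_0[OF assms]
  fix P Q :: "'k \<Rightarrow>\<^sub>0 'v" and c :: real
  let ?I = "Poly_Mapping.keys P \<union> Poly_Mapping.keys Q"
  have "(\<Sum>k\<in>Poly_Mapping.keys (P + Q). h k (Poly_Mapping.lookup (P + Q) k))
      = (\<Sum>k\<in>?I. h k (Poly_Mapping.lookup (P + Q) k))"
    by (rule sum_keys_superset) (use h0 keys_add[of P Q] in auto)
  also have "\<dots> = (\<Sum>k\<in>?I. h k (Poly_Mapping.lookup P k)) + (\<Sum>k\<in>?I. h k (Poly_Mapping.lookup Q k))"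
    by (simp add: lookup_add linear_add[OF assms] sum.distrib)
  finally show "(\<Sum>k\<in>Poly_Mapping.keys (P + Q). h k (Poly_Mapping.lookup (P + Q) k))
      = (\<Sum>k\<in>Poly_Mapping.keys P. h k (Poly_Mapping.lookup P k))
      + (\<Sum>k\<in>Poly_Mapping.keys Q. h k (Poly_Mapping.lookup Q k))"
    using sum_keys_superset[of h ?I P] sum_keys_superset[of h ?I Q] h0 by simp
  have "(\<Sum>k\<in>Poly_Mapping.keys (c *\<^sub>R P). h k (Poly_Mapping.lookup (c *\<^sub>R P) k))
      = (\<Sum>k\<in>Poly_Mapping.keys P. h k (Poly_Mapping.lookup (c *\<^sub>R P) k))"
    by (rule sum_keys_superset) (use h0 in \<open>auto simp: in_keys_iff lookup_scaleR\<close>)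
  then show "(\<Sum>k\<in>Poly_Mapping.keys (c *\<^sub>R P). h k (Poly_Mapping.lookup (c *\<^sub>R P) k))
      = c *\<^sub>R (\<Sum>k\<in>Poly_Mapping.keys P. h k (Poly_Mapping.lookup P k))"
    by (simp add: lookup_scaleR linear_cmul[OF assms] scaleR_sum_right)
qed

lemma keys_sum_single:
  assumes "h k 0 = 0"
  shows "(\<Sum>k\<in>Poly_Mapping.keys (Poly_Mapping.single k f).
     h k (Poly_Mapping.lookup (Poly_Mapping.single k f) k)) = h k f"
  using assms by (cases "f = 0") auto

lemma linear_single: "linear (Poly_Mapping.single k)"
  by (rule linearI) (simp_all add: single_add scaleR_single)

lemma linear_of_nat_mult: "linear (\<lambda>f::'n::finite smooth_fun. of_nat m * f)"
  by (rule linearI) (simp_all add: distrib_left)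

lemma d_alpha_eq: "d_alpha j P = (\<Sum>k\<in>Poly_Mapping.keys P.
    (\<lambda>k f. Poly_Mapping.single (fst k - {#j#}, snd k) (of_nat (count (fst k) j) * f)) k (Poly_Mapping.lookup P k))"
  by (simp add: d_alpha_def case_prod_beta)

lemma d_beta_eq: "d_beta j P = (\<Sum>k\<in>Poly_Mapping.keys P.
    (\<lambda>k f. Poly_Mapping.single (fst k, snd k - {#j#}) (of_nat (count (snd k) j) * f)) k (Poly_Mapping.lookup P k))"
  by (simp add: d_beta_def case_prod_beta)

lemma linear_d_alpha: "linear (d_alpha j)"
  unfolding d_alpha_eq
  by (rule linear_keys_sum)
     (use linear_compose[OF linear_of_nat_mult linear_single] in \<open>simp add: o_def\<close>)

lemma linear_d_beta: "linear (d_beta j)"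
  unfolding d_beta_eq
  by (rule linear_keys_sum)
     (use linear_compose[OF linear_of_nat_mult linear_single] in \<open>simp add: o_def\<close>)

lemma d_alpha_single:
  "d_alpha j (Poly_Mapping.single (a, b) f) = Poly_Mapping.single (a - {#j#}, b) (of_nat (count a j) * f)"
  unfolding d_alpha_eq
  using keys_sum_single[of "\<lambda>k f. Poly_Mapping.single (fst k - {#j#}, snd k) (of_nat (count (fst k) j) * f)"]
  by simp

lemma d_beta_single:
  "d_beta j (Poly_Mapping.single (a, b) f) = Poly_Mapping.single (a, b - {#j#}) (of_nat (count b j) * f)"
  unfolding d_beta_eq
  using keys_sum_single[of "\<lambda>k f. Poly_Mapping.single (fst k, snd k - {#j#}) (of_nat (count (snd k) j) * f)"]
  by simp

lemma linear_map_pd: "linear (Poly_Mapping.map (pd i) :: 'n::finite symbol \<Rightarrow> _)"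
proof -
  have *: "Poly_Mapping.lookup (Poly_Mapping.map (pd i) P) k = pd i (Poly_Mapping.lookup P k)"
    for P :: "'n symbol" and k
    by (simp add: Poly_Mapping.map.rep_eq when_def pd_zero)
  show ?thesis
    by (rule linearI) (rule poly_mapping_eqI, simp add: * lookup_add pd_add lookup_scaleR pd_scaleR)+
qed

lemma map_pd_single:
  "Poly_Mapping.map (pd i) (Poly_Mapping.single k f) = Poly_Mapping.single k (pd i f)"
  by (rule map_single) (rule pd_zero)

lemma scaleR_symbol_mult: "c *\<^sub>R P = Poly_Mapping.single 0 (of_real c) * (P :: 'n::finite symbol)"
  unfolding mult_map_scale_conv_mult[symmetric]
  by (rule poly_mapping_eqI)
     (simp add: lookup_scaleR Poly_Mapping.map.rep_eq when_def scaleR_conv_of_real)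

lemma linear_symbol_mult: "linear ((*) (P :: 'n::finite symbol))"
  by (rule linearI) (simp_all add: scaleR_symbol_mult distrib_left mult.left_commute)

section \<open>The Weyl algebra of the symbols\<close>

text \<open>The generators \<open>mA, mB, mX\<close> multiply by \<open>\<alpha>\<^sub>i\<close>, \<open>\<beta>\<^sub>i\<close> and the coordinate \<open>x\<^sup>i\<close>, while
  \<open>dA, dB, dX\<close> differentiate in these variables. All projective Lie derivatives are
  noncommutative polynomials in them, so that the canonical commutation relations suffice for
  every identity below.\<close>

definition mult_op :: "'n::finite symbol \<Rightarrow> 'n symbol_endo" where "mult_op P = Endo ((*) P)"
definition dA :: "'n::finite \<Rightarrow> 'n symbol_endo" where "dA i = Endo (d_alpha i)"
definition dB :: "'n::finite \<Rightarrow> 'n symbol_endo" where "dB i = Endo (d_beta i)"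
definition dX :: "'n::finite \<Rightarrow> 'n symbol_endo" where "dX i = Endo (Poly_Mapping.map (pd i))"

lemma act_basic:
  "act (mult_op P) Q = P * Q" "act (dA i) Q = d_alpha i Q" "act (dB i) Q = d_beta i Q"
  "act (dX i) Q = Poly_Mapping.map (pd i) Q"
  by (simp_all add: mult_op_def dA_def dB_def dX_def Endo_inverse linear_symbol_mult linear_d_alpha
      linear_d_beta linear_map_pd)

definition mA :: "'n::finite \<Rightarrow> 'n symbol_endo" where "mA i = mult_op (alpha i)"
definition mB :: "'n::finite \<Rightarrow> 'n symbol_endo" where "mB i = mult_op (beta i)"
definition mX :: "'n::finite \<Rightarrow> 'n symbol_endo" where "mX i = mult_op (coeff_const (coord i))"

lemma act_weyl_single:
  "act (mA i) (Poly_Mapping.single (a, b) f) = Poly_Mapping.single (add_mset i a, b) f"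
  "act (mB i) (Poly_Mapping.single (a, b) f) = Poly_Mapping.single (a, add_mset i b) f"
  "act (mX i) (Poly_Mapping.single (a, b) f) = Poly_Mapping.single (a, b) (coord i * f)"
  "act (dA i) (Poly_Mapping.single (a, b) f) = Poly_Mapping.single (a - {#i#}, b) (of_nat (count a i) * f)"
  "act (dB i) (Poly_Mapping.single (a, b) f) = Poly_Mapping.single (a, b - {#i#}) (of_nat (count b i) * f)"
  "act (dX i) (Poly_Mapping.single (a, b) f) = Poly_Mapping.single (a, b) (pd i f)"
  by (simp_all add: mA_def mB_def mX_def act_basic alpha_def
      beta_def coeff_const_def mult_single d_alpha_single d_beta_single map_pd_single)

definition commutator :: "'a::ring \<Rightarrow> 'a \<Rightarrow> 'a" where
  "commutator F G = F * G - G * F"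

lemma commutator_mult: "commutator F (G * H) = commutator F G * H + G * commutator F H" "commutator (F * G) H = F * commutator G H + commutator F H * G"
  by (simp_all add: commutator_def algebra_simps)

lemma commutator_linear:
  "commutator F (G + H) = commutator F G + commutator F H" "commutator (F + G) H = commutator F H + commutator G H"
  "commutator F (G - H) = commutator F G - commutator F H" "commutator (F - G) H = commutator F H - commutator G H"
  "commutator F (- G) = - commutator F G" "commutator (- F) G = - commutator F G" "commutator F 0 = 0" "commutator 0 F = 0"
  by (simp_all add: commutator_def algebra_simps)

lemma commutator_one: "commutator F (1::'a::ring_1) = 0" "commutator (1::'a::ring_1) F = 0"
  by (simp_all add: commutator_def)

lemma commutator_sum: "commutator F (\<Sum>i\<in>I. G i) = (\<Sum>i\<in>I. commutator F (G i))" "commutator (\<Sum>i\<in>I. G i) F = (\<Sum>i\<in>I. commutator (G i) F)"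
  by (simp_all add: commutator_def sum_distrib_left sum_distrib_right sum_subtractf)

lemma commutator_self: "commutator F F = 0"
  by (simp add: commutator_def)

lemma commutator_swap: "commutator G F = - commutator F G"
  by (simp add: commutator_def)

lemma commutator_eq_0D: "commutator F G = 0 \<Longrightarrow> F * G = G * F"
  by (simp add: commutator_def)

lemma commutator_eqI:
  assumes "\<And>a b f. act F (act G (Poly_Mapping.single (a, b) f)) - act G (act F (Poly_Mapping.single (a, b) f))
    = act H (Poly_Mapping.single (a, b) f)"
  shows "commutator F G = H"
  by (rule symbol_endo_eqI) (simp add: commutator_def act_simps assms)

lemma pd_of_nat_mult: "pd i (of_nat k * f) = of_nat k * pd i f"
  using pd_scaleR[of i "real k" f] by (simp add: scaleR_conv_of_real)

lemma single_minus_single: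
  "Poly_Mapping.single k f - Poly_Mapping.single k g = Poly_Mapping.single k (f - g :: 'a::ab_group_add)"
  by (simp add: single_diff)

lemma commutator_dA_dA_single:
  "Poly_Mapping.single (a - {#j#} - {#i#}, b) (of_nat (count (a - {#j#}) i) * (of_nat (count a j) * f))
  = Poly_Mapping.single (a - {#i#} - {#j#}, b) (of_nat (count (a - {#i#}) j) * (of_nat (count a i) * (f::'n::finite smooth_fun)))"
  by (cases "i = j") (simp_all add: diff_right_commute mult.left_commute add_mset_commute)

lemma commutator_dB_dB_single:
  "Poly_Mapping.single (a, b - {#j#} - {#i#}) (of_nat (count (b - {#j#}) i) * (of_nat (count b j) * f))
  = Poly_Mapping.single (a, b - {#i#} - {#j#}) (of_nat (count (b - {#i#}) j) * (of_nat (count b i) * (f::'n::finite smooth_fun)))"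
  by (cases "i = j") (simp_all add: diff_right_commute mult.left_commute add_mset_commute)

lemma weyl_commute:
  "commutator (mA i) (mA j) = 0" "commutator (mA i) (mB j) = 0" "commutator (mA i) (mX j) = 0" "commutator (mA i) (dB j) = 0" "commutator (mA i) (dX j) = 0"
  "commutator (mB i) (mA j) = 0" "commutator (mB i) (mB j) = 0" "commutator (mB i) (mX j) = 0" "commutator (mB i) (dA j) = 0" "commutator (mB i) (dX j) = 0"
  "commutator (mX i) (mA j) = 0" "commutator (mX i) (mB j) = 0" "commutator (mX i) (mX j) = 0" "commutator (mX i) (dA j) = 0" "commutator (mX i) (dB j) = 0"
  "commutator (dA i) (mB j) = 0" "commutator (dA i) (mX j) = 0" "commutator (dA i) (dA j) = 0" "commutator (dA i) (dB j) = 0" "commutator (dA i) (dX j) = 0"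
  "commutator (dB i) (mA j) = 0" "commutator (dB i) (mX j) = 0" "commutator (dB i) (dA j) = 0" "commutator (dB i) (dB j) = 0" "commutator (dB i) (dX j) = 0"
  "commutator (dX i) (mA j) = 0" "commutator (dX i) (mB j) = 0" "commutator (dX i) (dA j) = 0" "commutator (dX i) (dB j) = 0" "commutator (dX i) (dX j) = 0"
  by (rule commutator_eqI, simp add: act_weyl_single act_simps pd_of_nat_mult mult.left_commute add_mset_commute
      commutator_dA_dA_single commutator_dB_dB_single pd_commute; (simp add: pd_commute)?)+

lemma weyl_heisenberg:
  "commutator (dA i) (mA j) = (if i = j then 1 else 0)" "commutator (dB i) (mB j) = (if i = j then 1 else 0)"
  "commutator (dX i) (mX j) = (if i = j then 1 else 0)"
proof -
  have *: "of_nat (count a i) * f = 0 \<or> i \<in># a" for a and f :: "'a smooth_fun"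
    by (auto simp: not_in_iff)
  show "commutator (dA i) (mA j) = (if i = j then 1 else 0)"
  proof (rule commutator_eqI)
    fix a b :: "'a multiset" and f :: "'a smooth_fun"
    show "act (dA i) (act (mA j) (Poly_Mapping.single (a, b) f)) - act (mA j) (act (dA i) (Poly_Mapping.single (a, b) f))
      = act (if i = j then 1 else 0) (Poly_Mapping.single (a, b) f)"
      using *[of a f]
      by (auto simp: act_weyl_single act_simps single_minus_single single_add algebra_simps)
  qed
  show "commutator (dB i) (mB j) = (if i = j then 1 else 0)"
  proof (rule commutator_eqI)
    fix a b :: "'a multiset" and f :: "'a smooth_fun"
    show "act (dB i) (act (mB j) (Poly_Mapping.single (a, b) f)) - act (mB j) (act (dB i) (Poly_Mapping.single (a, b) f))
      = act (if i = j then 1 else 0) (Poly_Mapping.single (a, b) f)"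
      using *[of b f]
      by (auto simp: act_weyl_single act_simps single_minus_single single_add algebra_simps)
  qed
  show "commutator (dX i) (mX j) = (if i = j then 1 else 0)"
    by (rule commutator_eqI) (simp add: act_weyl_single act_simps single_minus_single pd_mult pd_coord)
qed

lemma weyl_heisenberg_swap:
  "commutator (mA j) (dA i) = (if i = j then - 1 else 0)" "commutator (mB j) (dB i) = (if i = j then - 1 else 0)"
  "commutator (mX j) (dX i) = (if i = j then - 1 else 0)"
  using weyl_heisenberg[of i j, THEN arg_cong[of _ _ uminus]] by (auto simp: commutator_def)

lemmas weyl = weyl_commute weyl_heisenberg weyl_heisenberg_swap

section \<open>The action of gl(2) and its Casimir operator\<close>

text \<open>The degrees in \<open>\<alpha>\<close> and \<open>\<beta>\<close> together with the two operators that replace one \<open>\<beta>\<close> by an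
  \<open>\<alpha>\<close> or conversely span \<open>gl(2)\<close>. In each total degree the operator \<open>gl2_casimir\<close> is an affine function
  of the quadratic Casimir operator, normalised to vanish on the symbols that depend on \<open>\<alpha>\<close>
  only.\<close>

definition deg_alpha :: "'n::finite symbol_endo" where "deg_alpha = (\<Sum>i\<in>UNIV. mA i * dA i)"
definition deg_beta :: "'n::finite symbol_endo" where "deg_beta = (\<Sum>i\<in>UNIV. mB i * dB i)"
definition beta_to_alpha :: "'n::finite symbol_endo" where "beta_to_alpha = (\<Sum>i\<in>UNIV. mA i * dB i)"
definition alpha_to_beta :: "'n::finite symbol_endo" where "alpha_to_beta = (\<Sum>i\<in>UNIV. mB i * dA i)"
definition gl2_casimir :: "'n::finite symbol_endo" where "gl2_casimir = deg_beta * (deg_alpha + 1) - alpha_to_beta * beta_to_alpha"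
definition deg_total :: "'n::finite symbol_endo" where "deg_total = deg_alpha + deg_beta"

lemma sum_delta_op:
  fixes g :: "'n::finite \<Rightarrow> 'a::ring_1"
  shows "(\<Sum>i\<in>UNIV. g i * (if i = j then 1 else 0)) = g j"
    "(\<Sum>i\<in>UNIV. g i * (if j = i then 1 else 0)) = g j"
    "(\<Sum>i\<in>UNIV. (if i = j then 1 else 0) * g i) = g j"
    "(\<Sum>i\<in>UNIV. (if j = i then 1 else 0) * g i) = g j"
    "(\<Sum>i\<in>UNIV. g i * (if i = j then - 1 else 0)) = - g j"
    "(\<Sum>i\<in>UNIV. g i * (if j = i then - 1 else 0)) = - g j"
    "(\<Sum>i\<in>UNIV. (if i = j then - 1 else 0) * g i) = - g j"
    "(\<Sum>i\<in>UNIV. (if j = i then - 1 else 0) * g i) = - g j"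
  by (simp_all add: if_distrib[of "\<lambda>x. _ * x"] if_distrib[of "\<lambda>x. x * _"] cong: if_cong)

lemma gl2_on_generators:
  "commutator deg_alpha (mA j) = mA j" "commutator deg_alpha (mB j) = 0" "commutator deg_alpha (mX j) = 0"
  "commutator deg_alpha (dA j) = - dA j" "commutator deg_alpha (dB j) = 0" "commutator deg_alpha (dX j) = 0"
  "commutator deg_beta (mA j) = 0" "commutator deg_beta (mB j) = mB j" "commutator deg_beta (mX j) = 0"
  "commutator deg_beta (dA j) = 0" "commutator deg_beta (dB j) = - dB j" "commutator deg_beta (dX j) = 0"
  "commutator beta_to_alpha (mA j) = 0" "commutator beta_to_alpha (mB j) = mA j" "commutator beta_to_alpha (mX j) = 0"
  "commutator beta_to_alpha (dA j) = - dB j" "commutator beta_to_alpha (dB j) = 0" "commutator beta_to_alpha (dX j) = 0"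
  "commutator alpha_to_beta (mA j) = mB j" "commutator alpha_to_beta (mB j) = 0" "commutator alpha_to_beta (mX j) = 0"
  "commutator alpha_to_beta (dA j) = 0" "commutator alpha_to_beta (dB j) = - dA j" "commutator alpha_to_beta (dX j) = 0"
  by (simp_all add: deg_alpha_def deg_beta_def beta_to_alpha_def alpha_to_beta_def commutator_sum commutator_mult weyl sum_delta_op)

lemma gl2_relations:
  "commutator deg_alpha beta_to_alpha = (beta_to_alpha :: 'n::finite symbol_endo)" "commutator deg_beta beta_to_alpha = - (beta_to_alpha :: 'n symbol_endo)"
  "commutator deg_alpha alpha_to_beta = - (alpha_to_beta :: 'n symbol_endo)" "commutator deg_beta alpha_to_beta = (alpha_to_beta :: 'n symbol_endo)"
  "commutator beta_to_alpha alpha_to_beta = (deg_alpha - deg_beta :: 'n symbol_endo)" "commutator deg_alpha deg_beta = (0 :: 'n symbol_endo)"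
proof -
  show "commutator deg_alpha beta_to_alpha = (beta_to_alpha :: 'n symbol_endo)"
    unfolding beta_to_alpha_def by (simp add: commutator_sum commutator_mult gl2_on_generators sum_negf)
  show "commutator deg_beta beta_to_alpha = (- beta_to_alpha :: 'n symbol_endo)"
    unfolding beta_to_alpha_def by (simp add: commutator_sum commutator_mult gl2_on_generators sum_negf)
  show "commutator deg_alpha alpha_to_beta = (- alpha_to_beta :: 'n symbol_endo)"
    unfolding alpha_to_beta_def by (simp add: commutator_sum commutator_mult gl2_on_generators sum_negf)
  show "commutator deg_beta alpha_to_beta = (alpha_to_beta :: 'n symbol_endo)"
    unfolding alpha_to_beta_def by (simp add: commutator_sum commutator_mult gl2_on_generators sum_negf)
  show "commutator beta_to_alpha alpha_to_beta = (deg_alpha - deg_beta :: 'n symbol_endo)"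
    unfolding alpha_to_beta_def deg_alpha_def deg_beta_def
    by (simp add: commutator_sum commutator_mult gl2_on_generators sum_negf sum.distrib sum_subtractf)
  show "commutator deg_alpha deg_beta = (0 :: 'n symbol_endo)"
    unfolding deg_beta_def by (simp add: commutator_sum commutator_mult gl2_on_generators)
qed

text \<open>The symmetry between \<open>\<alpha>\<close> and \<open>\<beta>\<close>: each later argument about \<open>\<alpha>\<close> has a mirror image.\<close>

lemma gl2_casimir_alt: "gl2_casimir = deg_alpha * (deg_beta + 1) - beta_to_alpha * (alpha_to_beta :: 'n::finite symbol_endo)"
proof -
  have "commutator beta_to_alpha alpha_to_beta = (deg_alpha - deg_beta :: 'n symbol_endo)" "commutator deg_alpha deg_beta = (0 :: 'n symbol_endo)"
    by (rule gl2_relations)+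
  then show ?thesis by (simp add: gl2_casimir_def commutator_def algebra_simps)
qed

lemma commutator_gl2_composite:
  assumes "commutator deg_alpha G = 0" "commutator deg_beta G = 0" "commutator beta_to_alpha G = 0" "commutator alpha_to_beta G = (0 :: 'n::finite symbol_endo)"
  shows "commutator deg_total G = 0" "commutator gl2_casimir G = 0"
  using assms by (simp_all add: deg_total_def gl2_casimir_def commutator_linear commutator_mult commutator_one)

lemma commutator_deg_total_gl2_casimir: "commutator deg_total gl2_casimir = (0 :: 'n::finite symbol_endo)"
  by (simp add: deg_total_def gl2_casimir_def commutator_linear commutator_mult commutator_one commutator_self gl2_relations
      commutator_swap[of deg_beta deg_alpha])

lemma gl2_relations_swap:
  "commutator beta_to_alpha deg_alpha = - (beta_to_alpha :: 'n::finite symbol_endo)" "commutator beta_to_alpha deg_beta = (beta_to_alpha :: 'n symbol_endo)"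
  "commutator alpha_to_beta deg_alpha = (alpha_to_beta :: 'n symbol_endo)" "commutator alpha_to_beta deg_beta = - (alpha_to_beta :: 'n symbol_endo)"
  "commutator deg_beta deg_alpha = (0 :: 'n symbol_endo)" "commutator alpha_to_beta beta_to_alpha = (deg_beta - deg_alpha :: 'n symbol_endo)"
  using gl2_relations[THEN arg_cong[of _ _ uminus]] by (simp_all add: commutator_def)

lemma commutator_gl2_casimir_gl2:
  "commutator gl2_casimir beta_to_alpha = (0 :: 'n::finite symbol_endo)" "commutator gl2_casimir alpha_to_beta = (0 :: 'n symbol_endo)"
  "commutator gl2_casimir deg_alpha = (0 :: 'n symbol_endo)" "commutator gl2_casimir deg_beta = (0 :: 'n symbol_endo)"
proof -
  have "deg_alpha * beta_to_alpha = beta_to_alpha + beta_to_alpha * (deg_alpha :: 'n symbol_endo)"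
    using gl2_relations(1) by (simp add: commutator_def algebra_simps)
  then show "commutator gl2_casimir beta_to_alpha = (0 :: 'n symbol_endo)"
    by (simp add: gl2_casimir_def commutator_linear commutator_mult commutator_one commutator_self gl2_relations gl2_relations_swap)
       (simp add: commutator_def algebra_simps)
  have "deg_beta * alpha_to_beta = alpha_to_beta + alpha_to_beta * (deg_beta :: 'n symbol_endo)"
    using gl2_relations(4) by (simp add: commutator_def algebra_simps)
  then show "commutator gl2_casimir alpha_to_beta = (0 :: 'n symbol_endo)"
    by (simp add: gl2_casimir_alt commutator_linear commutator_mult commutator_one commutator_self gl2_relations gl2_relations_swap)
       (simp add: commutator_def algebra_simps)
  show "commutator gl2_casimir deg_alpha = (0 :: 'n symbol_endo)" "commutator gl2_casimir deg_beta = (0 :: 'n symbol_endo)"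
    by (simp_all add: gl2_casimir_def commutator_linear commutator_mult commutator_one commutator_self gl2_relations gl2_relations_swap)
qed

text \<open>Lets a rewrite rule for a product act inside a product that is nested to the right.\<close>

lemma mult_left_rewrite: "a * b = c \<Longrightarrow> a * (b * d) = c * (d :: 'a::semigroup_mult)"
  by (simp add: mult.assoc[symmetric])

text \<open>The pair \<open>(dA h, dB h)\<close> is a doublet of \<open>gl(2)\<close>, so moving the Casimir operator past one
  member involves the other.\<close>

lemma gl2_casimir_dA: "gl2_casimir * dA h = dA h * (gl2_casimir - deg_beta - 1) + dB h * alpha_to_beta"
proof -
  have r: "deg_beta * dA h = dA h * deg_beta" "deg_alpha * dA h = dA h * deg_alpha - dA h"
    "beta_to_alpha * dA h = dA h * beta_to_alpha - dB h" "alpha_to_beta * dA h = dA h * alpha_to_beta" "alpha_to_beta * dB h = dB h * alpha_to_beta - dA h"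
    using gl2_on_generators[of h] by (simp_all add: commutator_def algebra_simps)
  have "gl2_casimir * dA h = deg_beta * ((deg_alpha + 1) * dA h) - alpha_to_beta * (beta_to_alpha * dA h)"
    by (simp add: gl2_casimir_def algebra_simps)
  also have "(deg_alpha + 1) * dA h = dA h * deg_alpha" by (simp add: r algebra_simps)
  also have "deg_beta * (dA h * deg_alpha) - alpha_to_beta * (beta_to_alpha * dA h)
      = (deg_beta * dA h) * deg_alpha - (alpha_to_beta * dA h) * beta_to_alpha + alpha_to_beta * dB h"
    by (simp add: r(1,3,4,5) r(1,3,4,5)[THEN mult_left_rewrite] algebra_simps)
  also have "\<dots> = dA h * (gl2_casimir - deg_beta - 1) + dB h * alpha_to_beta"
    by (simp add: r(1,4,5) r(1,4)[THEN mult_left_rewrite] gl2_casimir_def algebra_simps)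
  finally show ?thesis .
qed

lemma gl2_casimir_dB: "gl2_casimir * dB h = dB h * (gl2_casimir - deg_alpha - 1) + dA h * beta_to_alpha"
proof -
  have r: "deg_alpha * dB h = dB h * deg_alpha" "deg_beta * dB h = dB h * deg_beta - dB h"
    "alpha_to_beta * dB h = dB h * alpha_to_beta - dA h" "beta_to_alpha * dB h = dB h * beta_to_alpha" "beta_to_alpha * dA h = dA h * beta_to_alpha - dB h"
    using gl2_on_generators[of h] by (simp_all add: commutator_def algebra_simps)
  have "gl2_casimir * dB h = deg_alpha * ((deg_beta + 1) * dB h) - beta_to_alpha * (alpha_to_beta * dB h)"
    by (simp add: gl2_casimir_alt algebra_simps)
  also have "(deg_beta + 1) * dB h = dB h * deg_beta" by (simp add: r algebra_simps)
  also have "deg_alpha * (dB h * deg_beta) - beta_to_alpha * (alpha_to_beta * dB h)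
      = (deg_alpha * dB h) * deg_beta - (beta_to_alpha * dB h) * alpha_to_beta + beta_to_alpha * dA h"
    by (simp add: r(1,3,4,5) r(1,3,4,5)[THEN mult_left_rewrite] algebra_simps)
  also have "\<dots> = dB h * (gl2_casimir - deg_alpha - 1) + dA h * beta_to_alpha"
    by (simp add: r(1,4,5) r(1,4)[THEN mult_left_rewrite] gl2_casimir_alt algebra_simps)
  finally show ?thesis .
qed

text \<open>A Cayley-Hamilton identity. The tensor product of a representation with a doublet has two
  components at most, so on the image of an eigenvector under a doublet operator the Casimir
  operator satisfies a quadratic equation. With \<open>v = j (d + 1 - j)\<close> its roots are \<open>j (d - j)\<close>
  and \<open>(j - 1) (d + 1 - j)\<close>, the values at the two diagrams with one box less.\<close>

lemma doublet_quadratic: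
  fixes M :: "'n::finite symbol_endo"
  assumes MD: "M * D = D * (M - L - 1) + D' * F" and MD': "M * D' = D' * (M - K - 1) + D * E"
    and EF: "E * F = K * (L + 1) - M" and KF: "K * F = F * K - F"
    and MF: "M * F = F * M" and M_L: "M * L = L * M" and KL: "K * L = L * K"
    and P: "act M P = v *\<^sub>R P" "act (K + L) P = d *\<^sub>R P"
  shows "act M (act M (act D P)) = (2 * v - d - 1) *\<^sub>R act M (act D P) - (v * (v - d)) *\<^sub>R act D P"
proof -
  note a = act_simps act_add act_diff act_scaleR
  note sc = scaleR_scaleR scaleR_add_left scaleR_diff_left scaleR_add_right scaleR_diff_right
  have K: "act K X = d *\<^sub>R X - act L X" if "act (K + L) X = d *\<^sub>R X" for X
    using that by (simp add: a algebra_simps)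
  have step: "act M (act D X) = v *\<^sub>R act D X - act D (act L X) - act D X + act D' (act F X)"
    if "act M X = v *\<^sub>R X" for X
    using arg_cong[OF MD, of "\<lambda>G. act G X"] that by (simp add: a sc algebra_simps)
  have LP: "act M (act L P) = v *\<^sub>R act L P"
    using arg_cong[OF M_L, of "\<lambda>G. act G P"] P by (simp add: a)
  have FP: "act M (act F P) = v *\<^sub>R act F P"
    using arg_cong[OF MF, of "\<lambda>G. act G P"] P by (simp add: a)
  have KFP: "act K (act F P) = act F (act K P) - act F P"
    using arg_cong[OF KF, of "\<lambda>G. act G P"] by (simp add: a)
  have KP: "act K P = d *\<^sub>R P - act L P" by (rule K) (rule P)
  \<comment> \<open>The cross term with E is eliminated by the second form of the Casimir operator.\<close>
  have EFP: "act E (act F P) = act K (act L P) + act K P - v *\<^sub>R P"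
    using arg_cong[OF EF, of "\<lambda>G. act G P"] P by (simp add: a)
  have "act M (act D' (act F P)) = v *\<^sub>R act D' (act F P) - act D' (act K (act F P))
      - act D' (act F P) + act D (act E (act F P))"
    using arg_cong[OF MD', of "\<lambda>G. act G (act F P)"] FP by (simp add: a algebra_simps)
  then have step': "act M (act D' (act F P)) = (v - d) *\<^sub>R act D' (act F P) + act D' (act F (act L P))
      + act D (act K (act L P)) + act D (act K P) - v *\<^sub>R act D P"
    by (simp add: KFP KP EFP a scaleR_diff_left)
  have KLP: "act K (act L P) = d *\<^sub>R act L P - act L (act L P)"
    using arg_cong[OF KL, of "\<lambda>G. act G P"] KP by (simp add: a)
  have twice: "(v * (v * 2)) *\<^sub>R Y = 2 * ((v * v) *\<^sub>R Y)" for Y :: "'n symbol"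
    by (simp only: mult_2 scaleR_add_left[symmetric]) (simp add: algebra_simps)
  have "act M (act M (act D P)) = (v + v - d - 1) *\<^sub>R act M (act D P) - (v * (v - d)) *\<^sub>R act D P"
    unfolding step[OF P(1)] a step[OF LP] step' KLP KP sc by (simp add: algebra_simps twice)
  then show ?thesis by (simp only: mult_2)
qed


lemma casimir_quadratic:
  assumes "act gl2_casimir P = v *\<^sub>R P" "act deg_total P = d *\<^sub>R P"
  shows "act gl2_casimir (act gl2_casimir (act (dA h) P))
      = (2 * v - d - 1) *\<^sub>R act gl2_casimir (act (dA h) P) - (v * (v - d)) *\<^sub>R act (dA h) P"
    and "act gl2_casimir (act gl2_casimir (act (dB h) P))
      = (2 * v - d - 1) *\<^sub>R act gl2_casimir (act (dB h) P) - (v * (v - d)) *\<^sub>R act (dB h) P"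
proof -
  have com: "gl2_casimir * beta_to_alpha = beta_to_alpha * (gl2_casimir :: 'a symbol_endo)" "gl2_casimir * alpha_to_beta = alpha_to_beta * (gl2_casimir :: 'a symbol_endo)"
    "gl2_casimir * deg_alpha = deg_alpha * (gl2_casimir :: 'a symbol_endo)" "gl2_casimir * deg_beta = deg_beta * (gl2_casimir :: 'a symbol_endo)"
    "deg_alpha * deg_beta = deg_beta * (deg_alpha :: 'a symbol_endo)"
    by (rule commutator_eq_0D, rule commutator_gl2_casimir_gl2 gl2_relations)+
  have KF: "deg_alpha * alpha_to_beta = alpha_to_beta * deg_alpha - (alpha_to_beta :: 'a symbol_endo)"
    and LE: "deg_beta * beta_to_alpha = beta_to_alpha * deg_beta - (beta_to_alpha :: 'a symbol_endo)"
    using gl2_relations(2,3) by (simp_all add: commutator_def algebra_simps)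
  have EF: "beta_to_alpha * alpha_to_beta = deg_alpha * (deg_beta + 1) - (gl2_casimir :: 'a symbol_endo)"
    and FE: "alpha_to_beta * beta_to_alpha = deg_beta * (deg_alpha + 1) - (gl2_casimir :: 'a symbol_endo)"
    by (simp add: gl2_casimir_alt) (simp add: gl2_casimir_def)
  show "act gl2_casimir (act gl2_casimir (act (dA h) P))
      = (2 * v - d - 1) *\<^sub>R act gl2_casimir (act (dA h) P) - (v * (v - d)) *\<^sub>R act (dA h) P"
    by (rule doublet_quadratic[OF gl2_casimir_dA gl2_casimir_dB EF KF com(2,4,5) assms(1)])
       (use assms(2) in \<open>simp add: deg_total_def\<close>)
  show "act gl2_casimir (act gl2_casimir (act (dB h) P))
      = (2 * v - d - 1) *\<^sub>R act gl2_casimir (act (dB h) P) - (v * (v - d)) *\<^sub>R act (dB h) P"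
    by (rule doublet_quadratic[OF gl2_casimir_dB gl2_casimir_dA FE LE com(1,3) com(5)[symmetric] assms(1)])
       (use assms(2) in \<open>simp add: deg_total_def add.commute\<close>)
qed

section \<open>The Casimir operators of the projective algebra\<close>

text \<open>Half the Casimir operator of the projective algebra on symbols of weight \<open>\<delta> = 1\<close>, and below
  the term \<open>casimir_defect\<close> that has to be added for the action on operators with
  \<open>\<lambda> = (0, 0)\<close>. The formula follows by evaluating the Casimir operator at the origin on constant
  symbols, using that the Casimir operators of \<open>gl(n)\<close> and \<open>gl(2)\<close> determine each other on
  polynomials in \<open>\<alpha>, \<beta>\<close>. The operators \<open>lie_linear i j\<close> and \<open>lie_quadratic h\<close> are the Lie
  derivatives, with \<open>\<delta> = 1\<close>, along the fields \<open>x\<^sup>j \<partial>\<^sub>i\<close> and \<open>x\<^sup>h \<Sum>\<^sub>i x\<^sup>i \<partial>\<^sub>i\<close>.\<close>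

definition proj_casimir :: "'n::finite symbol_endo" where "proj_casimir = deg_total * deg_total - deg_total - gl2_casimir"
definition div_alpha :: "'n::finite symbol_endo" where "div_alpha = (\<Sum>i\<in>UNIV. dX i * dA i)"
definition div_beta :: "'n::finite symbol_endo" where "div_beta = (\<Sum>i\<in>UNIV. dX i * dB i)"
definition euler :: "'n::finite symbol_endo" where "euler = (\<Sum>i\<in>UNIV. mX i * dX i)"
definition gl_vec :: "'n::finite \<Rightarrow> 'n \<Rightarrow> 'n symbol_endo" where "gl_vec i j = mA i * dA j + mB i * dB j"
definition defect :: "'n::finite \<Rightarrow> 'n symbol_endo" where "defect h = deg_alpha * dA h + deg_beta * dB h"
definition casimir_defect :: "'n::finite symbol_endo" where "casimir_defect = deg_alpha * div_alpha + deg_beta * div_beta"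

definition lie_linear :: "'n::finite \<Rightarrow> 'n \<Rightarrow> 'n symbol_endo" where
  "lie_linear i j = mX j * dX i - gl_vec i j + (if i = j then 1 else 0)"
definition lie_quadratic :: "'n::finite \<Rightarrow> 'n symbol_endo" where
  "lie_quadratic h = mX h * (euler - deg_total + of_nat (CARD('n) + 1)) - (\<Sum>i\<in>UNIV. mX i * gl_vec i h)"

text \<open>Recovers the form in which the defect enters the Casimir operator, from which the lowering
  property of \<open>casimir_defect\<close> is inherited.\<close>

lemma casimir_defect_sum: "casimir_defect = (\<Sum>h\<in>UNIV. defect h * dX h)"
proof -
  have "dX h * dA h = dA h * dX h" "dX h * dB h = dB h * dX h" for h :: 'a
    by (rule commutator_eq_0D, rule weyl)+
  then show ?thesis
    by (simp add: casimir_defect_def defect_def div_alpha_def div_beta_def sum_distrib_left sum.distrib distrib_right mult.assoc)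
qed

lemma commutator_of_nat: "commutator F (of_nat k :: 'a::ring_1) = 0" "commutator (of_nat k :: 'a::ring_1) F = 0"
  by (induction k) (simp_all add: commutator_linear commutator_one)

lemma gl2_gl_vec:
  "commutator deg_alpha (gl_vec i j) = (0 :: 'n symbol_endo)" "commutator deg_beta (gl_vec i j) = (0 :: 'n symbol_endo)"
  "commutator beta_to_alpha (gl_vec i j) = (0 :: 'n symbol_endo)" "commutator alpha_to_beta (gl_vec i j) = (0 :: 'n symbol_endo)"
  for i j :: "'n::finite"
  by (simp_all add: gl_vec_def commutator_linear commutator_mult gl2_on_generators)

lemma gl2_euler:
  "commutator deg_alpha euler = (0 :: 'n::finite symbol_endo)" "commutator deg_beta euler = (0 :: 'n symbol_endo)"
  "commutator beta_to_alpha euler = (0 :: 'n symbol_endo)" "commutator alpha_to_beta euler = (0 :: 'n symbol_endo)"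
  by (simp_all add: euler_def commutator_sum commutator_mult gl2_on_generators)

lemma gl2_lie_linear:
  "commutator deg_alpha (lie_linear i j) = (0 :: 'n symbol_endo)" "commutator deg_beta (lie_linear i j) = (0 :: 'n symbol_endo)"
  "commutator beta_to_alpha (lie_linear i j) = (0 :: 'n symbol_endo)" "commutator alpha_to_beta (lie_linear i j) = (0 :: 'n symbol_endo)"
  for i j :: "'n::finite"
  by (simp_all add: lie_linear_def commutator_linear commutator_mult gl2_on_generators gl2_gl_vec commutator_one)

lemma gl2_lie_quadratic:
  "commutator deg_alpha (lie_quadratic h) = (0 :: 'n symbol_endo)" "commutator deg_beta (lie_quadratic h) = (0 :: 'n symbol_endo)"
  "commutator beta_to_alpha (lie_quadratic h) = (0 :: 'n symbol_endo)" "commutator alpha_to_beta (lie_quadratic h) = (0 :: 'n symbol_endo)"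
  for h :: "'n::finite"
  by (simp_all add: lie_quadratic_def commutator_linear commutator_mult commutator_sum gl2_on_generators gl2_gl_vec gl2_euler
      commutator_of_nat commutator_self gl2_relations gl2_relations_swap deg_total_def commutator_one)

lemma commutator_proj_casimir:
  assumes "commutator deg_alpha G = 0" "commutator deg_beta G = 0" "commutator beta_to_alpha G = 0" "commutator alpha_to_beta G = (0 :: 'n::finite symbol_endo)"
  shows "commutator proj_casimir G = 0"
  using commutator_gl2_composite[OF assms] by (simp add: proj_casimir_def commutator_linear commutator_mult)

lemma proj_casimir_gl2: "commutator proj_casimir deg_alpha = (0 :: 'n::finite symbol_endo)" "commutator proj_casimir deg_beta = (0 :: 'n symbol_endo)"
  by (simp_all add: proj_casimir_def deg_total_def commutator_linear commutator_mult commutator_self gl2_relations gl2_relations_swap commutator_gl2_casimir_gl2)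

lemma proj_casimir_dA: "commutator proj_casimir (dA h) = - (deg_total * dA h + deg_alpha * dA h + alpha_to_beta * dB h)"
proof -
  have N: "dA h * deg_total = deg_total * dA h + dA h"
    using gl2_on_generators[of h] by (simp add: commutator_def algebra_simps deg_total_def)
  have L: "dA h * deg_beta = deg_beta * dA h" and F: "dB h * alpha_to_beta = alpha_to_beta * dB h + dA h"
    using gl2_on_generators[of h] by (simp_all add: commutator_def algebra_simps)
  have "commutator proj_casimir (dA h) = deg_total * deg_total * dA h - deg_total * dA h - dA h * (deg_total * deg_total) + dA h * deg_total
      + (dA h * gl2_casimir - gl2_casimir * dA h)"
    by (simp add: proj_casimir_def commutator_def algebra_simps)
  also have "dA h * gl2_casimir - gl2_casimir * dA h = deg_beta * dA h - alpha_to_beta * dB h"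
    using L F by (simp add: gl2_casimir_dA algebra_simps)
  also have "deg_total * deg_total * dA h - deg_total * dA h - dA h * (deg_total * deg_total) + dA h * deg_total
      = - (deg_total * dA h) - deg_total * dA h"
    by (simp add: N N[THEN mult_left_rewrite] algebra_simps)
  finally show ?thesis by (simp add: deg_total_def algebra_simps)
qed

lemma proj_casimir_dB: "commutator proj_casimir (dB h) = - (deg_total * dB h + beta_to_alpha * dA h + deg_beta * dB h)"
proof -
  have N: "dB h * deg_total = deg_total * dB h + dB h"
    using gl2_on_generators[of h] by (simp add: commutator_def algebra_simps deg_total_def)
  have L: "dB h * deg_alpha = deg_alpha * dB h" and F: "dA h * beta_to_alpha = beta_to_alpha * dA h + dB h"
    using gl2_on_generators[of h] by (simp_all add: commutator_def algebra_simps)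
  have "commutator proj_casimir (dB h) = deg_total * deg_total * dB h - deg_total * dB h - dB h * (deg_total * deg_total) + dB h * deg_total
      + (dB h * gl2_casimir - gl2_casimir * dB h)"
    by (simp add: proj_casimir_def commutator_def algebra_simps)
  also have "dB h * gl2_casimir - gl2_casimir * dB h = deg_alpha * dB h - beta_to_alpha * dA h"
    using L F by (simp add: gl2_casimir_dB algebra_simps)
  also have "deg_total * deg_total * dB h - deg_total * dB h - dB h * (deg_total * deg_total) + dB h * deg_total
      = - (deg_total * dB h) - deg_total * dB h"
    by (simp add: N N[THEN mult_left_rewrite] algebra_simps)
  finally show ?thesis by (simp add: deg_total_def algebra_simps)
qed

lemma div_alpha_on_generators:
  "commutator div_alpha (mA j) = dX j" "commutator div_alpha (mB j) = 0" "commutator div_alpha (mX j) = dA j"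
  "commutator div_alpha (dA j) = 0" "commutator div_alpha (dB j) = 0" "commutator div_alpha (dX j) = 0"
  "commutator div_beta (mA j) = 0" "commutator div_beta (mB j) = dX j" "commutator div_beta (mX j) = dB j"
  "commutator div_beta (dA j) = 0" "commutator div_beta (dB j) = 0" "commutator div_beta (dX j) = 0"
  by (simp_all add: div_alpha_def div_beta_def commutator_sum commutator_mult weyl sum_delta_op)

lemma gl2_div:
  "commutator deg_alpha div_alpha = - (div_alpha :: 'n::finite symbol_endo)" "commutator deg_alpha div_beta = (0 :: 'n symbol_endo)"
  "commutator deg_beta div_alpha = (0 :: 'n symbol_endo)" "commutator deg_beta div_beta = - (div_beta :: 'n symbol_endo)"
  by (simp_all add: div_alpha_def div_beta_def commutator_sum commutator_mult gl2_on_generators sum_negf)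

lemma gl2_div_swap:
  "commutator div_alpha deg_alpha = (div_alpha :: 'n::finite symbol_endo)" "commutator div_beta deg_alpha = (0 :: 'n symbol_endo)"
  "commutator div_alpha deg_beta = (0 :: 'n symbol_endo)" "commutator div_beta deg_beta = (div_beta :: 'n symbol_endo)"
  using gl2_div[THEN arg_cong[of _ _ uminus]] by (simp_all add: commutator_def)

lemma div_euler: "commutator div_alpha euler = (div_alpha :: 'n::finite symbol_endo)" "commutator div_beta euler = (div_beta :: 'n symbol_endo)"
proof -
  have r: "dA h * dX h = dX h * dA h" "dB h * dX h = dX h * dB h" for h :: 'n
    by (rule commutator_eq_0D, rule weyl)+
  show "commutator div_alpha euler = (div_alpha :: 'n symbol_endo)" "commutator div_beta euler = (div_beta :: 'n symbol_endo)"
    unfolding euler_def by (simp_all add: commutator_sum commutator_mult div_alpha_on_generators r) (simp_all add: div_alpha_def div_beta_def)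
qed

lemma div_lie_linear: "commutator div_alpha (lie_linear i j) = (0 :: 'n symbol_endo)" "commutator div_beta (lie_linear i j) = (0 :: 'n symbol_endo)"
  for i j :: "'n::finite"
proof -
  have r: "dA j * dX i = dX i * dA j" "dB j * dX i = dX i * dB j"
    by (rule commutator_eq_0D, rule weyl)+
  show "commutator div_alpha (lie_linear i j) = (0 :: 'n symbol_endo)" "commutator div_beta (lie_linear i j) = (0 :: 'n symbol_endo)"
    by (simp_all add: lie_linear_def gl_vec_def commutator_linear commutator_mult commutator_one div_alpha_on_generators r)
qed

text \<open>The commutator of a divergence with a quadratic field is the commutator of the Casimir
  operator with the corresponding fibre derivative, see \<open>proj_casimir_dA\<close>. This coincidence is what
  makes the corrected Casimir operator invariant.\<close>

lemma div_lie_quadratic: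
  "commutator div_alpha (lie_quadratic h) = - (deg_total * dA h + deg_alpha * dA h + alpha_to_beta * dB h)"
  "commutator div_beta (lie_quadratic h) = - (deg_total * dB h + beta_to_alpha * dA h + deg_beta * dB h)" for h :: "'n::finite"
proof -
  let ?n = "of_nat CARD('n) :: 'n symbol_endo"
  have com: "dA h * euler = euler * dA h" "dB h * euler = euler * dB h"
    by (rule commutator_eq_0D, simp add: euler_def commutator_sum commutator_mult weyl)+
  have comn: "dA h * ?n = ?n * dA h" "dB h * ?n = ?n * dB h"
    by (rule commutator_eq_0D, rule commutator_of_nat)+
  have N: "dA h * deg_total = deg_total * dA h + dA h" "dB h * deg_total = deg_total * dB h + dB h"
    using gl2_on_generators[of h] by (simp_all add: commutator_def algebra_simps deg_total_def)
  have glA: "(\<Sum>i\<in>UNIV. dA i * gl_vec i h) = (deg_alpha + ?n) * dA h + alpha_to_beta * dB h"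
  proof -
    have "dA i * gl_vec i h = (mA i * dA i + 1) * dA h + mB i * dA i * dB h" for i
    proof -
      have "dA i * mA i = mA i * dA i + 1" "dA i * mB i = mB i * dA i"
        using weyl_heisenberg(1)[of i i] weyl_commute(16)[of i i] by (simp_all add: commutator_def algebra_simps)
      then show ?thesis by (simp add: gl_vec_def distrib_left mult.assoc[symmetric])
    qed
    then show ?thesis
      by (simp add: deg_alpha_def alpha_to_beta_def sum.distrib distrib_right sum_distrib_right)
  qed
  have glB: "(\<Sum>i\<in>UNIV. dB i * gl_vec i h) = beta_to_alpha * dA h + (deg_beta + ?n) * dB h"
  proof -
    have "dB i * gl_vec i h = mA i * dB i * dA h + (mB i * dB i + 1) * dB h" for i
    proof -
      have "dB i * mB i = mB i * dB i + 1" "dB i * mA i = mA i * dB i"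
        using weyl_heisenberg(2)[of i i] weyl_commute(21)[of i i] by (simp_all add: commutator_def algebra_simps)
      then show ?thesis by (simp add: gl_vec_def distrib_left mult.assoc[symmetric])
    qed
    then show ?thesis
      by (simp add: deg_beta_def beta_to_alpha_def sum.distrib distrib_right sum_distrib_right)
  qed
  have eu: "(\<Sum>i\<in>UNIV. mX i * (dX i * dA h)) = euler * dA h" "(\<Sum>i\<in>UNIV. mX i * (dX i * dB h)) = euler * dB h"
    by (simp_all add: euler_def sum_distrib_right mult.assoc)
  show "commutator div_alpha (lie_quadratic h) = - (deg_total * dA h + deg_alpha * dA h + alpha_to_beta * dB h)"
  proof -
    have "commutator div_alpha (lie_quadratic h) = dA h * (euler - deg_total + ?n + 1) - (\<Sum>i\<in>UNIV. dA i * gl_vec i h) - euler * dA h"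
      by (simp add: lie_quadratic_def commutator_linear commutator_mult commutator_sum commutator_one commutator_of_nat div_alpha_on_generators deg_total_def
          gl2_div_swap div_euler sum.distrib gl_vec_def eu algebra_simps)
    then show ?thesis unfolding glA by (simp add: algebra_simps com comn N)
  qed
  show "commutator div_beta (lie_quadratic h) = - (deg_total * dB h + beta_to_alpha * dA h + deg_beta * dB h)"
  proof -
    have "commutator div_beta (lie_quadratic h) = dB h * (euler - deg_total + ?n + 1) - (\<Sum>i\<in>UNIV. dB i * gl_vec i h) - euler * dB h"
      by (simp add: lie_quadratic_def commutator_linear commutator_mult commutator_sum commutator_one commutator_of_nat div_alpha_on_generators deg_total_def
          gl2_div_swap div_euler sum.distrib gl_vec_def eu algebra_simps)
    then show ?thesis unfolding glB by (simp add: algebra_simps com comn N)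
  qed
qed

lemma commutator_casimir_defect_defect: "commutator casimir_defect (defect h) = 0"
proof -
  have sw: "commutator (dA h) deg_alpha = dA h" "commutator (dA h) deg_beta = 0" "commutator (dB h) deg_alpha = 0" "commutator (dB h) deg_beta = dB h"
    using gl2_on_generators[of h, THEN arg_cong[of _ _ uminus]] by (simp_all add: commutator_def)
  have d: "div_alpha * dA h = dA h * div_alpha" "div_alpha * dB h = dB h * div_alpha"
      "div_beta * dA h = dA h * div_beta" "div_beta * dB h = dB h * div_beta"
    by (rule commutator_eq_0D, rule div_alpha_on_generators)+
  have k: "deg_alpha * deg_beta = deg_beta * (deg_alpha :: 'a symbol_endo)"
    by (rule commutator_eq_0D, rule gl2_relations)
  show ?thesis
    by (simp add: casimir_defect_def defect_def commutator_linear commutator_mult gl2_div gl2_div_swap gl2_on_generators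
        div_alpha_on_generators commutator_self gl2_relations gl2_relations_swap d)
       (simp add: d algebra_simps k k[THEN mult_left_rewrite])?
qed

text \<open>Invariance of the corrected Casimir operator under the action on operators.\<close>

lemma commutator_total_casimir:
  "commutator (proj_casimir + casimir_defect) (dX i) = 0" "commutator (proj_casimir + casimir_defect) (lie_linear i j) = 0"
  "commutator (proj_casimir + casimir_defect) (lie_quadratic h - defect h) = 0"
proof -
  show "commutator (proj_casimir + casimir_defect) (dX i) = 0" "commutator (proj_casimir + casimir_defect) (lie_linear i j) = 0"
    by (simp_all add: commutator_linear commutator_proj_casimir casimir_defect_def commutator_mult gl2_on_generators gl2_lie_linear div_alpha_on_generators div_lie_linear)
  show "commutator (proj_casimir + casimir_defect) (lie_quadratic h - defect h) = 0"
    by (simp add: commutator_linear commutator_casimir_defect_defect commutator_proj_casimir gl2_lie_quadratic)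
       (simp add: proj_casimir_gl2 casimir_defect_def defect_def commutator_linear commutator_mult gl2_lie_quadratic div_lie_quadratic proj_casimir_dA proj_casimir_dB)
qed

section \<open>Diagonalising a triangular perturbation\<close>

text \<open>Linear maps given separately on every joint eigenspace can be glued. No commutation of \<open>S\<close> and
  \<open>T\<close> and no projections are involved: a basis of joint eigenvectors is adapted to all
  eigenspaces at once, since an eigenvector can only involve basis vectors with its own
  eigenvalues.\<close>

lemma joint_eigenvector_extension:
  fixes S T :: "'v::real_vector \<Rightarrow> 'v" and f :: "real \<Rightarrow> real \<Rightarrow> 'v \<Rightarrow> 'w::real_vector"
  assumes S: "linear S" and T: "linear T"
    and spans: "span {x. \<exists>s t. S x = s *\<^sub>R x \<and> T x = t *\<^sub>R x} = UNIV"
    and f: "\<And>s t. linear (f s t)"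
  shows "\<exists>g. linear g \<and> (\<forall>s t x. S x = s *\<^sub>R x \<and> T x = t *\<^sub>R x \<longrightarrow> g x = f s t x)"
proof -
  let ?V = "{x. \<exists>s t. S x = s *\<^sub>R x \<and> T x = t *\<^sub>R x}"
  obtain B where B: "B \<subseteq> ?V" "independent B" "?V \<subseteq> span B"
    using maximal_independent_subset[of ?V] by blast
  have "\<forall>b\<in>B. \<exists>p. S b = fst p *\<^sub>R b \<and> T b = snd p *\<^sub>R b"
    using B(1) by auto
  then obtain p where p: "\<And>b. b \<in> B \<Longrightarrow> S b = fst (p b) *\<^sub>R b \<and> T b = snd (p b) *\<^sub>R b"
    by metis
  obtain g where g: "linear g" "\<And>b. b \<in> B \<Longrightarrow> g b = f (fst (p b)) (snd (p b)) b"
    using linear_independent_extend[OF B(2), of "\<lambda>b. f (fst (p b)) (snd (p b)) b"] by auto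
  have "g x = f s t x" if x: "S x = s *\<^sub>R x" "T x = t *\<^sub>R x" for s t x
  proof -
    have "x \<in> span B" using B(3) span_minimal[OF B(3)] spans by auto
    then obtain A r where A: "finite A" "A \<subseteq> B" "x = (\<Sum>b\<in>A. r b *\<^sub>R b)"
      unfolding span_explicit by auto
    \<comment> \<open>Independence of the basis: only basis vectors with the eigenvalues of x contribute.\<close>
    have "(\<Sum>b\<in>A. (r b * (fst (p b) - s)) *\<^sub>R b) = S x - s *\<^sub>R x"
      unfolding A(3) linear_sum[OF S] scaleR_sum_right sum_subtractf[symmetric]
      by (rule sum.cong) (use A(2) p in \<open>auto simp: linear_cmul[OF S] algebra_simps subset_iff\<close>)
    then have s: "r b * (fst (p b) - s) = 0" if "b \<in> A" for b
      using independentD[OF B(2) A(1,2), of "\<lambda>b. r b * (fst (p b) - s)"] x that by simp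
    have "(\<Sum>b\<in>A. (r b * (snd (p b) - t)) *\<^sub>R b) = T x - t *\<^sub>R x"
      unfolding A(3) linear_sum[OF T] scaleR_sum_right sum_subtractf[symmetric]
      by (rule sum.cong) (use A(2) p in \<open>auto simp: linear_cmul[OF T] algebra_simps subset_iff\<close>)
    then have t: "r b * (snd (p b) - t) = 0" if "b \<in> A" for b
      using independentD[OF B(2) A(1,2), of "\<lambda>b. r b * (snd (p b) - t)"] x that by simp
    have "r b *\<^sub>R g b = r b *\<^sub>R f s t b" if "b \<in> A" for b
      using s[OF that] t[OF that] g(2)[of b] A(2) that by auto
    then show "g x = f s t x"
      unfolding A(3) linear_sum[OF g(1)] linear_sum[OF f] linear_cmul[OF g(1)] linear_cmul[OF f]
      by (rule sum.cong[OF refl])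
  qed
  with g(1) show ?thesis by blast
qed

text \<open>The operators \<open>D\<close> and \<open>C\<close> play the parts of the degree and of an invariant operator on
  symbols, and \<open>G\<close> of a perturbation of \<open>C\<close>. The subspace \<open>lower d v\<close> requires the degree and the
  eigenvalue to drop together: the eigenvalue makes \<open>C - v\<close> invertible there, and the degree,
  being a natural number, makes the iteration terminate.\<close>

locale triangular_perturbation =
  fixes D C G :: "'v::real_vector \<Rightarrow> 'v"
  assumes linear_D: "linear D" and linear_C: "linear C" and linear_G: "linear G"
begin

definition eig :: "nat \<Rightarrow> real \<Rightarrow> 'v set" where
  "eig d v = {x. D x = real d *\<^sub>R x \<and> C x = v *\<^sub>R x}"

definition lower :: "nat \<Rightarrow> real \<Rightarrow> 'v set" where
  "lower d v = span (\<Union>d'\<in>{..<d}. \<Union>w\<in>{..<v}. eig d' w)"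

lemma lower_mono: "d \<le> d' \<Longrightarrow> v \<le> v' \<Longrightarrow> lower d v \<subseteq> lower d' v'"
  unfolding lower_def by (intro span_mono UN_mono) auto

lemma eig_lower: "x \<in> eig d' w \<Longrightarrow> d' < d \<Longrightarrow> w < v \<Longrightarrow> x \<in> lower d v"
  unfolding lower_def by (intro span_base) auto

lemma subspace_lower: "subspace (lower d v)"
  by (simp add: lower_def)

lemma lower_0: "lower 0 v = {0}"
  by (simp add: lower_def)

lemma lower_induct:
  assumes "y \<in> lower d v" "subspace P" "\<And>d' w x. d' < d \<Longrightarrow> w < v \<Longrightarrow> x \<in> eig d' w \<Longrightarrow> x \<in> P"
  shows "y \<in> P"
proof -
  have "(\<Union>d'\<in>{..<d}. \<Union>w\<in>{..<v}. eig d' w) \<subseteq> P" using assms(3) by auto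
  from span_minimal[OF this assms(2)] show ?thesis using assms(1) by (auto simp: lower_def)
qed

lemma linear_maps_lower:
  assumes "linear F" "y \<in> lower d v"
    and "\<And>d' w x. d' < d \<Longrightarrow> w < v \<Longrightarrow> x \<in> eig d' w \<Longrightarrow> F x \<in> W" "subspace W"
  shows "F y \<in> W"
proof -
  have "y \<in> {y. F y \<in> W}"
    by (rule lower_induct[OF assms(2) linear_subspace_vimage[OF assms(1,4), unfolded vimage_def]])
       (use assms(3) in auto)
  then show ?thesis by simp
qed

lemma linear_eq_on_lower:
  assumes "linear F" "linear H" "y \<in> lower d v"
    and "\<And>d' w x. d' < d \<Longrightarrow> w < v \<Longrightarrow> x \<in> eig d' w \<Longrightarrow> F x = H x"
  shows "F y = H y"
proof -
  have "F y - H y \<in> {0}"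
    by (rule linear_maps_lower[OF linear_compose_sub[OF assms(1,2)] assms(3)])
       (use assms(4) subspace_single_0 in auto)
  then show ?thesis by simp
qed

end

locale lowering_perturbation = triangular_perturbation +
  assumes spans: "span (\<Union>d. \<Union>v. eig d v) = UNIV"
    and G_lowers: "x \<in> eig d v \<Longrightarrow> G x \<in> lower d v"
begin

lemma span_joint: "span {x. \<exists>s t. D x = s *\<^sub>R x \<and> C x = t *\<^sub>R x} = UNIV"
proof -
  have "(\<Union>d. \<Union>v. eig d v) \<subseteq> {x. \<exists>s t. D x = s *\<^sub>R x \<and> C x = t *\<^sub>R x}"
    by (auto simp: eig_def)
  from span_mono[OF this] show ?thesis using spans by auto
qed

lemma G_lower_Suc: "y \<in> lower (Suc d) v \<Longrightarrow> G y \<in> lower d v"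
proof (rule linear_maps_lower[OF linear_G _ _ subspace_lower])
  fix d' w x assume "d' < Suc d" "w < v" "x \<in> eig d' w"
  then show "G x \<in> lower d v"
    using G_lowers[of x d' w] lower_mono[of d' d w v] by auto
qed

text \<open>The inverse of \<open>v - C\<close> on \<open>lower d v\<close>, for all \<open>d\<close> at once. Outside these subspaces its values
  are arbitrary.\<close>

lemma resolvent:
  "\<exists>R. linear R \<and> (\<forall>d. \<forall>y\<in>lower d v.
     R y \<in> lower d v \<and> C (R y) = v *\<^sub>R R y - y \<and> R (C y) = v *\<^sub>R R y - y)"
proof -
  have lin: "linear (\<lambda>x. (1 / (v - t)) *\<^sub>R x :: 'a)" for t
    by (rule linear_compose_scale_right[OF linear_ident])
  obtain R where R: "linear R" "\<And>s t x. D x = s *\<^sub>R x \<Longrightarrow> C x = t *\<^sub>R x \<Longrightarrow> R x = (1 / (v - t)) *\<^sub>R x"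
    using joint_eigenvector_extension[OF linear_D linear_C span_joint, of "\<lambda>s t x. (1 / (v - t)) *\<^sub>R x"] lin
    by auto
  have Reig: "R x = (1 / (v - w)) *\<^sub>R x" if "x \<in> eig d' w" for x d' w
    using that R(2) by (auto simp: eig_def)
  have val: "(w / (v - w)) *\<^sub>R x = (v / (v - w)) *\<^sub>R x - x" if "w < v" for w and x :: 'a
  proof -
    have "w / (v - w) = v / (v - w) - 1" using that by (simp add: field_simps)
    then show ?thesis by (simp only: scaleR_diff_left scaleR_one)
  qed
  show ?thesis
  proof (intro exI[of _ R] conjI allI ballI)
    show "linear R" by (rule R)
    fix d y assume y: "y \<in> lower d v"
    show "R y \<in> lower d v"
      by (rule linear_maps_lower[OF R(1) y _ subspace_lower])
         (auto simp: Reig intro!: subspace_scale[OF subspace_lower] eig_lower)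
    show "C (R y) = v *\<^sub>R R y - y"
    proof (rule linear_eq_on_lower[OF _ _ y])
      show "linear (\<lambda>y. C (R y))" using linear_compose[OF R(1) linear_C] by (simp add: o_def)
      show "linear (\<lambda>y. v *\<^sub>R R y - y)"
        by (intro linear_compose_sub linear_compose_scale_right R linear_ident)
      fix d' w x assume w: "d' < d" "w < v" and x: "x \<in> eig d' w"
      then have "C x = w *\<^sub>R x" by (simp add: eig_def)
      then show "C (R x) = v *\<^sub>R R x - x"
        using val[OF w(2), of x] by (simp add: Reig[OF x] linear_cmul[OF linear_C])
    qed
    show "R (C y) = v *\<^sub>R R y - y"
    proof (rule linear_eq_on_lower[OF _ _ y])
      show "linear (\<lambda>y. R (C y))" using linear_compose[OF linear_C R(1)] by (simp add: o_def)
      show "linear (\<lambda>y. v *\<^sub>R R y - y)"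
        by (intro linear_compose_sub linear_compose_scale_right R linear_ident)
      fix d' w x assume w: "d' < d" "w < v" and x: "x \<in> eig d' w"
      then have "C x = w *\<^sub>R x" by (simp add: eig_def)
      then show "R (C x) = v *\<^sub>R R x - x"
        using val[OF w(2), of x] by (simp add: Reig[OF x] linear_cmul[OF R(1)])
    qed
  qed
qed

text \<open>On such a vector \<open>y = R (G y)\<close> with the resolvent \<open>R\<close>, and \<open>R \<circ> G\<close> is nilpotent on
  \<open>lower d v\<close>. This is the uniqueness on which equivariance rests.\<close>

lemma lower_eigenvector_zero:
  assumes y: "y \<in> lower d v" and eq: "C y + G y = v *\<^sub>R y"
  shows "y = 0"
proof -
  obtain R where R: "linear R" "\<And>d y. y \<in> lower d v \<Longrightarrow> R y \<in> lower d v"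
    "\<And>d y. y \<in> lower d v \<Longrightarrow> C (R y) = v *\<^sub>R R y - y"
    "\<And>d y. y \<in> lower d v \<Longrightarrow> R (C y) = v *\<^sub>R R y - y"
    using resolvent[of v] by auto
  have "v *\<^sub>R R y = (v *\<^sub>R R y - y) + R (G y)"
    by (simp only: R(4)[OF y, symmetric] linear_add[OF R(1), symmetric] eq linear_cmul[OF R(1)])
  then have "R (G y) = y" by (simp add: algebra_simps)
  then have step: "y \<in> lower (Suc d) v \<Longrightarrow> y \<in> lower d v" for d
    using R(2) G_lower_Suc by metis
  have "y \<in> lower 0 v"
    using y by (induction d) (use step in auto)
  then show ?thesis by (simp add: lower_0)
qed

text \<open>The Neumann series of \<open>1 - R \<circ> G\<close>, which is finite because each step lowers the degree.\<close>

lemma eigenvector_correction: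
  "\<exists>Q. linear Q \<and> (\<forall>d v. \<forall>x\<in>eig d v. Q x - x \<in> lower d v \<and> C (Q x) + G (Q x) = v *\<^sub>R Q x)"
proof -
  obtain R where R: "\<And>v. linear (R v)" "\<And>v d y. y \<in> lower d v \<Longrightarrow> R v y \<in> lower d v"
    "\<And>v d y. y \<in> lower d v \<Longrightarrow> C (R v y) = v *\<^sub>R R v y - y"
  proof -
    obtain R where "\<forall>v. linear (R v) \<and> (\<forall>d. \<forall>y\<in>lower d v. R v y \<in> lower d v
        \<and> C (R v y) = v *\<^sub>R R v y - y \<and> R v (C y) = v *\<^sub>R R v y - y)"
      using resolvent by metis
    then show thesis by (intro that[of R]) auto
  qed
  \<comment> \<open>Each application of N lowers the degree, so d iterations are enough in degree d.\<close>
  define N where "N v = (\<lambda>y. R v (G y))" for v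
  have linN: "linear (N v ^^ k)" for v k
  proof (induction k)
    case (Suc k)
    have "linear (N v)" unfolding N_def using linear_compose[OF linear_G R(1)] by (simp add: o_def)
    from linear_compose[OF Suc this] show ?case by (simp add: o_def)
  qed (simp add: linear_ident id_def)
  have linsum: "linear (\<lambda>x. \<Sum>k\<le>nat \<lfloor>s\<rfloor>. (N t ^^ k) x)" for s t
    by (rule linear_compose_sum) (use linN in auto)
  obtain Q where Q: "linear Q"
    "\<And>s t x. D x = s *\<^sub>R x \<Longrightarrow> C x = t *\<^sub>R x \<Longrightarrow> Q x = (\<Sum>k\<le>nat \<lfloor>s\<rfloor>. (N t ^^ k) x)"
    using joint_eigenvector_extension[OF linear_D linear_C span_joint,
        of "\<lambda>s t x. \<Sum>k\<le>nat \<lfloor>s\<rfloor>. (N t ^^ k) x", OF linsum] by auto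
  have Qeig: "Q x = (\<Sum>k\<le>d. (N v ^^ k) x)" if "x \<in> eig d v" for d v x
    using that Q(2)[of x "real d" v] by (simp add: eig_def)
  have iter: "(N v ^^ Suc k) x \<in> lower (d - k) v" if x: "x \<in> eig d v" for d v x k
  proof (induction k)
    case 0
    show ?case using R(2)[OF G_lowers[OF x]] by (simp add: N_def)
  next
    case (Suc k)
    have "G ((N v ^^ Suc k) x) \<in> lower (d - Suc k) v"
    proof (cases "d - k")
      case 0
      with Suc have "(N v ^^ Suc k) x = 0" by (simp add: lower_0 del: funpow.simps)
      then show ?thesis using linear_0[OF linear_G] subspace_0[OF subspace_lower] by simp
    next
      case (Suc m)
      then have "d - Suc k = m" by simp
      with Suc Suc.IH show ?thesis using G_lower_Suc by metis
    qed
    then show ?case using R(2) by (simp add: N_def)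
  qed
  show ?thesis
  proof (intro exI[of _ Q] conjI allI ballI)
    show "linear Q" by (rule Q)
    fix d v x assume x: "x \<in> eig d v"
    have Q': "Q x = x + (\<Sum>k<d. (N v ^^ Suc k) x)"
      unfolding Qeig[OF x] by (simp add: sum.atMost_shift del: funpow.simps)
    show "Q x - x \<in> lower d v"
      unfolding Q' using iter[OF x] lower_mono[of "d - _" d v v]
      by (auto intro!: subspace_sum[OF subspace_lower] simp del: funpow.simps)
    have C: "C ((N v ^^ Suc k) x) = v *\<^sub>R (N v ^^ Suc k) x - G ((N v ^^ k) x)" for k
    proof -
      have "G ((N v ^^ k) x) \<in> lower d v"
      proof (cases k)
        case (Suc m)
        have "(N v ^^ Suc m) x \<in> lower (Suc d) v"
          using iter[OF x, of m] lower_mono[OF le_SucI[OF diff_le_self] order_refl]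
          by (rule rev_subsetD)
        then show ?thesis unfolding Suc by (rule G_lower_Suc)
      qed (simp add: G_lowers[OF x])
      from R(3)[OF this] show ?thesis by (simp add: N_def)
    qed
    have last: "G ((N v ^^ d) x) = 0"
    proof (cases d)
      case 0
      then show ?thesis using G_lowers[OF x] by (simp add: lower_0)
    next
      case (Suc m)
      have "(N v ^^ Suc m) x \<in> lower (Suc 0) v" using iter[OF x, of m] Suc by simp
      from G_lower_Suc[OF this] show ?thesis unfolding Suc by (simp add: lower_0)
    qed
    have "C (Q x) = C x + (\<Sum>k<d. v *\<^sub>R (N v ^^ Suc k) x - G ((N v ^^ k) x))"
      unfolding Q' linear_add[OF linear_C] linear_sum[OF linear_C] C ..
    also have "\<dots> = v *\<^sub>R Q x - (\<Sum>k<d. G ((N v ^^ k) x))"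
      using x unfolding Q' eig_def
      by (simp add: sum_subtractf scaleR_sum_right scaleR_add_right del: funpow.simps)
    also have "(\<Sum>k<d. G ((N v ^^ k) x)) = G (Q x)"
      unfolding Qeig[OF x] linear_sum[OF linear_G] using last
      by (simp add: lessThan_Suc_atMost[symmetric])
    finally show "C (Q x) + G (Q x) = v *\<^sub>R Q x" by simp
  qed
qed

text \<open>An operator \<open>L\<close> that preserves the eigenspaces, perturbed by a lowering \<open>g\<close> so as to commute
  with \<open>C + G\<close>, is carried to \<open>L\<close> by \<open>Q\<close>: the difference of the two sides is an eigenvector of
  \<open>C + G\<close> inside \<open>lower d v\<close>, hence zero.\<close>

theorem intertwining_correction:
  obtains Q where "linear Q" "\<And>d v x. x \<in> eig d v \<Longrightarrow> Q x - x \<in> lower d v"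
    "\<And>L g x. linear L \<Longrightarrow> linear g \<Longrightarrow> (\<And>d v x. x \<in> eig d v \<Longrightarrow> L x \<in> eig d v) \<Longrightarrow>
      (\<And>d v x. x \<in> eig d v \<Longrightarrow> g x \<in> lower d v) \<Longrightarrow>
      (\<And>x. L (C x + G x) - g (C x + G x) = C (L x - g x) + G (L x - g x)) \<Longrightarrow>
      L (Q x) - g (Q x) = Q (L x)"
proof -
  obtain Q where Q: "linear Q" "\<And>d v x. x \<in> eig d v \<Longrightarrow> Q x - x \<in> lower d v"
    "\<And>d v x. x \<in> eig d v \<Longrightarrow> C (Q x) + G (Q x) = v *\<^sub>R Q x"
    using eigenvector_correction by auto
  show thesis
  proof
    show "linear Q" "\<And>d v x. x \<in> eig d v \<Longrightarrow> Q x - x \<in> lower d v" by (fact Q)+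
    fix L g x
    assume L: "linear L" and g: "linear g" and Leig: "\<And>d v x. x \<in> eig d v \<Longrightarrow> L x \<in> eig d v"
      and geig: "\<And>d v x. x \<in> eig d v \<Longrightarrow> g x \<in> lower d v"
      and com: "\<And>x. L (C x + G x) - g (C x + G x) = C (L x - g x) + G (L x - g x)"
    have *: "L (Q x) - g (Q x) = Q (L x)" if x: "x \<in> eig d v" for x d v
    proof -
      have Llow: "L y \<in> lower d v" if "y \<in> lower d v" for y
        by (rule linear_maps_lower[OF L that _ subspace_lower]) (blast intro: eig_lower Leig)
      have glow: "g y \<in> lower d v" if "y \<in> lower d v" for y
      proof (rule linear_maps_lower[OF g that _ subspace_lower])
        fix d' w x assume "d' < d" "w < v" "x \<in> eig d' w"
        then show "g x \<in> lower d v" using geig[of x d' w] lower_mono[of d' d w v] by auto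
      qed
      let ?y = "L (Q x) - g (Q x) - Q (L x)"
      have "?y = L (Q x - x) - g (Q x - x) - g x - (Q (L x) - L x)"
        by (simp add: linear_diff[OF L] linear_diff[OF g])
      also have "\<dots> \<in> lower d v"
        using Llow[OF Q(2)[OF x]] glow[OF Q(2)[OF x]] geig[OF x] Q(2)[OF Leig[OF x]]
        by (metis subspace_diff[OF subspace_lower])
      finally have low: "?y \<in> lower d v" .
      have "C ?y + G ?y = (L (C (Q x) + G (Q x)) - g (C (Q x) + G (Q x))) - (C (Q (L x)) + G (Q (L x)))"
        unfolding com by (simp add: linear_diff[OF linear_C] linear_diff[OF linear_G])
      also have "\<dots> = v *\<^sub>R ?y"
        by (simp add: Q(3)[OF x] Q(3)[OF Leig[OF x]] linear_cmul[OF L] linear_cmul[OF g] algebra_simps)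
      finally show ?thesis using lower_eigenvector_zero[OF low] by simp
    qed
    have "linear (\<lambda>x. L (Q x) - g (Q x))" "linear (\<lambda>x. Q (L x))"
      using linear_compose[OF Q(1) L] linear_compose[OF Q(1) g] linear_compose[OF L Q(1)]
      by (auto simp: o_def intro: linear_compose_sub)
    from linear_eq_on_span[OF this, of "\<Union>d. \<Union>v. eig d v" x] show "L (Q x) - g (Q x) = Q (L x)"
      using * spans by auto
  qed
qed

end

section \<open>The spectrum of the Casimir operator\<close>

lemma act_gl2_single:
  "act deg_alpha (Poly_Mapping.single (a, b) f) = real (size a) *\<^sub>R Poly_Mapping.single (a, b) f"
  "act deg_beta (Poly_Mapping.single (a, b) f) = real (size b) *\<^sub>R Poly_Mapping.single (a, b) f"
proof -
  have size: "(\<Sum>i\<in>UNIV. of_nat (count c i) * f) = real (size c) *\<^sub>R f" for c :: "'a multiset"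
  proof -
    have "size c = (\<Sum>i\<in>UNIV. count c i)"
      unfolding size_multiset_overloaded_eq by (rule sum.mono_neutral_left) (auto simp: not_in_iff)
    then show ?thesis by (simp add: sum_distrib_right[symmetric] scaleR_conv_of_real)
  qed
  have A: "act (mA i) (act (dA i) (Poly_Mapping.single (a, b) f))
      = Poly_Mapping.single (a, b) (of_nat (count a i) * f)" for i
    by (cases "i \<in># a") (simp_all add: act_weyl_single not_in_iff act_zero)
  have B: "act (mB i) (act (dB i) (Poly_Mapping.single (a, b) f))
      = Poly_Mapping.single (a, b) (of_nat (count b i) * f)" for i
    by (cases "i \<in># b") (simp_all add: act_weyl_single not_in_iff act_zero)
  show "act deg_alpha (Poly_Mapping.single (a, b) f) = real (size a) *\<^sub>R Poly_Mapping.single (a, b) f"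
    "act deg_beta (Poly_Mapping.single (a, b) f) = real (size b) *\<^sub>R Poly_Mapping.single (a, b) f"
    by (simp_all add: deg_alpha_def deg_beta_def act_sum act_simps A B linear_sum[OF linear_single, symmetric]
        size scaleR_single)
qed

lemma linear_lookup: "linear (\<lambda>P. Poly_Mapping.lookup P k)"
  by (rule linearI) (simp_all add: lookup_add lookup_scaleR)

lemma lookup_gl2:
  "Poly_Mapping.lookup (act deg_alpha P) (a, b) = real (size a) *\<^sub>R Poly_Mapping.lookup P (a, b)"
  "Poly_Mapping.lookup (act deg_beta P) (a, b) = real (size b) *\<^sub>R Poly_Mapping.lookup P (a, b)"
  "Poly_Mapping.lookup (act deg_total P) (a, b) = real (size a + size b) *\<^sub>R Poly_Mapping.lookup P (a, b)"
proof -
  note lin = linear_compose[OF linear_act linear_lookup, unfolded o_def]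
    linear_compose_scale_right[OF linear_lookup]
  show K: "Poly_Mapping.lookup (act deg_alpha P) (a, b) = real (size a) *\<^sub>R Poly_Mapping.lookup P (a, b)" for P
    by (rule linear_symbol_eqI[OF lin]) (auto simp: act_gl2_single lookup_scaleR lookup_single when_def)
  show L: "Poly_Mapping.lookup (act deg_beta P) (a, b) = real (size b) *\<^sub>R Poly_Mapping.lookup P (a, b)" for P
    by (rule linear_symbol_eqI[OF lin]) (auto simp: act_gl2_single lookup_scaleR lookup_single when_def)
  show "Poly_Mapping.lookup (act deg_total P) (a, b) = real (size a + size b) *\<^sub>R Poly_Mapping.lookup P (a, b)"
    by (simp add: deg_total_def act_simps lookup_add K L scaleR_add_left)
qed

lemma degree_eigen_lookup:
  assumes "act deg_total P = d *\<^sub>R P" "Poly_Mapping.lookup P (a, b) \<noteq> 0"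
  shows "d = real (size a + size b)"
  using arg_cong[OF assms(1), of "\<lambda>Q. Poly_Mapping.lookup Q (a, b)"] assms(2)
  by (simp add: lookup_gl2 lookup_scaleR)

lemma negative_weight_zero:
  "act deg_alpha P = - P \<Longrightarrow> P = 0" "act deg_beta P = - P \<Longrightarrow> P = 0" "act deg_total P = - P \<Longrightarrow> P = 0"
proof -
  have *: "f = 0" if "real k *\<^sub>R f = - f" for k and f :: "'a smooth_fun"
  proof -
    from that have "(real k + 1) *\<^sub>R f = 0" by (simp add: scaleR_add_left)
    then show "f = 0" by (simp add: add_nonneg_eq_0_iff)
  qed
  show "P = 0" if "act deg_alpha P = - P"
  proof (rule poly_mapping_eqI)
    fix k show "Poly_Mapping.lookup P k = Poly_Mapping.lookup 0 k"
      using *[of "size (fst k)"] lookup_gl2(1)[of P "fst k" "snd k"] that by simp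
  qed
  show "P = 0" if "act deg_beta P = - P"
  proof (rule poly_mapping_eqI)
    fix k show "Poly_Mapping.lookup P k = Poly_Mapping.lookup 0 k"
      using *[of "size (snd k)"] lookup_gl2(2)[of P "fst k" "snd k"] that by simp
  qed
  show "P = 0" if "act deg_total P = - P"
  proof (rule poly_mapping_eqI)
    fix k show "Poly_Mapping.lookup P k = Poly_Mapping.lookup 0 k"
      using *[of "size (fst k) + size (snd k)"] lookup_gl2(3)[of P "fst k" "snd k"] that by simp
  qed
qed

text \<open>The eigenvalue on the Young diagram with rows \<open>(d - j, j)\<close>; only \<open>2 * j \<le> d\<close> is meaningful.\<close>

definition gl2_eigenvalue :: "nat \<Rightarrow> nat \<Rightarrow> real" where
  "gl2_eigenvalue d j = real j * (real d + 1 - real j)"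

text \<open>Products of the factors \<open>gl2_casimir - gl2_eigenvalue d j\<close> over \<open>j < m\<close>; that such a product kills a
  symbol means that the symbol only has components for diagrams with second row shorter than \<open>m\<close>.\<close>

primrec char_product :: "nat \<Rightarrow> nat \<Rightarrow> 'n::finite symbol_endo" where
  "char_product d 0 = 1"
| "char_product d (Suc m) = (gl2_casimir - of_real (gl2_eigenvalue d m)) * char_product d m"

lemma char_product_commute:
  assumes "gl2_casimir * G = G * gl2_casimir"
  shows "char_product d m * G = G * char_product d m"
proof (induction m)
  case (Suc m)
  have "(gl2_casimir - of_real c) * G = G * (gl2_casimir - of_real c)" for c
    using assms by (simp add: of_real_def algebra_simps)
  with Suc show ?case by (simp add: mult.assoc) (simp add: mult.assoc[symmetric])
qed simp

lemma char_product_eigen: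
  assumes "act gl2_casimir P = c *\<^sub>R P"
  shows "act (char_product d m) P = (\<Prod>j<m. c - gl2_eigenvalue d j) *\<^sub>R P"
  by (induction m)
     (simp_all add: act_simps act_of_real act_scaleR assms algebra_simps)

lemma char_product_mono:
  "act (char_product d m) P = 0 \<Longrightarrow> act (char_product d (m + k)) P = 0"
  by (induction k) (simp_all add: act_simps act_zero)

text \<open>Highest weight theory in elementary form. The operator \<open>E\<close> trades one of the \<open>l\<close> variables of
  the second kind for one of the first; by induction the product for \<open>l\<close> variables annihilates its
  image, so what remains is killed by \<open>E\<close>, and on such a highest weight vector the Casimir
  operator is \<open>L (K + 1)\<close>. Arbitrary operators in place of the generators of \<open>gl(2)\<close> allow the
  two variables to be exchanged.\<close>

lemma char_product_bidegree:
  fixes K L E F :: "'n::finite symbol_endo"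
  assumes L_E: "L * E = E * L - E" and K_E: "K * E = E * K + E" and M_E: "gl2_casimir * E = E * gl2_casimir"
    and M_K: "gl2_casimir * K = K * gl2_casimir" and M_L: "gl2_casimir * L = L * gl2_casimir"
    and M: "gl2_casimir = L * (K + 1) - F * E"
    and neg: "\<And>P. act L P = - P \<Longrightarrow> P = 0"
    and P: "act K P = real k *\<^sub>R P" "act L P = real l *\<^sub>R P"
  shows "act (char_product (k + l) (Suc l)) P = 0"
  using P
proof (induction l arbitrary: k P)
  case 0
  have "act L (act E P) = - act E P"
    using arg_cong[OF L_E, of "\<lambda>G. act G P"] 0 by (simp add: act_simps act_zero)
  then have "act E P = 0" by (rule neg)
  moreover have "act L (act K P + P) = 0"
    using 0 by (simp add: act_add act_scaleR)
  ultimately have "act gl2_casimir P = 0"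
    unfolding M by (simp add: act_simps act_zero)
  then show ?case by (simp add: act_simps gl2_eigenvalue_def)
next
  case (Suc l)
  let ?d = "k + Suc l"
  define Y where "Y = act (char_product ?d (Suc l)) P"
  have EP: "act K (act E P) = real (Suc k) *\<^sub>R act E P" "act L (act E P) = real l *\<^sub>R act E P"
    using arg_cong[OF K_E, of "\<lambda>G. act G P"] arg_cong[OF L_E, of "\<lambda>G. act G P"] Suc.prems
    by (simp_all add: act_simps act_scaleR act_add algebra_simps)
  have com: "act G Y = act (char_product ?d (Suc l)) (act G P)" if "gl2_casimir * G = G * gl2_casimir" for G
    using arg_cong[OF char_product_commute[OF that], of "\<lambda>G. act G P"]
    unfolding Y_def act_simps(7) by (rule sym)
  have EY: "act E Y = 0" using Suc.IH[OF EP] by (simp add: com[OF M_E])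
  have KY: "act K Y = real k *\<^sub>R Y"
    by (simp only: com[OF M_K] Suc.prems act_scaleR) (simp only: Y_def)
  have LY: "act L Y = real (Suc l) *\<^sub>R Y"
    by (simp only: com[OF M_L] Suc.prems act_scaleR) (simp only: Y_def)
  have "act gl2_casimir Y = act L (act K Y + Y) - act F (act E Y)"
    by (subst M) (simp add: act_simps)
  also have "\<dots> = (real (Suc l) * (real k + 1)) *\<^sub>R Y"
    unfolding EY KY by (simp add: act_add act_scaleR LY act_zero algebra_simps)
  finally have "act gl2_casimir Y = gl2_eigenvalue ?d (Suc l) *\<^sub>R Y"
    by (simp add: gl2_eigenvalue_def)
  then have "act (gl2_casimir - of_real (gl2_eigenvalue ?d (Suc l))) Y = 0"
    by (simp only: act_simps act_of_real) simp
  then show ?case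
    unfolding char_product.simps(2)[of ?d "Suc l"] act_simps(7) Y_def .
qed

lemma char_product_single:
  "act (char_product (size a + size b) (Suc (min (size a) (size b)))) (Poly_Mapping.single (a, b) (f :: 'n::finite smooth_fun)) = 0"
proof -
  let ?P = "Poly_Mapping.single (a, b) f"
  have com: "gl2_casimir * beta_to_alpha = beta_to_alpha * (gl2_casimir :: 'n symbol_endo)" "gl2_casimir * alpha_to_beta = alpha_to_beta * (gl2_casimir :: 'n symbol_endo)"
    "gl2_casimir * deg_alpha = deg_alpha * (gl2_casimir :: 'n symbol_endo)" "gl2_casimir * deg_beta = deg_beta * (gl2_casimir :: 'n symbol_endo)"
    by (rule commutator_eq_0D, rule commutator_gl2_casimir_gl2)+
  have rel: "deg_beta * beta_to_alpha = beta_to_alpha * deg_beta - (beta_to_alpha :: 'n symbol_endo)" "deg_alpha * beta_to_alpha = beta_to_alpha * deg_alpha + (beta_to_alpha :: 'n symbol_endo)"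
    "deg_alpha * alpha_to_beta = alpha_to_beta * deg_alpha - (alpha_to_beta :: 'n symbol_endo)" "deg_beta * alpha_to_beta = alpha_to_beta * deg_beta + (alpha_to_beta :: 'n symbol_endo)"
    using gl2_relations(1-4) by (simp_all add: commutator_def algebra_simps)
  show ?thesis
  proof (cases "size b \<le> size a")
    case True
    then show ?thesis
      using char_product_bidegree[OF rel(1,2) com(1,3,4) gl2_casimir_def negative_weight_zero(2)
          act_gl2_single[of a b f]] by (simp add: min.absorb2 del: char_product.simps)
  next
    case False
    then show ?thesis
      using char_product_bidegree[OF rel(3,4) com(2,4,3) gl2_casimir_alt negative_weight_zero(1)
          act_gl2_single(2,1)[of a b f]] by (simp add: min.absorb1 add.commute del: char_product.simps)
  qed
qed

lemma gl2_casimir_spectrum: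
  assumes N: "act deg_total P = real d *\<^sub>R P" and M: "act gl2_casimir P = c *\<^sub>R P" and "P \<noteq> 0"
  obtains j where "2 * j \<le> d" "c = gl2_eigenvalue d j"
proof -
  let ?F = "char_product d (Suc (d div 2)) :: 'a symbol_endo"
  have "act ?F (Poly_Mapping.single k (Poly_Mapping.lookup P k)) = 0" for k
  proof (cases "Poly_Mapping.lookup P k = 0")
    case False
    obtain a b where k: "k = (a, b)" by force
    with False have d: "d = size a + size b" using degree_eigen_lookup[OF N] by fastforce
    have "Suc (d div 2) = Suc (min (size a) (size b)) + (d div 2 - min (size a) (size b))"
      unfolding d by auto
    then show ?thesis using char_product_mono[OF char_product_single] k d by metis
  qed (simp add: act_zero)
  then have "act ?F P = 0"
    by (subst symbol_sum_singles) (simp add: act_sum_right del: char_product.simps)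
  then have "(\<Prod>j<Suc (d div 2). c - gl2_eigenvalue d j) = 0"
    using char_product_eigen[OF M, of d "Suc (d div 2)"] \<open>P \<noteq> 0\<close> by simp
  then obtain j where "j < Suc (d div 2)" "c = gl2_eigenvalue d j"
    by (auto simp del: prod.lessThan_Suc)
  then show thesis by (intro that[of j]) auto
qed

lemma gl2_eigenvalue_inj:
  assumes "gl2_eigenvalue d i = gl2_eigenvalue d j" "2 * i \<le> d" "2 * j \<le> d"
  shows "i = j"
proof -
  have "(real i - real j) * (real d + 1 - real i - real j) = 0"
    using assms(1) by (simp add: gl2_eigenvalue_def algebra_simps)
  moreover have "real d + 1 - real i - real j > 0" using assms(2,3) by linarith
  ultimately show ?thesis by simp
qed

text \<open>A vector that is annihilated by a product of distinct linear factors is a sum of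
  eigenvectors.\<close>

lemma char_product_decompose:
  assumes "act deg_total P = real d *\<^sub>R P" "act (char_product d m) P = 0" "2 * m \<le> d + 2"
  shows "P \<in> span (\<Union>j\<in>{..<m}. {Y. act deg_total Y = real d *\<^sub>R Y \<and> act gl2_casimir Y = gl2_eigenvalue d j *\<^sub>R Y})"
  using assms
proof (induction m arbitrary: P)
  case 0
  then show ?case by (simp add: act_simps span_zero)
next
  case (Suc m)
  let ?E = "\<lambda>j. {Y :: 'a symbol. act deg_total Y = real d *\<^sub>R Y \<and> act gl2_casimir Y = gl2_eigenvalue d j *\<^sub>R Y}"
  let ?S = "span (\<Union>j\<in>{..<m}. ?E j)"
  let ?T = "gl2_casimir - of_real (gl2_eigenvalue d m) :: 'a symbol_endo"
  have "act (char_product d m) (act ?T P) = 0"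
    using arg_cong[OF char_product_commute[of ?T d m], of "\<lambda>G. act G P"] Suc.prems(2)
    by (simp add: act_simps act_diff act_scaleR algebra_simps of_real_def)
  moreover have "act deg_total (act ?T P) = real d *\<^sub>R act ?T P"
    using arg_cong[OF commutator_eq_0D[OF commutator_deg_total_gl2_casimir], of "\<lambda>G. act G P"] Suc.prems(1)
    by (simp add: act_simps act_diff act_of_real act_scaleR algebra_simps)
  ultimately have "act ?T P \<in> ?S"
    using Suc by simp
  moreover have "?S \<subseteq> act ?T ` ?S"
  proof (rule span_minimal)
    show "subspace (act ?T ` ?S)" by (rule linear_subspace_image[OF linear_act]) simp
    show "(\<Union>j\<in>{..<m}. ?E j) \<subseteq> act ?T ` ?S"
    proof (rule UN_least, rule subsetI)
      fix j Y assume j: "j \<in> {..<m}" and Y: "Y \<in> ?E j"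
      define c where "c = gl2_eigenvalue d j - gl2_eigenvalue d m"
      have "c \<noteq> 0" using gl2_eigenvalue_inj[of d j m] j Suc.prems(3) by (auto simp: c_def)
      moreover have "act ?T Y = c *\<^sub>R Y"
        using Y by (simp add: c_def act_simps act_of_real scaleR_diff_left)
      ultimately have T: "act ?T ((1 / c) *\<^sub>R Y) = Y"
        unfolding act_scaleR by simp
      have "(1 / c) *\<^sub>R Y \<in> ?S"
        using j Y by (intro span_scale span_base) blast
      then show "Y \<in> act ?T ` ?S" by (rule image_eqI[of Y "act ?T", OF T[symmetric]])
    qed
  qed
  ultimately obtain Z where Z: "Z \<in> ?S" "act ?T P = act ?T Z" by blast
  have NZ: "act deg_total Z = real d *\<^sub>R Z"
  proof -
    have sub: "subspace {Z. act deg_total Z = real d *\<^sub>R Z}"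
      by (auto simp: subspace_def act_add act_scaleR act_zero algebra_simps)
    have "(\<Union>j\<in>{..<m}. ?E j) \<subseteq> {Z. act deg_total Z = real d *\<^sub>R Z}" by auto
    from span_minimal[OF this sub] Z(1) show ?thesis by auto
  qed
  have "P - Z \<in> ?E m"
    using Z(2) NZ Suc.prems(1) by (simp add: act_diff act_simps act_of_real algebra_simps)
  then have "P - Z \<in> span (\<Union>j\<in>{..<Suc m}. ?E j)" by (intro span_base) auto
  moreover have "Z \<in> span (\<Union>j\<in>{..<Suc m}. ?E j)"
    by (rule subsetD[OF span_mono Z(1)]) (auto simp: less_Suc_eq)
  ultimately have "(P - Z) + Z \<in> span (\<Union>j\<in>{..<Suc m}. ?E j)" by (rule span_add)
  then show ?case by simp
qed

section \<open>The defect lowers the Casimir eigenvalue\<close>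

interpretation tri: triangular_perturbation "act deg_total" "act proj_casimir" "act casimir_defect :: 'n::finite symbol \<Rightarrow> 'n symbol"
  by (intro triangular_perturbation.intro linear_act)

lemma eig_iff: "P \<in> tri.eig d v \<longleftrightarrow> act deg_total P = real d *\<^sub>R P \<and> act gl2_casimir P = (real d * real d - real d - v) *\<^sub>R P"
proof -
  have "act proj_casimir P = v *\<^sub>R P \<longleftrightarrow> act gl2_casimir P = (real d * real d - real d - v) *\<^sub>R P"
    if "act deg_total P = real d *\<^sub>R P"
  proof -
    have "act proj_casimir P = (real d * real d - real d) *\<^sub>R P - act gl2_casimir P"
      using that by (simp add: proj_casimir_def act_simps act_scaleR algebra_simps)
    then have "act gl2_casimir P = (real d * real d - real d) *\<^sub>R P - act proj_casimir P" by simp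
    then show ?thesis
      unfolding scaleR_diff_left[of "real d * real d - real d" v] by auto
  qed
  then show ?thesis by (auto simp: tri.eig_def)
qed

lemma eig_preserved:
  assumes "commutator deg_total F = 0" "commutator proj_casimir F = 0" "P \<in> tri.eig d v"
  shows "act F P \<in> tri.eig d v"
proof -
  have "act deg_total (act F P) = act F (act deg_total P)" "act proj_casimir (act F P) = act F (act proj_casimir P)"
    using assms(1,2)[THEN commutator_eq_0D, THEN arg_cong[of _ _ "\<lambda>G. act G P"]] by (simp_all add: act_simps)
  with assms(3) show ?thesis by (simp add: tri.eig_def act_scaleR)
qed

lemma lower_preserved:
  assumes "commutator deg_total F = 0" "commutator proj_casimir F = 0" "P \<in> tri.lower d v"
  shows "act F P \<in> tri.lower d v"
  by (rule tri.linear_maps_lower[OF linear_act assms(3) _ tri.subspace_lower])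
     (blast intro: tri.eig_lower eig_preserved assms)

lemma lower_gl2:
  assumes "P \<in> tri.lower d v"
  shows "act deg_alpha P \<in> tri.lower d v" "act deg_beta P \<in> tri.lower d v"
  by (rule lower_preserved[OF _ _ assms];
      simp add: proj_casimir_gl2 deg_total_def commutator_linear commutator_self gl2_relations gl2_relations_swap)+

lemma single_in_span_eig:
  "Poly_Mapping.single (a, b) f \<in> span (\<Union>v. tri.eig (size a + size b) v)"
proof -
  let ?P = "Poly_Mapping.single (a, b) f" and ?d = "size a + size b"
  have N: "act deg_total ?P = real ?d *\<^sub>R ?P"
    by (simp add: deg_total_def act_simps act_gl2_single scaleR_add_left)
  have "{Y :: 'a symbol. act deg_total Y = real ?d *\<^sub>R Y \<and> act gl2_casimir Y = gl2_eigenvalue ?d j *\<^sub>R Y}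
      \<subseteq> tri.eig ?d (real ?d * real ?d - real ?d - gl2_eigenvalue ?d j)" for j
    by (auto simp: eig_iff)
  then have "(\<Union>j\<in>{..<m}. {Y :: 'a symbol. act deg_total Y = real ?d *\<^sub>R Y \<and> act gl2_casimir Y = gl2_eigenvalue ?d j *\<^sub>R Y})
      \<subseteq> (\<Union>v. tri.eig ?d v)" for m
    by blast
  from subsetD[OF span_mono[OF this] char_product_decompose[OF N char_product_single]]
  show ?thesis by simp
qed

lemma span_eig: "span (\<Union>d. \<Union>v. tri.eig d v) = (UNIV :: 'n::finite symbol set)"
proof -
  have "Poly_Mapping.single (a, b) f \<in> span (\<Union>d. \<Union>v. tri.eig d v)" for a b :: "'n multiset" and f
    by (rule subsetD[OF span_mono single_in_span_eig]) blast
  then have "P \<in> span (\<Union>d. \<Union>v. tri.eig d v)" for P :: "'n symbol"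
    by (subst symbol_sum_singles, intro span_sum) (metis surj_pair)
  then show ?thesis by auto
qed

lemma degree_zero_weights:
  assumes "act deg_total P = 0"
  shows "act deg_alpha P = 0" "act deg_beta P = 0"
proof -
  have "Poly_Mapping.lookup P k = 0 \<or> size (fst k) = 0 \<and> size (snd k) = 0" for k
    using lookup_gl2(3)[of P "fst k" "snd k"] assms by (auto simp: add_nonneg_eq_0_iff)
  then show "act deg_alpha P = 0" "act deg_beta P = 0"
    by (intro poly_mapping_eqI; metis lookup_gl2 lookup_zero of_nat_0 scaleR_eq_0_iff prod.collapse)+
qed

text \<open>The diagram \<open>(1, 1)\<close> consists of antisymmetric bivectors, which have one \<open>\<alpha>\<close> and one
  \<open>\<beta>\<close>.\<close>

lemma antisymmetric_weights:
  assumes N: "act deg_total P = 2 *\<^sub>R P" and M: "act gl2_casimir P = 2 *\<^sub>R P"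
  shows "act deg_alpha P = P" "act deg_beta P = P"
proof -
  have com: "gl2_casimir * deg_alpha = deg_alpha * (gl2_casimir :: 'a symbol_endo)" "gl2_casimir * deg_beta = deg_beta * (gl2_casimir :: 'a symbol_endo)"
    by (rule commutator_eq_0D, rule commutator_gl2_casimir_gl2)+
  have rel: "deg_beta * beta_to_alpha = beta_to_alpha * deg_beta - (beta_to_alpha :: 'a symbol_endo)" "deg_alpha * alpha_to_beta = alpha_to_beta * deg_alpha - (alpha_to_beta :: 'a symbol_endo)"
    using gl2_relations(2,3) by (simp_all add: commutator_def algebra_simps)
  have size: "size a + size b = 2" if "Poly_Mapping.lookup P (a, b) \<noteq> 0" for a b
    using degree_eigen_lookup[OF N that] by linarith
  \<comment> \<open>Y isolates the part of bidegree (2, 0), on which the Casimir operator is zero instead of 2.\<close>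
  define Y where "Y = act deg_alpha (act deg_alpha P) - act deg_alpha P"
  have MY: "act gl2_casimir Y = 2 *\<^sub>R Y"
    using arg_cong[OF com(1), of "\<lambda>G. act G P"] arg_cong[OF com(1), of "\<lambda>G. act G (act deg_alpha P)"] M
    by (simp add: Y_def act_simps act_diff act_scaleR scaleR_diff_right)
  have LY: "act deg_beta Y = 0"
  proof (rule poly_mapping_eqI)
    fix k :: "'a multiset \<times> 'a multiset"
    obtain a b where k: "k = (a, b)" by force
    have "real (size b) * (real (size a) * real (size a) - real (size a)) = 0 \<or> Poly_Mapping.lookup P (a, b) = 0"
    proof (cases "Poly_Mapping.lookup P (a, b) = 0")
      case False
      with size[of a b] have "size b = 0 \<or> size a = 0 \<or> size a = 1" by linarith
      then show ?thesis by auto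
    qed simp
    then show "Poly_Mapping.lookup (act deg_beta Y) k = Poly_Mapping.lookup 0 k"
      by (auto simp: k Y_def lookup_gl2 lookup_minus scaleR_diff_left[symmetric])
  qed
  have "act deg_beta (act beta_to_alpha Y) = - act beta_to_alpha Y"
    using arg_cong[OF rel(1), of "\<lambda>G. act G Y"] LY by (simp add: act_simps act_zero)
  then have "act beta_to_alpha Y = 0" by (rule negative_weight_zero)
  moreover have "act deg_beta (act deg_alpha Y + Y) = 0"
    using arg_cong[OF commutator_eq_0D[OF gl2_relations(6)], of "\<lambda>G. act G Y"] LY
    by (simp add: act_simps act_add act_zero)
  ultimately have "act gl2_casimir Y = 0" by (simp add: gl2_casimir_def act_simps act_zero)
  then have Y: "Y = 0" using MY by simp
  \<comment> \<open>Z isolates the part of bidegree (0, 2).\<close>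
  define Z where "Z = act deg_beta (act deg_beta P) - act deg_beta P"
  have MZ: "act gl2_casimir Z = 2 *\<^sub>R Z"
    using arg_cong[OF com(2), of "\<lambda>G. act G P"] arg_cong[OF com(2), of "\<lambda>G. act G (act deg_beta P)"] M
    by (simp add: Z_def act_simps act_diff act_scaleR scaleR_diff_right)
  have KZ: "act deg_alpha Z = 0"
  proof (rule poly_mapping_eqI)
    fix k :: "'a multiset \<times> 'a multiset"
    obtain a b where k: "k = (a, b)" by force
    have "real (size a) * (real (size b) * real (size b) - real (size b)) = 0 \<or> Poly_Mapping.lookup P (a, b) = 0"
    proof (cases "Poly_Mapping.lookup P (a, b) = 0")
      case False
      with size[of a b] have "size a = 0 \<or> size b = 0 \<or> size b = 1" by linarith
      then show ?thesis by auto
    qed simp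
    then show "Poly_Mapping.lookup (act deg_alpha Z) k = Poly_Mapping.lookup 0 k"
      by (auto simp: k Z_def lookup_gl2 lookup_minus scaleR_diff_left[symmetric])
  qed
  have "act deg_alpha (act alpha_to_beta Z) = - act alpha_to_beta Z"
    using arg_cong[OF rel(2), of "\<lambda>G. act G Z"] KZ by (simp add: act_simps act_zero)
  then have "act alpha_to_beta Z = 0" by (rule negative_weight_zero)
  moreover have "act deg_alpha (act deg_beta Z + Z) = 0"
    using arg_cong[OF commutator_eq_0D[OF gl2_relations(6)], of "\<lambda>G. act G Z"] KZ
    by (simp add: act_simps act_add act_zero)
  ultimately have "act gl2_casimir Z = 0" by (simp add: gl2_casimir_alt act_simps act_zero)
  then have Z: "Z = 0" using MZ by simp
  have "size a = 1 \<and> size b = 1" if "Poly_Mapping.lookup P (a, b) \<noteq> 0" for a b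
  proof -
    have "(real (size a) * real (size a) - real (size a)) *\<^sub>R Poly_Mapping.lookup P (a, b) = 0"
      "(real (size b) * real (size b) - real (size b)) *\<^sub>R Poly_Mapping.lookup P (a, b) = 0"
      using arg_cong[OF Y, of "\<lambda>Q. Poly_Mapping.lookup Q (a, b)"] arg_cong[OF Z, of "\<lambda>Q. Poly_Mapping.lookup Q (a, b)"]
      by (simp_all add: Y_def Z_def lookup_minus lookup_gl2 scaleR_diff_left)
    then have "size a = 0 \<or> size a = 1" "size b = 0 \<or> size b = 1" using that by auto
    with size[OF that] show ?thesis by auto
  qed
  then have "Poly_Mapping.lookup P k = 0 \<or> size (fst k) = 1 \<and> size (snd k) = 1" for k
    by (metis prod.collapse)
  then show "act deg_alpha P = P" "act deg_beta P = P"
    by (intro poly_mapping_eqI; metis lookup_gl2 of_nat_1 scaleR_one scaleR_zero_right prod.collapse)+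
qed

lemma eig_index:
  assumes "P \<in> tri.eig d v" "P \<noteq> 0"
  obtains j where "2 * j \<le> d" "v = real d * real d - real d - gl2_eigenvalue d j"
proof -
  have "act deg_total P = real d *\<^sub>R P" "act gl2_casimir P = (real d * real d - real d - v) *\<^sub>R P"
    using assms(1) unfolding eig_iff by auto
  then obtain j where "2 * j \<le> d" "real d * real d - real d - v = gl2_eigenvalue d j"
    using assms(2) by (rule gl2_casimir_spectrum)
  then show thesis by (intro that[of j]) auto
qed

text \<open>Both components of the derivative, one for each removable box, have a smaller Casimir eigenvalue:
  it drops by \<open>2 (d - 1) - j\<close> or by \<open>d + j - 3\<close>. A removal that does not leave a diagram is
  excluded by the spectrum or harmless. The two excluded pairs are those where a drop is zero.\<close>

lemma doublet_lower:
  assumes N: "act deg_total R = (real d - 1) *\<^sub>R R" and d: "1 \<le> d" and j: "2 * j \<le> d"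
    and quad: "act gl2_casimir (act gl2_casimir R) = (2 * gl2_eigenvalue d j - real d - 1) *\<^sub>R act gl2_casimir R
      - (gl2_eigenvalue d j * (gl2_eigenvalue d j - real d)) *\<^sub>R R"
    and nonresonant: "(d, j) \<noteq> (1, 0)" "(d, j) \<noteq> (2, 1)"
  shows "R \<in> tri.lower d (real d * real d - real d - gl2_eigenvalue d j)"
proof -
  let ?v = "real d * real d - real d - gl2_eigenvalue d j"
  \<comment> \<open>Casimir eigenvalues after removing a box from the first and from the second row.\<close>
  define c1 where "c1 = real j * (real d - real j)"
  define c2 where "c2 = (real j - 1) * (real d + 1 - real j)"
  have sum: "2 * gl2_eigenvalue d j - real d - 1 = c1 + c2"
    and prod: "gl2_eigenvalue d j * (gl2_eigenvalue d j - real d) = c1 * c2"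
    by (simp_all add: gl2_eigenvalue_def c1_def c2_def algebra_simps)
  have diff: "c1 - c2 = real d + 1 - 2 * real j" by (simp add: c1_def c2_def algebra_simps)
  then have pos: "c1 - c2 > 0" using j by linarith
  have N': "act deg_total (act gl2_casimir R - c *\<^sub>R R) = real (d - 1) *\<^sub>R (act gl2_casimir R - c *\<^sub>R R)" for c
  proof -
    have "act deg_total (act gl2_casimir R) = (real d - 1) *\<^sub>R act gl2_casimir R"
      using arg_cong[OF commutator_eq_0D[OF commutator_deg_total_gl2_casimir], of "\<lambda>G. act G R"] by (simp add: act_simps N act_scaleR)
    then show ?thesis
      using d by (simp add: act_diff act_scaleR N of_nat_diff scaleR_diff_right mult.commute)
  qed
  have M1: "act gl2_casimir (act gl2_casimir R - c2 *\<^sub>R R) = c1 *\<^sub>R (act gl2_casimir R - c2 *\<^sub>R R)"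
    and M2: "act gl2_casimir (act gl2_casimir R - c1 *\<^sub>R R) = c2 *\<^sub>R (act gl2_casimir R - c1 *\<^sub>R R)"
    using quad unfolding sum prod by (simp_all add: act_diff act_scaleR algebra_simps)
  have in_lower: "Y \<in> tri.lower d ?v"
    if Y: "act deg_total Y = real (d - 1) *\<^sub>R Y" "act gl2_casimir Y = c *\<^sub>R Y"
      and c: "c \<ge> 0 \<Longrightarrow> real (d - 1) * real (d - 1) - real (d - 1) - c < ?v" for Y c
  proof (cases "Y = 0")
    case True
    then show ?thesis by (simp add: subspace_0[OF tri.subspace_lower])
  next
    case False
    obtain i where i: "2 * i \<le> d - 1" "c = gl2_eigenvalue (d - 1) i"
      using gl2_casimir_spectrum[OF Y False] .
    have "c \<ge> 0" unfolding i(2) gl2_eigenvalue_def using i(1) by (intro mult_nonneg_nonneg) auto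
    moreover have "Y \<in> tri.eig (d - 1) (real (d - 1) * real (d - 1) - real (d - 1) - c)"
      using Y by (simp add: eig_iff)
    ultimately show ?thesis using c d by (intro tri.eig_lower) auto
  qed
  have d1: "real (d - 1) = real d - 1" using d by simp
  have Y1: "act gl2_casimir R - c2 *\<^sub>R R \<in> tri.lower d ?v"
  proof (rule in_lower[OF N' M1])
    have "?v - (real (d - 1) * real (d - 1) - real (d - 1) - c1) = 2 * (real d - 1) - real j"
      unfolding d1 by (simp add: gl2_eigenvalue_def c1_def algebra_simps)
    moreover have "2 * (real d - 1) - real j > 0"
    proof (cases "d = 1")
      case True
      with j nonresonant show ?thesis by auto
    next
      case False
      with d have "2 \<le> real d" by simp
      moreover have "2 * real j \<le> real d" using j by linarith
      ultimately have "0 < 2 * (real d - 1) - real j" by (simp add: field_simps)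
      then show ?thesis .
    qed
    ultimately show "real (d - 1) * real (d - 1) - real (d - 1) - c1 < ?v" by linarith
  qed
  have Y2: "act gl2_casimir R - c1 *\<^sub>R R \<in> tri.lower d ?v"
  proof (rule in_lower[OF N' M2])
    assume "c2 \<ge> 0"
    have "j \<noteq> 0"
    proof
      assume "j = 0"
      with \<open>c2 \<ge> 0\<close> show False by (simp add: c2_def)
    qed
    have "?v - (real (d - 1) * real (d - 1) - real (d - 1) - c2) = real d + real j - 3"
      unfolding d1 by (simp add: gl2_eigenvalue_def c2_def algebra_simps)
    moreover have "real d + real j - 3 > 0"
    proof (cases "d = 2")
      case True
      with j nonresonant \<open>j \<noteq> 0\<close> show ?thesis by auto
    next
      case False
      with j \<open>j \<noteq> 0\<close> have "3 \<le> real d" "1 \<le> real j" by linarith+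
      then show ?thesis by linarith
    qed
    ultimately show "real (d - 1) * real (d - 1) - real (d - 1) - c2 < ?v" by linarith
  qed
  have "R = (1 / (c1 - c2)) *\<^sub>R ((act gl2_casimir R - c2 *\<^sub>R R) - (act gl2_casimir R - c1 *\<^sub>R R))"
  proof -
    have "(act gl2_casimir R - c2 *\<^sub>R R) - (act gl2_casimir R - c1 *\<^sub>R R) = (c1 - c2) *\<^sub>R R"
      by (simp add: scaleR_diff_left)
    then show ?thesis using pos by simp
  qed
  then show ?thesis
    using subspace_scale[OF tri.subspace_lower subspace_diff[OF tri.subspace_lower Y1 Y2]] by metis
qed

text \<open>At the two resonant diagrams the defect vanishes: in degree one it is a degree operator applied
  to a constant, and on bivectors \<open>K D\<^bsub>\<alpha> h\<^esub> = D\<^bsub>\<alpha> h\<^esub> (K - 1) = 0\<close> and likewise for \<open>\<beta>\<close>.\<close>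

lemma defect_lowers:
  assumes P: "P \<in> tri.eig d v"
  shows "act (defect h) P \<in> tri.lower d v"
proof (cases "P = 0")
  case True
  then show ?thesis by (simp add: act_zero subspace_0[OF tri.subspace_lower])
next
  case False
  obtain j where j: "2 * j \<le> d" "v = real d * real d - real d - gl2_eigenvalue d j"
    using eig_index[OF P False] .
  have N: "act deg_total P = real d *\<^sub>R P" and M: "act gl2_casimir P = gl2_eigenvalue d j *\<^sub>R P"
    using P unfolding eig_iff j(2) by auto
  have ND: "act deg_total (act (dA h) P) = (real d - 1) *\<^sub>R act (dA h) P"
    "act deg_total (act (dB h) P) = (real d - 1) *\<^sub>R act (dB h) P"
  proof -
    have "deg_total * dA h = dA h * deg_total - dA h" "deg_total * dB h = dB h * deg_total - dB h"
      using gl2_on_generators[of h] by (simp_all add: commutator_def deg_total_def algebra_simps)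
    from this[THEN arg_cong[of _ _ "\<lambda>G. act G P"]] N
    show "act deg_total (act (dA h) P) = (real d - 1) *\<^sub>R act (dA h) P"
      "act deg_total (act (dB h) P) = (real d - 1) *\<^sub>R act (dB h) P"
      by (simp_all add: act_simps act_scaleR scaleR_diff_left)
  qed
  have defect: "act (defect h) P = act deg_alpha (act (dA h) P) + act deg_beta (act (dB h) P)"
    by (simp add: defect_def act_simps)
  consider "d = 0" | "(d, j) = (1, 0)" | "(d, j) = (2, 1)"
    | "1 \<le> d" "(d, j) \<noteq> (1, 0)" "(d, j) \<noteq> (2, 1)" by linarith
  then show ?thesis
  proof cases
    case 1
    then have "act (dA h) P = 0" "act (dB h) P = 0"
      using ND by (auto intro: negative_weight_zero(3))
    then show ?thesis unfolding defect by (simp add: act_zero subspace_0[OF tri.subspace_lower])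
  next
    case 2
    then have "act deg_total (act (dA h) P) = 0" "act deg_total (act (dB h) P) = 0" using ND by auto
    then show ?thesis unfolding defect
      by (simp add: degree_zero_weights subspace_0[OF tri.subspace_lower])
  next
    case 3
    then have KL: "act deg_alpha P = P" "act deg_beta P = P"
      using antisymmetric_weights[of P] N M by (auto simp: gl2_eigenvalue_def)
    have "deg_alpha * dA h = dA h * deg_alpha - dA h" "deg_beta * dB h = dB h * deg_beta - dB h"
      using gl2_on_generators[of h] by (simp_all add: commutator_def algebra_simps)
    from this[THEN arg_cong[of _ _ "\<lambda>G. act G P"]] KL
    have "act deg_alpha (act (dA h) P) = 0" "act deg_beta (act (dB h) P) = 0"
      by (simp_all add: act_simps)
    then show ?thesis unfolding defect by (simp add: subspace_0[OF tri.subspace_lower])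
  next
    case 4
    have "act (dA h) P \<in> tri.lower d v" "act (dB h) P \<in> tri.lower d v"
      unfolding j(2)
      by (rule doublet_lower[OF ND(1) 4(1) j(1) casimir_quadratic(1)[OF M N] 4(2,3)],
          rule doublet_lower[OF ND(2) 4(1) j(1) casimir_quadratic(2)[OF M N] 4(2,3)])
    then show ?thesis unfolding defect
      by (intro subspace_add[OF tri.subspace_lower] lower_gl2)
  qed
qed

lemma casimir_defect_lowers:
  assumes P: "P \<in> tri.eig d v"
  shows "act casimir_defect P \<in> tri.lower d v"
proof -
  have "act (dX h) P \<in> tri.eig d v" for h
    by (rule eig_preserved[OF _ _ P]) (simp_all add: commutator_proj_casimir deg_total_def commutator_linear gl2_on_generators)
  then show ?thesis
    unfolding casimir_defect_sum act_sum act_simps by (intro subspace_sum[OF tri.subspace_lower] defect_lowers)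
qed

interpretation tri: lowering_perturbation "act deg_total" "act proj_casimir" "act casimir_defect :: 'n::finite symbol \<Rightarrow> 'n symbol"
  by unfold_locales (rule span_eig casimir_defect_lowers; assumption?)+

section \<open>Lie derivatives along the projective algebra\<close>

lemma coeff_const_simps:
  "coeff_const 0 = 0" "coeff_const 1 = 1" "coeff_const (f + g) = coeff_const f + coeff_const g"
  "coeff_const (f * g) = coeff_const f * coeff_const g" "coeff_const (c *\<^sub>R f) = c *\<^sub>R coeff_const f"
  "coeff_const (of_nat k) = of_nat k"
  by (simp_all add: coeff_const_def single_add mult_single scaleR_single)

definition coeff_op :: "'n::finite smooth_fun \<Rightarrow> 'n symbol_endo" where "coeff_op f = mult_op (coeff_const f)"

lemma coeff_op_simps:
  "coeff_op 0 = 0" "coeff_op 1 = 1" "coeff_op (f + g) = coeff_op f + coeff_op g" "coeff_op (f * g) = coeff_op f * coeff_op g"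
  "coeff_op (c *\<^sub>R f) = c *\<^sub>R coeff_op f" "coeff_op (coord i) = mX i" "coeff_op (if b then f else g) = (if b then coeff_op f else coeff_op g)"
  by (rule symbol_endo_eqI;
      simp add: coeff_op_def act_basic coeff_const_simps act_simps distrib_right mult.assoc mX_def
        scaleR_symbol_mult)+

definition lie_endo :: "real \<Rightarrow> 'n::finite vector_field \<Rightarrow> 'n symbol_endo" where
  "lie_endo \<delta> X = (\<Sum>i\<in>UNIV. coeff_op (X $ i) * dX i)
     - (\<Sum>i\<in>UNIV. \<Sum>j\<in>UNIV. coeff_op (pd j (X $ i)) * gl_vec i j) + \<delta> *\<^sub>R coeff_op (divergence X)"

lemma lie_symbol_eq: "lie_symbol \<delta> X P = act (lie_endo \<delta> X) P"
  by (simp add: lie_symbol_def lie_endo_def act_simps act_sum coeff_op_def act_basic gl_vec_def mA_def mB_def)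

lemma divergence_linear:
  "divergence (X + Y) = divergence X + divergence Y" "divergence (c *\<^sub>R X) = c *\<^sub>R divergence X"
  by (simp_all add: divergence_def pd_add sum.distrib pd_scaleR scaleR_sum_right)

lemma lie_endo_linear:
  "lie_endo \<delta> (X + Y) = lie_endo \<delta> X + lie_endo \<delta> Y" "lie_endo \<delta> (c *\<^sub>R X) = c *\<^sub>R lie_endo \<delta> X"
  by (simp_all add: lie_endo_def pd_add pd_scaleR coeff_op_simps distrib_right sum.distrib divergence_linear
      scaleR_add_right scaleR_diff_right scaleR_sum_right mult.commute)

lemma axis_component: "axis i f $ k = (if k = i then f else 0)"
  by (simp add: axis_def)

lemma pd_one: "pd i 1 = 0"
  using pd_of_real[of i 1] by simp

lemma pd_if: "pd i (if b then f else g) = (if b then pd i f else pd i g)"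
  by simp

lemma divergence_generators:
  fixes h :: "'n::finite"
  shows
  "divergence (axis i 1) = 0" "divergence (axis i (coord j)) = (if i = j then 1 else 0)"
  "divergence (\<chi> i. coord h * coord i ) = real (CARD('n) + 1) *\<^sub>R coord h"
proof -
  show "divergence (axis i 1) = 0"
    by (simp add: divergence_def axis_component pd_if pd_one pd_zero cong: if_cong)
  show "divergence (axis i (coord j)) = (if i = j then 1 else 0)"
    by (simp add: divergence_def axis_component pd_if pd_coord pd_zero cong: if_cong)
  have "divergence (\<chi> i. coord h * coord i ) = coord h + of_nat (CARD('n)) * coord h"
    by (simp add: divergence_def pd_mult pd_coord sum.distrib if_distrib[of "\<lambda>x. x * _"] cong: if_cong)
  then show "divergence (\<chi> i. coord h * coord i ) = real (CARD('n) + 1) *\<^sub>R coord h"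
    by (simp add: scaleR_add_left scaleR_conv_of_real distrib_right)
qed

lemma sum_gl_vec: "(\<Sum>i\<in>UNIV. gl_vec i i) = deg_total"
  by (simp add: gl_vec_def deg_total_def deg_alpha_def deg_beta_def sum.distrib)

lemma lie_endo_generators:
  "lie_endo 1 (axis i 1) = dX i" "lie_endo 1 (axis i (coord j)) = lie_linear i j"
  "lie_endo 1 (\<chi> i. coord h * coord i) = lie_quadratic h"
proof -
  show "lie_endo 1 (axis i 1) = dX i"
    by (simp add: lie_endo_def divergence_generators axis_component pd_if pd_one pd_zero coeff_op_simps
        if_distrib[of "\<lambda>x. x * _"] cong: if_cong)
  have "(\<Sum>k\<in>UNIV. \<Sum>l\<in>UNIV. coeff_op (pd l (axis i (coord j) $ k)) * gl_vec k l) = gl_vec i j"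
  proof -
    have "(\<Sum>l\<in>UNIV. coeff_op (pd l (axis i (coord j) $ k)) * gl_vec k l) = (if k = i then gl_vec i j else 0)" for k
      by (simp add: axis_component pd_if pd_coord pd_zero coeff_op_simps if_distrib[of "\<lambda>x. x * _"] cong: if_cong)
    then show ?thesis by simp
  qed
  then show "lie_endo 1 (axis i (coord j)) = lie_linear i j"
    unfolding lie_endo_def lie_linear_def divergence_generators
    by (simp add: axis_component coeff_op_simps if_distrib[of "\<lambda>x. x * _"] cong: if_cong)
  have 1: "(\<Sum>i\<in>UNIV. \<Sum>j\<in>UNIV. coeff_op (pd j (coord h * coord i)) * gl_vec i j)
      = (\<Sum>i\<in>UNIV. mX i * gl_vec i h) + mX h * deg_total"
  proof -
    have "(\<Sum>j\<in>UNIV. coeff_op (pd j (coord h * coord i)) * gl_vec i j) = mX i * gl_vec i h + mX h * gl_vec i i" for i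
      by (simp add: pd_mult pd_coord coeff_op_simps distrib_right sum.distrib
          if_distrib[of "\<lambda>x. x * _"] if_distrib[of "\<lambda>x. _ * x"] cong: if_cong)
    then show ?thesis by (simp add: sum.distrib sum_distrib_left[symmetric] sum_gl_vec)
  qed
  have 2: "(\<Sum>i\<in>UNIV. coeff_op (coord h * coord i) * dX i) = mX h * euler"
    by (simp add: coeff_op_simps euler_def sum_distrib_left mult.assoc)
  have 3: "real k *\<^sub>R mX h = mX h * of_nat k" for k
    by (simp only: scaleR_conv_of_real of_real_of_nat_eq mult_of_nat_commute)
  show "lie_endo 1 (\<chi> i. coord h * coord i) = lie_quadratic h"
    unfolding lie_endo_def lie_quadratic_def divergence_generators vec_lambda_beta 1 2
    unfolding coeff_op_simps distrib_left right_diff_distrib scaleR_one 3 by simp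
qed

subsection \<open>The action on bidifferential operators\<close>

lemma bidiff_op_eq: "bidiff_op P f g = (\<Sum>k\<in>Poly_Mapping.keys P.
    (\<lambda>k c. c * multi_pd (fst k) f * multi_pd (snd k) g) k (Poly_Mapping.lookup P k))"
  by (simp add: bidiff_op_def case_prod_beta)

lemma linear_bidiff_op: "linear (\<lambda>P. bidiff_op P f g)"
  unfolding bidiff_op_eq
  by (rule linear_keys_sum) (auto intro!: linearI simp: distrib_right)

lemma bidiff_op_single: "bidiff_op (Poly_Mapping.single (a, b) c) f g = c * multi_pd a f * multi_pd b g"
  unfolding bidiff_op_eq
  using keys_sum_single[of "\<lambda>k c. c * multi_pd (fst k) f * multi_pd (snd k) g"] by simp

lemma pd_multi_pd: "pd i (multi_pd a f) = multi_pd (add_mset i a) f"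
  by (simp add: multi_pd_def)

lemma multi_pd_linear:
  "multi_pd a (f + g) = multi_pd a f + multi_pd a g" "multi_pd a (c *\<^sub>R f) = c *\<^sub>R multi_pd a f"
  by (induction a arbitrary: f g) (simp_all add: multi_pd_empty multi_pd_add_mset pd_add pd_scaleR)

lemma multi_pd_zero: "multi_pd a 0 = 0"
  using multi_pd_linear(2)[of a 0 0] by simp

lemma multi_pd_coord:
  "multi_pd a (coord j * f) = coord j * multi_pd a f + of_nat (count a j) * multi_pd (a - {#j#}) f"
proof (induction a arbitrary: f)
  case (add i a)
  have step: "multi_pd (add_mset i a) (coord j * f) = (if i = j then multi_pd a f else 0)
      + (coord j * multi_pd a (pd i f) + of_nat (count a j) * multi_pd (a - {#j#}) (pd i f))"
    by (simp add: multi_pd_add_mset pd_mult pd_coord multi_pd_linear multi_pd_zero add.IH)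
  show ?case
  proof (cases "i = j")
    case True
    have "of_nat (count a j) * multi_pd (a - {#j#}) (pd j f) = of_nat (count a j) * multi_pd a f"
    proof (cases "j \<in># a")
      case True
      then obtain c where "a = add_mset j c" by (meson multi_member_split)
      then show ?thesis by (simp add: multi_pd_add_mset)
    qed (simp add: not_in_iff)
    with True show ?thesis unfolding step by (simp add: multi_pd_add_mset distrib_right)
  next
    case False
    then show ?thesis unfolding step by (simp add: multi_pd_add_mset)
  qed
qed (simp add: multi_pd_empty)

lemma bidiff_op_linear_arguments:
  "bidiff_op P (f + f') g = bidiff_op P f g + bidiff_op P f' g"
  "bidiff_op P (c *\<^sub>R f) g = c *\<^sub>R bidiff_op P f g"
  "bidiff_op P f (g + g') = bidiff_op P f g + bidiff_op P f g'"
  "bidiff_op P f (c *\<^sub>R g) = c *\<^sub>R bidiff_op P f g"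
  by (simp_all add: bidiff_op_eq multi_pd_linear distrib_left distrib_right sum.distrib scaleR_sum_right)

lemma bidiff_op_sum_arguments:
  "bidiff_op P (\<Sum>i\<in>I. f i) g = (\<Sum>i\<in>I. bidiff_op P (f i) g)"
  "bidiff_op P u (\<Sum>i\<in>I. h i) = (\<Sum>i\<in>I. bidiff_op P u (h i))"
proof -
  have "linear (\<lambda>f. bidiff_op P f g)" "linear (\<lambda>g. bidiff_op P f g)" for f g
    by (auto intro!: linearI simp: bidiff_op_linear_arguments)
  from this[THEN linear_sum] show
  "bidiff_op P (\<Sum>i\<in>I. f i) g = (\<Sum>i\<in>I. bidiff_op P (f i) g)"
  "bidiff_op P u (\<Sum>i\<in>I. h i) = (\<Sum>i\<in>I. bidiff_op P u (h i))" by simp_all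
qed

text \<open>The dictionary between operators and symbols: multiplications and derivatives before or after a
  bidifferential operator act on its polynomial form through the generators.\<close>

lemma bidiff_op_weyl:
  "bidiff_op P (pd i f) g = bidiff_op (act (mA i) P) f g"
  "bidiff_op P f (pd i g) = bidiff_op (act (mB i) P) f g"
  "coord j * bidiff_op P f g = bidiff_op (act (mX j) P) f g"
  "bidiff_op P (coord j * f) g = bidiff_op (act (mX j) P) f g + bidiff_op (act (dA j) P) f g"
  "bidiff_op P f (coord j * g) = bidiff_op (act (mX j) P) f g + bidiff_op (act (dB j) P) f g"
  "pd i (bidiff_op P f g) = bidiff_op (act (dX i) P) f g + bidiff_op (act (mA i) P) f g + bidiff_op (act (mB i) P) f g"
proof -
  note B = linear_bidiff_op
  have BA: "linear (\<lambda>P. bidiff_op (act F P) f g)" for F and f g :: "'a smooth_fun"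
    using linear_compose[OF linear_act B] by (simp add: o_def)
  show "bidiff_op P (pd i f) g = bidiff_op (act (mA i) P) f g"
    by (rule linear_symbol_eqI[OF B BA]) (simp add: bidiff_op_single act_weyl_single multi_pd_add_mset)
  show "bidiff_op P f (pd i g) = bidiff_op (act (mB i) P) f g"
    by (rule linear_symbol_eqI[OF B BA]) (simp add: bidiff_op_single act_weyl_single multi_pd_add_mset)
  show "coord j * bidiff_op P f g = bidiff_op (act (mX j) P) f g"
    by (rule linear_symbol_eqI[OF _ BA])
       (auto intro!: linearI simp: bidiff_op_single act_weyl_single mult.assoc linear_add[OF B] linear_cmul[OF B] distrib_left)
  show "bidiff_op P (coord j * f) g = bidiff_op (act (mX j) P) f g + bidiff_op (act (dA j) P) f g"
    by (rule linear_symbol_eqI[OF B linear_compose_add[OF BA BA]])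
       (simp only: bidiff_op_single act_weyl_single multi_pd_coord, simp add: algebra_simps)
  show "bidiff_op P f (coord j * g) = bidiff_op (act (mX j) P) f g + bidiff_op (act (dB j) P) f g"
    by (rule linear_symbol_eqI[OF B linear_compose_add[OF BA BA]])
       (simp only: bidiff_op_single act_weyl_single multi_pd_coord, simp add: algebra_simps)
  show "pd i (bidiff_op P f g) = bidiff_op (act (dX i) P) f g + bidiff_op (act (mA i) P) f g + bidiff_op (act (mB i) P) f g"
    by (rule linear_symbol_eqI[OF _ linear_compose_add[OF linear_compose_add[OF BA BA] BA]])
       (auto intro!: linearI simp: bidiff_op_single act_weyl_single pd_mult pd_multi_pd pd_add pd_scaleR
         linear_add[OF B] linear_cmul[OF B] algebra_simps)
qed

lemma lie_density_generators:
  "lie_density l (axis i 1) f = pd i f"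
  "lie_density l (axis i (coord j)) f = coord j * pd i f + (if i = j then l else 0) *\<^sub>R f"
  "lie_density l (\<chi> i. coord h * coord i) f
    = (\<Sum>i\<in>UNIV. coord h * (coord i * pd i f)) + (l * real (CARD('n::finite) + 1)) *\<^sub>R (coord (h::'n) * f)"
  unfolding lie_density_def divergence_generators
  by (simp_all add: axis_component mult.assoc if_distrib[of "\<lambda>x. x * _"] cong: if_cong)

lemma bidiff_op_act:
  "bidiff_op (act (F + G) P) f g = bidiff_op (act F P) f g + bidiff_op (act G P) f g"
  "bidiff_op (act (F - G) P) f g = bidiff_op (act F P) f g - bidiff_op (act G P) f g"
  "bidiff_op (act (c *\<^sub>R F) P) f g = c *\<^sub>R bidiff_op (act F P) f g"
  "bidiff_op (act (\<Sum>i\<in>I. H i) P) f g = (\<Sum>i\<in>I. bidiff_op (act (H i) P) f g)"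
  by (simp_all add: act_simps act_sum linear_add[OF linear_bidiff_op] linear_diff[OF linear_bidiff_op]
      linear_cmul[OF linear_bidiff_op] linear_sum[OF linear_bidiff_op])

text \<open>The defect for arbitrary weights; it is \<open>defect\<close> when both are zero.\<close>

definition weighted_defect :: "real \<Rightarrow> real \<Rightarrow> 'n::finite \<Rightarrow> 'n symbol_endo" where
  "weighted_defect l1 l2 h = defect h + (l1 * real (CARD('n) + 1)) *\<^sub>R dA h + (l2 * real (CARD('n) + 1)) *\<^sub>R dB h"

lemma lie_op_translation: "lie_op l1 l2 m (axis i 1) (bidiff_op P) = bidiff_op (act (dX i) P)"
  by (simp add: lie_op_def lie_density_generators bidiff_op_weyl fun_eq_iff)

lemma lie_op_linear_field:
  assumes "m = l1 + l2 + 1"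
  shows "lie_op l1 l2 m (axis i (coord j)) (bidiff_op P) = bidiff_op (act (lie_linear i j) P)"
proof (intro ext)
  fix f g
  have com: "mA i * mX j = mX j * mA i" "mB i * mX j = mX j * mB i"
    by (rule commutator_eq_0D, rule weyl)+
  note com' = com[THEN arg_cong[of _ _ "\<lambda>G. act G P"], unfolded act_simps]
  show "lie_op l1 l2 m (axis i (coord j)) (bidiff_op P) f g = bidiff_op (act (lie_linear i j) P) f g"
    unfolding lie_op_def lie_density_generators bidiff_op_linear_arguments bidiff_op_weyl
    by (simp add: lie_linear_def gl_vec_def bidiff_op_act assms act_simps act_add com' distrib_left bidiff_op_weyl(3)
        linear_add[OF linear_bidiff_op] linear_diff[OF linear_bidiff_op] linear_0[OF linear_bidiff_op] algebra_simps)
qed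

lemma lie_op_quadratic_field:
  fixes h :: "'n::finite"
  assumes "m = l1 + l2 + 1"
  shows "lie_op l1 l2 m (\<chi> i. coord h * coord i) (bidiff_op P) = bidiff_op (act (lie_quadratic h - weighted_defect l1 l2 h) P)"
proof (intro ext)
  fix f g :: "'n smooth_fun"
  define q where "q = real (CARD('n) + 1)"
  let ?B = "\<lambda>F. bidiff_op (act F P) f g"
  have T: "lie_density m (\<chi> i. coord h * coord i) (bidiff_op P f g)
      = ?B ((\<Sum>i\<in>UNIV. mX h * (mX i * (dX i + mA i + mB i))) + (m * q) *\<^sub>R mX h)"
    unfolding lie_density_generators q_def[symmetric] bidiff_op_weyl
    by (simp add: bidiff_op_act sum.distrib distrib_left act_simps linear_add[OF linear_bidiff_op] linear_cmul[OF linear_bidiff_op] bidiff_op_weyl)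
  have F: "bidiff_op P (lie_density l1 (\<chi> i. coord h * coord i) f) g
      = ?B ((\<Sum>i\<in>UNIV. mA i * mX i * (mX h + dA h) + mA i * dA i * (mX h + dA h)) + (l1 * q) *\<^sub>R (mX h + dA h))"
    unfolding lie_density_generators q_def[symmetric] bidiff_op_linear_arguments bidiff_op_sum_arguments bidiff_op_weyl
    by (simp add: bidiff_op_act sum.distrib distrib_left act_simps scaleR_add_right act_sum
        linear_add[OF linear_bidiff_op] linear_cmul[OF linear_bidiff_op] linear_sum[OF linear_bidiff_op])
  have G: "bidiff_op P f (lie_density l2 (\<chi> i. coord h * coord i) g)
      = ?B ((\<Sum>i\<in>UNIV. mB i * mX i * (mX h + dB h) + mB i * dB i * (mX h + dB h)) + (l2 * q) *\<^sub>R (mX h + dB h))"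
    unfolding lie_density_generators q_def[symmetric] bidiff_op_linear_arguments bidiff_op_sum_arguments bidiff_op_weyl
    by (simp add: bidiff_op_act sum.distrib distrib_left act_simps scaleR_add_right act_sum
        linear_add[OF linear_bidiff_op] linear_cmul[OF linear_bidiff_op] linear_sum[OF linear_bidiff_op])
  have com: "mA i * mX j = mX j * mA i" "mB i * mX j = mX j * mB i" "mX j * mX i = mX i * mX j"
    "dA i * mX j = mX j * dA i" "dB i * mX j = mX j * dB i" for i j :: 'n
    by (rule commutator_eq_0D, rule weyl)+
  have K: "deg_alpha * mX h = mX h * deg_alpha" "deg_beta * mX h = mX h * deg_beta"
    by (rule commutator_eq_0D, rule gl2_on_generators)+
  have "(\<Sum>i\<in>UNIV. mX h * (mX i * (dX i + mA i + mB i))) + (m * q) *\<^sub>R mX h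
     - ((\<Sum>i\<in>UNIV. mA i * mX i * (mX h + dA h) + mA i * dA i * (mX h + dA h)) + (l1 * q) *\<^sub>R (mX h + dA h))
     - ((\<Sum>i\<in>UNIV. mB i * mX i * (mX h + dB h) + mB i * dB i * (mX h + dB h)) + (l2 * q) *\<^sub>R (mX h + dB h))
     = lie_quadratic h - weighted_defect l1 l2 h"
  proof -
    have s1: "(\<Sum>i\<in>UNIV. mX h * (mX i * (dX i + mA i + mB i)))
      = mX h * euler + (\<Sum>i\<in>UNIV. mX h * (mX i * mA i)) + (\<Sum>i\<in>UNIV. mX h * (mX i * mB i))"
      by (simp add: euler_def distrib_left sum.distrib sum_distrib_left)
    have s2: "(\<Sum>i\<in>UNIV. mA i * mX i * (mX h + dA h) + mA i * dA i * (mX h + dA h))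
      = (\<Sum>i\<in>UNIV. mX h * (mX i * mA i)) + (\<Sum>i\<in>UNIV. mX i * (mA i * dA h)) + mX h * deg_alpha + deg_alpha * dA h"
    proof -
      have a: "mA i * mX i * (mX h + dA h) = mX h * (mX i * mA i) + mX i * (mA i * dA h)" for i
      proof -
        have "mX i * mA i * mX h = mX i * mX h * mA i" by (simp add: mult.assoc com(1)[of i h])
        also have "\<dots> = mX h * (mX i * mA i)" unfolding com(3)[of i h] by (simp add: mult.assoc)
        finally show ?thesis
          unfolding com(1)[of i i] distrib_left by (simp add: mult.assoc)
      qed
      have b: "(\<Sum>i\<in>UNIV. mA i * dA i * (mX h + dA h)) = mX h * deg_alpha + deg_alpha * dA h"
        unfolding sum_distrib_right[symmetric] deg_alpha_def[symmetric] by (simp add: distrib_left K)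
      show ?thesis unfolding sum.distrib b a by (simp add: sum.distrib)
    qed
    have s3: "(\<Sum>i\<in>UNIV. mB i * mX i * (mX h + dB h) + mB i * dB i * (mX h + dB h))
      = (\<Sum>i\<in>UNIV. mX h * (mX i * mB i)) + (\<Sum>i\<in>UNIV. mX i * (mB i * dB h)) + mX h * deg_beta + deg_beta * dB h"
    proof -
      have a: "mB i * mX i * (mX h + dB h) = mX h * (mX i * mB i) + mX i * (mB i * dB h)" for i
      proof -
        have "mX i * mB i * mX h = mX i * mX h * mB i" by (simp add: mult.assoc com(2)[of i h])
        also have "\<dots> = mX h * (mX i * mB i)" unfolding com(3)[of i h] by (simp add: mult.assoc)
        finally show ?thesis
          unfolding com(2)[of i i] distrib_left by (simp add: mult.assoc)
      qed
      have b: "(\<Sum>i\<in>UNIV. mB i * dB i * (mX h + dB h)) = mX h * deg_beta + deg_beta * dB h"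
        unfolding sum_distrib_right[symmetric] deg_beta_def[symmetric] by (simp add: distrib_left K)
      show ?thesis unfolding sum.distrib b a by (simp add: sum.distrib)
    qed
    have s4: "(\<Sum>i\<in>UNIV. mX i * gl_vec i h) = (\<Sum>i\<in>UNIV. mX i * (mA i * dA h)) + (\<Sum>i\<in>UNIV. mX i * (mB i * dB h))"
      by (simp add: gl_vec_def distrib_left sum.distrib)
    have n: "(of_nat (CARD('n) + 1) :: 'n symbol_endo) = of_real q" by (simp add: q_def)
    have s5: "mX h * of_real q = q *\<^sub>R mX h" by (simp add: of_real_def)
    have s6: "(m * q) *\<^sub>R mX h = q *\<^sub>R mX h + (l1 * q) *\<^sub>R mX h + (l2 * q) *\<^sub>R mX h"
    proof -
      have "m * q = q + l1 * q + l2 * q" by (simp add: assms algebra_simps)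
      then show ?thesis by (simp only: scaleR_add_left)
    qed
    have lie_quadratic': "lie_quadratic h = mX h * euler - (mX h * deg_alpha + mX h * deg_beta) + q *\<^sub>R mX h
        - ((\<Sum>i\<in>UNIV. mX i * (mA i * dA h)) + (\<Sum>i\<in>UNIV. mX i * (mB i * dB h)))"
      unfolding lie_quadratic_def n s4 deg_total_def distrib_left right_diff_distrib s5 ..
    have cancel: "e + a + b + (x + x1 + x2) - (a + a' + u + u' + (x1 + w1)) - (b + b' + v + v' + (x2 + w2))
        = e - (u + v) + x - (a' + b') - (u' + v' + w1 + w2)"
      for e a b x x1 x2 a' u u' w1 b' v v' w2 :: "'n symbol_endo"
      by simp
    show ?thesis
      unfolding s1 s2 s3 s6 lie_quadratic' weighted_defect_def defect_def q_def[symmetric] scaleR_add_right by (rule cancel)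
  qed
  then show "lie_op l1 l2 m (\<chi> i. coord h * coord i) (bidiff_op P) f g
      = bidiff_op (act (lie_quadratic h - weighted_defect l1 l2 h) P) f g"
    unfolding lie_op_def T F G bidiff_op_act(2)[symmetric] by simp
qed

section \<open>Symbol maps from unipotent intertwiners\<close>

lemma lie_density_linear_field:
  "lie_density l (X + Y) f = lie_density l X f + lie_density l Y f"
  "lie_density l (c *\<^sub>R X) f = c *\<^sub>R lie_density l X f"
  by (simp_all add: lie_density_def divergence_linear distrib_right sum.distrib scaleR_add_right
      scaleR_sum_right)

lemma lie_op_linear:
  "lie_op l1 l2 m (X + Y) (bidiff_op P) f g
    = lie_op l1 l2 m X (bidiff_op P) f g + lie_op l1 l2 m Y (bidiff_op P) f g"
  "lie_op l1 l2 m (c *\<^sub>R X) (bidiff_op P) f g = c *\<^sub>R lie_op l1 l2 m X (bidiff_op P) f g"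
  by (simp_all add: lie_op_def lie_density_linear_field bidiff_op_linear_arguments scaleR_diff_right)

text \<open>The hypotheses are statements about symbols. Both sides are linear in the field, so the three
  families that span the projective algebra suffice.\<close>

lemma lie_equivariance_on_generators:
  fixes Q :: "'n::finite symbol \<Rightarrow> 'n symbol"
  assumes Q: "linear Q" and m: "m = l1 + l2 + 1"
    and translation: "\<And>i P. act (dX i) (Q P) = Q (act (dX i) P)"
    and linear_field: "\<And>i j P. act (lie_linear i j) (Q P) = Q (act (lie_linear i j) P)"
    and quadratic: "\<And>h P. act (lie_quadratic h - weighted_defect l1 l2 h) (Q P) = Q (act (lie_quadratic h) P)"
    and X: "X \<in> sl_fields"
  shows "lie_op l1 l2 m X (bidiff_op (Q P)) = bidiff_op (Q (lie_symbol 1 X P))"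
proof -
  let ?G = "{X. \<forall>P. lie_op l1 l2 m X (bidiff_op (Q P)) = bidiff_op (Q (lie_symbol 1 X P))}"
  note B = linear_bidiff_op
  have lsym: "lie_symbol 1 (X + Y) P = lie_symbol 1 X P + lie_symbol 1 Y P"
    "lie_symbol 1 (c *\<^sub>R X) P = c *\<^sub>R lie_symbol 1 X P" for X Y :: "'n vector_field" and c P
    by (simp_all add: lie_symbol_eq lie_endo_linear act_simps)
  have "subspace ?G"
  proof (rule subspaceI)
    have "lie_op l1 l2 m (0 *\<^sub>R 0) (bidiff_op (Q P)) f g = bidiff_op (Q (lie_symbol 1 (0 *\<^sub>R 0) P)) f g" for P f g
      unfolding lie_op_linear lsym linear_cmul[OF Q] linear_cmul[OF B] by simp
    then show "0 \<in> ?G" by (simp add: fun_eq_iff)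
  qed (auto simp: fun_eq_iff lie_op_linear lsym linear_cmul[OF Q] linear_cmul[OF B] linear_add[OF Q] linear_add[OF B])
  moreover have "range (\<lambda>i. axis i 1) \<union> range (\<lambda>(i, j). axis i (coord j))
      \<union> range (\<lambda>j. \<chi> i. coord j * coord i) \<subseteq> ?G"
    by (auto simp: lie_symbol_eq lie_endo_generators lie_op_translation lie_op_linear_field[OF m]
        lie_op_quadratic_field[OF m] translation linear_field quadratic)
  ultimately have "sl_fields \<subseteq> ?G"
    unfolding sl_fields_def by (intro span_minimal)
  with X show ?thesis by blast
qed

lemma lookup_above_total_degree:
  "total_degree P < size a + size b \<Longrightarrow> Poly_Mapping.lookup P (a, b) = 0"
proof (rule ccontr)
  assume less: "total_degree P < size a + size b" and "Poly_Mapping.lookup P (a, b) \<noteq> 0"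
  then have "size a + size b \<in> insert 0 ((\<lambda>(a, b). size a + size b) ` Poly_Mapping.keys P)"
    by (force simp: in_keys_iff)
  then have "size a + size b \<le> total_degree P"
    unfolding total_degree_def by (intro Max_ge) auto
  with less show False by simp
qed

lemma total_degree_attained:
  "total_degree P = 0 \<or> (\<exists>a b. size a + size b = total_degree P \<and> Poly_Mapping.lookup P (a, b) \<noteq> 0)"
proof -
  have "total_degree P \<in> insert 0 ((\<lambda>(a, b). size a + size b) ` Poly_Mapping.keys P)"
    unfolding total_degree_def by (intro Max_in) auto
  then show ?thesis by (auto simp: in_keys_iff)
qed

lemma total_degree_eqI:
  assumes "\<And>a b. r < size a + size b \<Longrightarrow> Poly_Mapping.lookup P (a, b) = 0"
    and "r = 0 \<or> (\<exists>a b. size a + size b = r \<and> Poly_Mapping.lookup P (a, b) \<noteq> 0)"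
  shows "total_degree P = r"
  unfolding total_degree_def
proof (rule Max_eqI)
  show "finite (insert 0 ((\<lambda>(a, b). size a + size b) ` Poly_Mapping.keys P))" by simp
  show "y \<le> r" if "y \<in> insert 0 ((\<lambda>(a, b). size a + size b) ` Poly_Mapping.keys P)" for y
    using that assms(1) by (force simp: in_keys_iff not_less[symmetric])
  show "r \<in> insert 0 ((\<lambda>(a, b). size a + size b) ` Poly_Mapping.keys P)"
    using assms(2) by (force simp: in_keys_iff)
qed

lemma lookup_homogeneous_component:
  "Poly_Mapping.lookup (homogeneous_component r P) (a, b)
    = (if size a + size b = r then Poly_Mapping.lookup P (a, b) else 0)"
proof -
  have "homogeneous_component r P = (\<Sum>k\<in>{k \<in> Poly_Mapping.keys P. size (fst k) + size (snd k) = r}.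
      Poly_Mapping.single k (Poly_Mapping.lookup P k))"
    unfolding homogeneous_component_def by (rule sum.cong) auto
  then show ?thesis
    by (auto simp: lookup_sum lookup_single when_def in_keys_iff)
qed

text \<open>The condition reads: symbols of degree at most \<open>m\<close> go to symbols of degree less than \<open>m\<close>. It is
  phrased by vanishing coefficients, since \<open>total_degree\<close> does not separate constants from zero.\<close>

definition lowers_degree :: "('n::finite symbol \<Rightarrow> 'n symbol) \<Rightarrow> bool" where
  "lowers_degree H \<longleftrightarrow> linear H \<and>
     (\<forall>P m. (\<forall>a b. m < size a + size b \<longrightarrow> Poly_Mapping.lookup P (a, b) = 0) \<longrightarrow>
        (\<forall>a b. m \<le> size a + size b \<longrightarrow> Poly_Mapping.lookup (H P) (a, b) = 0))"

lemma lowers_degreeD: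
  assumes "lowers_degree H" "\<And>a b. m < size a + size b \<Longrightarrow> Poly_Mapping.lookup P (a, b) = 0"
    "m \<le> size a + size b"
  shows "Poly_Mapping.lookup (H P) (a, b) = 0"
  using assms unfolding lowers_degree_def by blast

lemma lowers_degree_if_on_eig:
  fixes H :: "'n::finite symbol \<Rightarrow> 'n symbol"
  assumes H: "linear H"
    and eig: "\<And>d v P a b. P \<in> tri.eig d v \<Longrightarrow> d \<le> size a + size b \<Longrightarrow> Poly_Mapping.lookup (H P) (a, b) = 0"
  shows "lowers_degree H"
  unfolding lowers_degree_def
proof (intro conjI allI impI H)
  fix P :: "'n symbol" and m and a b :: "'n multiset"
  assume P: "\<forall>a b. m < size a + size b \<longrightarrow> Poly_Mapping.lookup P (a, b) = 0" and m: "m \<le> size a + size b"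
  have lin: "linear (\<lambda>P. Poly_Mapping.lookup (H P) (a, b))"
    using linear_compose[OF H linear_lookup] by (simp add: o_def)
  have "Poly_Mapping.lookup (H (Poly_Mapping.single k (Poly_Mapping.lookup P k))) (a, b) = 0" for k
  proof (cases "Poly_Mapping.lookup P k = 0")
    case False
    obtain a' b' where k: "k = (a', b')" by force
    have le: "size a' + size b' \<le> size a + size b"
      using P False m unfolding k by (meson le_trans not_le)
    have "span (\<Union>v. tri.eig (size a' + size b') v) \<subseteq> {P. Poly_Mapping.lookup (H P) (a, b) = 0}"
      by (rule span_minimal) (use eig le linear_subspace_kernel[OF lin] in auto)
    then show ?thesis using single_in_span_eig unfolding k by blast
  qed (simp add: linear_0[OF H])
  then show "Poly_Mapping.lookup (H P) (a, b) = 0"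
    by (subst symbol_sum_singles) (simp add: linear_sum[OF lin])
qed

lemma lookup_lower:
  assumes "P \<in> tri.lower d v" "d \<le> size a + size b"
  shows "Poly_Mapping.lookup P (a, b) = 0"
proof -
  have "P \<in> {P. Poly_Mapping.lookup P (a, b) = 0}"
  proof (rule tri.lower_induct[OF assms(1) linear_subspace_kernel[OF linear_lookup]])
    fix d' w and Y :: "'a symbol" assume "d' < d" and Y: "Y \<in> tri.eig d' w"
    then show "Y \<in> {P. Poly_Mapping.lookup P (a, b) = 0}"
      using degree_eigen_lookup[of Y "real d'" a b] assms(2) by (auto simp: tri.eig_def)
  qed
  then show ?thesis by simp
qed

text \<open>Such a map \<open>Q\<close> is a quantisation: it is the identity on principal symbols, hence invertible, and
  its inverse is the symbol map.\<close>

locale unipotent =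
  fixes Q :: "'n::finite symbol \<Rightarrow> 'n symbol"
  assumes linear_Q: "linear Q" and lowers: "lowers_degree (\<lambda>P. Q P - P)"
begin

lemma lookup_top:
  "total_degree P \<le> size a + size b \<Longrightarrow> Poly_Mapping.lookup (Q P) (a, b) = Poly_Mapping.lookup P (a, b)"
  using lowers_degreeD[OF lowers, OF lookup_above_total_degree[of P]]
  by (simp add: lookup_minus)

lemma total_degree_Q: "total_degree (Q P) = total_degree P"
proof (rule total_degree_eqI)
  fix a b :: "'n multiset" assume "total_degree P < size a + size b"
  then show "Poly_Mapping.lookup (Q P) (a, b) = 0"
    by (simp add: lookup_top lookup_above_total_degree)
next
  show "total_degree P = 0 \<or> (\<exists>a b. size a + size b = total_degree P \<and> Poly_Mapping.lookup (Q P) (a, b) \<noteq> 0)"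
    using total_degree_attained[of P] by (auto simp: lookup_top)
qed

lemma homogeneous_component_Q:
  "homogeneous_component (total_degree P) (Q P) = homogeneous_component (total_degree P) P"
  by (rule poly_mapping_eqI) (auto simp: lookup_homogeneous_component lookup_top)

lemma inj_Q: "inj Q"
proof -
  have "P = 0" if "Q P = 0" for P
  proof -
    have "total_degree P = 0"
      using total_degree_Q[of P] that total_degree_eqI[of 0 0] by (metis lookup_zero)
    then show ?thesis
      using lookup_top[of P] that by (intro poly_mapping_eqI) auto
  qed
  then show ?thesis using linear_injective_0[OF linear_Q] by blast
qed

lemma surj_Q: "surj Q"
proof -
  have *: "P \<in> range Q" if "\<And>a b. m \<le> size a + size b \<Longrightarrow> Poly_Mapping.lookup P (a, b) = 0" for m P
    using that
  proof (induction m arbitrary: P)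
    case 0
    then have "P = 0" by (intro poly_mapping_eqI) auto
    then show ?case using linear_0[OF linear_Q] by (metis rangeI)
  next
    case (Suc m)
    have "Q P - P \<in> range Q"
      by (rule Suc.IH, rule lowers_degreeD[OF lowers]) (use Suc.prems in auto)
    then obtain R where "Q P - P = Q R" by blast
    then have "P = Q (P - R)" by (simp add: linear_diff[OF linear_Q] algebra_simps)
    then show ?case by (metis rangeI)
  qed
  have "P \<in> range Q" for P
    by (rule *[of "Suc (total_degree P)"]) (simp add: lookup_above_total_degree)
  then show ?thesis by auto
qed

lemma inv_Q: "inv Q (Q P) = P" "Q (inv Q P) = P"
  by (simp_all add: inj_Q surj_Q surj_f_inv_f)

theorem symbol_map:
  assumes equivariant: "\<And>X P. X \<in> sl_fields \<Longrightarrow>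
      lie_op l1 l2 m X (bidiff_op (Q P)) = bidiff_op (Q (lie_symbol (m - l1 - l2) X P))"
  shows "proj_equiv_symbol_map l1 l2 m (\<lambda>T. inv Q (polynomial_form T))"
proof -
  let ?s = "\<lambda>T. inv Q (polynomial_form T)"
  have s: "?s (bidiff_op P) = inv Q P" for P by (simp add: polynomial_form_bidiff_op)
  have ops: "\<exists>P. T = bidiff_op (Q P)" if "T \<in> bidiff_ops" for T
    using that inv_Q(2) unfolding bidiff_ops_def by (metis imageE)
  have sQ: "?s (bidiff_op (Q P)) = P" for P by (simp add: s inv_Q)
  have add: "(\<lambda>f g. bidiff_op P f g + bidiff_op R f g) = bidiff_op (P + R)" for P R :: "'n symbol"
    by (simp add: fun_eq_iff linear_add[OF linear_bidiff_op])
  have scale: "(\<lambda>f g. c *\<^sub>R bidiff_op P f g) = bidiff_op (c *\<^sub>R P)" for c and P :: "'n symbol"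
    by (simp add: fun_eq_iff linear_cmul[OF linear_bidiff_op])
  have "bij_betw ?s bidiff_ops UNIV"
  proof (rule bij_betw_byWitness[where f' = "\<lambda>P. bidiff_op (Q P)"])
    show "\<forall>T\<in>bidiff_ops. bidiff_op (Q (?s T)) = T" using ops sQ by metis
    show "(\<lambda>P. bidiff_op (Q P)) ` UNIV \<subseteq> bidiff_ops" by (auto simp: bidiff_ops_def)
  qed (auto simp: sQ)
  moreover have "\<forall>S\<in>bidiff_ops. \<forall>T\<in>bidiff_ops. ?s (\<lambda>f g. S f g + T f g) = ?s S + ?s T"
  proof (intro ballI)
    fix S T :: "'n bioperator" assume "S \<in> bidiff_ops" "T \<in> bidiff_ops"
    then obtain P R where "S = bidiff_op (Q P)" "T = bidiff_op (Q R)" using ops by metis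
    then show "?s (\<lambda>f g. S f g + T f g) = ?s S + ?s T"
      by (simp add: add linear_add[OF linear_Q, symmetric] sQ)
  qed
  moreover have "\<forall>c. \<forall>T\<in>bidiff_ops. ?s (\<lambda>f g. c *\<^sub>R T f g) = c *\<^sub>R ?s T"
  proof (intro allI ballI)
    fix c and T :: "'n bioperator" assume "T \<in> bidiff_ops"
    then obtain P where "T = bidiff_op (Q P)" using ops by metis
    then show "?s (\<lambda>f g. c *\<^sub>R T f g) = c *\<^sub>R ?s T"
      by (simp add: scale linear_cmul[OF linear_Q, symmetric] sQ)
  qed
  moreover have "\<forall>T\<in>bidiff_ops. total_degree (?s T) = total_order T \<and>
        homogeneous_component (total_order T) (?s T) = principal_symbol T"
  proof
    fix T :: "'n bioperator" assume "T \<in> bidiff_ops"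
    then obtain P where T: "T = bidiff_op (Q P)" using ops by metis
    have o: "total_order T = total_degree P"
      by (simp add: T total_order_def polynomial_form_bidiff_op total_degree_Q)
    show "total_degree (?s T) = total_order T \<and>
        homogeneous_component (total_order T) (?s T) = principal_symbol T"
      unfolding principal_symbol_def o
      by (simp add: T sQ polynomial_form_bidiff_op homogeneous_component_Q inv_Q)
  qed
  moreover have "\<forall>X\<in>sl_fields. \<forall>T\<in>bidiff_ops. ?s (lie_op l1 l2 m X T) = lie_symbol (m - l1 - l2) X (?s T)"
  proof (intro ballI)
    fix X :: "'n vector_field" and T :: "'n bioperator"
    assume X: "X \<in> sl_fields" and "T \<in> bidiff_ops"
    then obtain P where "T = bidiff_op (Q P)" using ops by metis
    then show "?s (lie_op l1 l2 m X T) = lie_symbol (m - l1 - l2) X (?s T)"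
      by (simp add: equivariant[OF X] sQ)
  qed
  ultimately show ?thesis unfolding proj_equiv_symbol_map_def by blast
qed

end

section \<open>Existence and non-uniqueness\<close>

lemma eig_preserved_if_gl2_invariant:
  assumes "commutator deg_alpha G = 0" "commutator deg_beta G = 0" "commutator beta_to_alpha G = 0" "commutator alpha_to_beta G = (0 :: 'n::finite symbol_endo)"
    and "P \<in> tri.eig d v"
  shows "act G P \<in> tri.eig d v"
  by (rule eig_preserved[OF commutator_gl2_composite(1)[OF assms(1-4)] commutator_proj_casimir[OF assms(1-4)] assms(5)])

lemma weighted_defect_zero: "weighted_defect 0 0 h = defect h"
  by (simp add: weighted_defect_def)

lemma act_commutator_0:
  "commutator F G = 0 \<Longrightarrow> act F (act G P) = act G (act F P)"
  using commutator_eq_0D[THEN arg_cong[of _ _ "\<lambda>G. act G P"]] by (simp add: act_simps)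

text \<open>The Casimir correction of \<open>intertwining_correction\<close>, for \<open>\<lambda> = (0, 0)\<close> and \<open>\<delta> = 1\<close>.\<close>

lemma equivariant_quantization:
  "\<exists>Q :: 'n::finite symbol \<Rightarrow> 'n symbol. unipotent Q \<and>
    (\<forall>i P. act (dX i) (Q P) = Q (act (dX i) P)) \<and>
    (\<forall>i j P. act (lie_linear i j) (Q P) = Q (act (lie_linear i j) P)) \<and>
    (\<forall>h P. act (lie_quadratic h - weighted_defect 0 0 h) (Q P) = Q (act (lie_quadratic h) P))"
proof (rule tri.intertwining_correction)
  fix Q :: "'n symbol \<Rightarrow> 'n symbol"
  assume Q: "linear Q"
    "\<And>d v x. x \<in> tri.eig d v \<Longrightarrow> Q x - x \<in> tri.lower d v"
    and inter: "\<And>L g x. linear L \<Longrightarrow> linear g \<Longrightarrow> (\<And>d v x. x \<in> tri.eig d v \<Longrightarrow> L x \<in> tri.eig d v) \<Longrightarrow>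
      (\<And>d v x. x \<in> tri.eig d v \<Longrightarrow> g x \<in> tri.lower d v) \<Longrightarrow>
      (\<And>x. L (act proj_casimir x + act casimir_defect x) - g (act proj_casimir x + act casimir_defect x)
        = act proj_casimir (L x - g x) + act casimir_defect (L x - g x)) \<Longrightarrow>
      L (Q x) - g (Q x) = Q (L x)"
  have zero: "act F (Q P) = Q (act F P)"
    if "commutator deg_alpha F = 0" "commutator deg_beta F = 0" "commutator beta_to_alpha F = 0" "commutator alpha_to_beta F = 0" "commutator (proj_casimir + casimir_defect) F = 0" for F P
  proof -
    have "act F (Q P) - act 0 (Q P) = Q (act F P)"
    proof (rule inter[OF linear_act linear_act])
      show "act F x \<in> tri.eig d v" if "x \<in> tri.eig d v" for x d v
        by (rule eig_preserved_if_gl2_invariant) fact+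
      show "act 0 x \<in> tri.lower d v" for x d v
        by (simp add: act_simps subspace_0[OF tri.subspace_lower])
      show "act F (act proj_casimir x + act casimir_defect x) - act 0 (act proj_casimir x + act casimir_defect x)
        = act proj_casimir (act F x - act 0 x) + act casimir_defect (act F x - act 0 x)" for x
        using act_commutator_0[OF that(5), of x] by (simp add: act_simps)
    qed
    then show ?thesis by (simp add: act_simps)
  qed
  show ?thesis
  proof (intro exI[of _ Q] conjI allI)
    show "unipotent Q"
    proof (rule unipotent.intro)
      show "linear Q" by (rule Q)
      show "lowers_degree (\<lambda>P. Q P - P)"
        by (rule lowers_degree_if_on_eig[OF linear_compose_sub[OF Q(1) linear_ident]])
           (use lookup_lower[OF Q(2)] in blast)
    qed
    show "act (dX i) (Q P) = Q (act (dX i) P)" for i P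
      by (rule zero) (simp_all add: gl2_on_generators commutator_total_casimir)
    show "act (lie_linear i j) (Q P) = Q (act (lie_linear i j) P)" for i j P
      by (rule zero) (simp_all add: gl2_lie_linear commutator_total_casimir)
    show "act (lie_quadratic h - weighted_defect 0 0 h) (Q P) = Q (act (lie_quadratic h) P)" for h P
    proof -
      have "act (lie_quadratic h) (Q P) - act (defect h) (Q P) = Q (act (lie_quadratic h) P)"
      proof (rule inter[OF linear_act linear_act])
        show "act (lie_quadratic h) x \<in> tri.eig d v" if "x \<in> tri.eig d v" for x d v
          by (rule eig_preserved_if_gl2_invariant[OF gl2_lie_quadratic that])
        show "act (defect h) x \<in> tri.lower d v" if "x \<in> tri.eig d v" for x d v
          by (rule defect_lowers[OF that])
        show "act (lie_quadratic h) (act proj_casimir x + act casimir_defect x) - act (defect h) (act proj_casimir x + act casimir_defect x)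
          = act proj_casimir (act (lie_quadratic h) x - act (defect h) x) + act casimir_defect (act (lie_quadratic h) x - act (defect h) x)" for x
          using act_commutator_0[OF commutator_total_casimir(3), of h x]
          by (simp add: act_simps act_diff act_add algebra_simps)
      qed
      then show ?thesis by (simp add: weighted_defect_zero act_simps)
    qed
  qed
qed

lemma degree_zero_derivatives:
  assumes "act deg_total P = 0"
  shows "act (dA i) P = 0" "act (dB i) P = 0"
proof -
  have "deg_total * dA i = dA i * deg_total - dA i" "deg_total * dB i = dB i * deg_total - dB i"
    using gl2_on_generators[of i] by (simp_all add: commutator_def deg_total_def algebra_simps)
  from this[THEN arg_cong[of _ _ "\<lambda>G. act G P"]] assms
  show "act (dA i) P = 0" "act (dB i) P = 0"
    by (simp_all add: act_simps act_zero negative_weight_zero(3))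
qed

text \<open>On symbols of degree one and weight \<open>\<delta> = 1\<close>, vector-valued densities, the divergence is
  invariant: its commutator with a quadratic field takes values in degree operators applied to
  constants. The map \<open>N\<close> is this divergence in degree one, extended by zero to the other
  degrees.\<close>

lemma divergence_intertwiner:
  "\<exists>N :: 'n::finite symbol \<Rightarrow> 'n symbol. lowers_degree N \<and>
    (\<forall>i P. act (dX i) (N P) = N (act (dX i) P)) \<and>
    (\<forall>i j P. act (lie_linear i j) (N P) = N (act (lie_linear i j) P)) \<and>
    (\<forall>h P. act (lie_quadratic h) (N P) = N (act (lie_quadratic h) P)) \<and>
    (\<exists>P. N P \<noteq> 0)"
proof -
  have lin: "linear (if s = 1 then act div_alpha else act 0 :: 'n symbol \<Rightarrow> 'n symbol)" for s :: real
    by (simp add: linear_act)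
  obtain N :: "'n symbol \<Rightarrow> 'n symbol" where N: "linear N"
    "\<And>s t x. act deg_total x = s *\<^sub>R x \<Longrightarrow> act proj_casimir x = t *\<^sub>R x \<Longrightarrow> N x = (if s = 1 then act div_alpha else act 0) x"
    using joint_eigenvector_extension[OF linear_act linear_act tri.span_joint,
      of "\<lambda>s t. if s = 1 then act div_alpha else act 0", OF lin] by auto
  have N1: "N x = act div_alpha x" if "x \<in> tri.eig d v" "d = 1" for x d v
    using that N(2)[of x 1 v] by (simp add: tri.eig_def)
  have N0: "N x = 0" if "x \<in> tri.eig d v" "d \<noteq> 1" for x d v
    using that N(2)[of x "real d" v] by (simp add: tri.eig_def act_simps)
  have deg_div: "act deg_total (act div_alpha x) = 0" if "x \<in> tri.eig 1 v" for x :: "'n symbol" and v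
  proof -
    have "deg_total * div_alpha = div_alpha * deg_total - (div_alpha :: 'n symbol_endo)"
    proof -
      have "deg_alpha * div_alpha = div_alpha * deg_alpha - (div_alpha :: 'n symbol_endo)" "deg_beta * div_alpha = div_alpha * (deg_beta :: 'n symbol_endo)"
        using gl2_div(1,3) by (simp_all add: commutator_def algebra_simps)
      then show ?thesis by (simp add: deg_total_def distrib_right distrib_left)
    qed
    from arg_cong[OF this, of "\<lambda>G. act G x"] that show ?thesis
      by (simp add: act_simps tri.eig_def)
  qed
  have inter: "act F (N P) = N (act F P)"
    if F: "commutator deg_alpha F = 0" "commutator deg_beta F = 0" "commutator beta_to_alpha F = 0" "commutator alpha_to_beta F = 0"
      and div: "\<And>x v. x \<in> tri.eig 1 v \<Longrightarrow> act F (act div_alpha x) = act div_alpha (act F x)" for F P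
  proof -
    have "linear (\<lambda>x. act F (N x))" "linear (\<lambda>x. N (act F x))"
      using linear_compose[OF N(1) linear_act] linear_compose[OF linear_act N(1)] by (simp_all add: o_def)
    moreover have "act F (N x) = N (act F x)" if x: "x \<in> (\<Union>d. \<Union>v. tri.eig d v)" for x
    proof -
      obtain d v where dv: "x \<in> tri.eig d v" using x by auto
      note Fx = eig_preserved_if_gl2_invariant[OF F dv]
      show ?thesis
        by (cases "d = 1") (use dv Fx in \<open>auto simp: N1 N0 div act_zero\<close>)
    qed
    moreover have "P \<in> span (\<Union>d. \<Union>v. tri.eig d v)" by (simp only: span_eig UNIV_I)
    ultimately show ?thesis by (rule linear_eq_on_span)
  qed
  show ?thesis
  proof (intro exI[of _ N] conjI allI)
    show "lowers_degree N"
    proof (rule lowers_degree_if_on_eig[OF N(1)])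
      fix d v and a b :: "'n multiset" and P :: "'n symbol" assume P: "P \<in> tri.eig d v" and le: "d \<le> size a + size b"
      show "Poly_Mapping.lookup (N P) (a, b) = 0"
      proof (cases "d = 1")
        case True
        then have "act deg_total (N P) = 0 *\<^sub>R N P" using P by (simp add: N1 deg_div)
        from degree_eigen_lookup[OF this, of a b] le True show ?thesis by auto
      next
        case False
        with P show ?thesis by (simp add: N0)
      qed
    qed
    show "act (dX i) (N P) = N (act (dX i) P)" for i P
    proof (rule inter)
      show "act (dX i) (act div_alpha x) = act div_alpha (act (dX i) x)" for x
        by (rule act_commutator_0[symmetric], rule div_alpha_on_generators)
    qed (rule gl2_on_generators)+
    show "act (lie_linear i j) (N P) = N (act (lie_linear i j) P)" for i j P
    proof (rule inter)
      show "act (lie_linear i j) (act div_alpha x) = act div_alpha (act (lie_linear i j) x)" for x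
        by (rule act_commutator_0[symmetric], rule div_lie_linear)
    qed (rule gl2_lie_linear)+
    show "act (lie_quadratic h) (N P) = N (act (lie_quadratic h) P)" for h P
    proof (rule inter)
      fix x :: "'n symbol" and v assume x: "x \<in> tri.eig 1 v"
      have "deg_total * dA h = dA h * deg_total - dA h" "deg_total * dB h = dB h * deg_total - dB h"
        using gl2_on_generators[of h] by (simp_all add: commutator_def deg_total_def algebra_simps)
      from this[THEN arg_cong[of _ _ "\<lambda>G. act G x"]] x
      have deg: "act deg_total (act (dA h) x) = 0" "act deg_total (act (dB h) x) = 0"
        by (simp_all add: act_simps tri.eig_def)
      have "act alpha_to_beta (act (dB h) x) = 0"
        by (simp add: alpha_to_beta_def act_sum act_simps degree_zero_derivatives[OF deg(2)] act_zero)
      then have "act (commutator div_alpha (lie_quadratic h)) x = 0"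
        by (simp add: div_lie_quadratic act_simps deg degree_zero_weights[OF deg(1)])
      then show "act (lie_quadratic h) (act div_alpha x) = act div_alpha (act (lie_quadratic h) x)"
        by (simp add: commutator_def act_simps)
    qed (rule gl2_lie_quadratic)+
    show "\<exists>P. N P \<noteq> 0"
    proof -
      fix i :: 'n
      let ?P = "Poly_Mapping.single ({#i#}, {#}) (coord i)"
      have K: "act deg_total ?P = 1 *\<^sub>R ?P"
        by (simp add: deg_total_def act_simps act_gl2_single)
      have M: "act gl2_casimir ?P = 0"
        using char_product_single[of "{#i#}" "{#}" "coord i"] by (simp add: act_simps gl2_eigenvalue_def)
      have "?P \<in> tri.eig 1 0" using K M by (simp add: eig_iff)
      then have "N ?P = act div_alpha ?P" by (simp add: N1)
      also have "\<dots> = (\<Sum>j\<in>UNIV. if j = i then Poly_Mapping.single 0 1 else 0)"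
        unfolding div_alpha_def act_sum act_simps act_weyl_single
        by (rule sum.cong) (auto simp: pd_coord pd_zero zero_prod_def)
      also have "\<dots> = 1" by simp
      finally have "N ?P \<noteq> 0" by simp
      then show ?thesis by blast
    qed
  qed
qed

lemma symbol_maps_not_unique:
  assumes "\<mu> = (1 :: real)"
  shows "\<exists>\<sigma> \<tau> :: 'n::finite bioperator \<Rightarrow> 'n symbol.
     proj_equiv_symbol_map 0 0 \<mu> \<sigma> \<and> proj_equiv_symbol_map 0 0 \<mu> \<tau> \<and> (\<exists>T\<in>bidiff_ops. \<sigma> T \<noteq> \<tau> T)"
proof -
  obtain Q :: "'n symbol \<Rightarrow> 'n symbol" where "unipotent Q"
    and Q: "\<And>i P. act (dX i) (Q P) = Q (act (dX i) P)"
    "\<And>i j P. act (lie_linear i j) (Q P) = Q (act (lie_linear i j) P)"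
    "\<And>h P. act (lie_quadratic h - weighted_defect 0 0 h) (Q P) = Q (act (lie_quadratic h) P)"
    using equivariant_quantization by auto
  interpret Q: unipotent Q by fact
  obtain N :: "'n symbol \<Rightarrow> 'n symbol" where Nlow: "lowers_degree N"
    and N: "\<And>i P. act (dX i) (N P) = N (act (dX i) P)"
    "\<And>i j P. act (lie_linear i j) (N P) = N (act (lie_linear i j) P)"
    "\<And>h P. act (lie_quadratic h) (N P) = N (act (lie_quadratic h) P)" and "\<exists>P. N P \<noteq> 0"
    using divergence_intertwiner by auto
  then obtain P0 where P0: "N P0 \<noteq> 0" by blast
  have linN: "linear N" using Nlow by (simp add: lowers_degree_def)
  define R where "R P = Q (P + N P)" for P
  have linR: "linear R"
    using linear_compose[OF linear_compose_add[OF linear_ident linN] Q.linear_Q]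
    by (simp add: R_def[abs_def] o_def)
  interpret R: unipotent R
  proof (rule unipotent.intro)
    show "linear R" by (rule linR)
    show "lowers_degree (\<lambda>P. R P - P)"
      unfolding lowers_degree_def
    proof (intro conjI allI impI)
      show "linear (\<lambda>P. R P - P)" by (rule linear_compose_sub[OF linR linear_ident])
      fix P :: "'n symbol" and m and a b :: "'n multiset"
      assume P: "\<forall>a b. m < size a + size b \<longrightarrow> Poly_Mapping.lookup P (a, b) = 0" and le: "m \<le> size a + size b"
      have NP: "Poly_Mapping.lookup (N P) (a, b) = 0" if "m \<le> size a + size b" for a b
        by (rule lowers_degreeD[OF Nlow _ that]) (use P in auto)
      have "Poly_Mapping.lookup (Q (P + N P) - (P + N P)) (a, b) = 0"
        by (rule lowers_degreeD[OF Q.lowers _ le]) (use P NP in \<open>auto simp: lookup_add\<close>)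
      with NP[OF le] show "Poly_Mapping.lookup (R P - P) (a, b) = 0"
        by (simp add: R_def lookup_minus lookup_add)
    qed
  qed
  have R: "\<And>i P. act (dX i) (R P) = R (act (dX i) P)"
    "\<And>i j P. act (lie_linear i j) (R P) = R (act (lie_linear i j) P)"
    "\<And>h P. act (lie_quadratic h - weighted_defect 0 0 h) (R P) = R (act (lie_quadratic h) P)"
    by (simp_all add: R_def Q N act_add)
  have m: "\<mu> = 0 + 0 + 1" using assms by simp
  have s: "proj_equiv_symbol_map 0 0 \<mu> (\<lambda>T. inv Q (polynomial_form T))"
    by (rule Q.symbol_map) (use lie_equivariance_on_generators[OF Q.linear_Q m Q] assms in simp)
  have t: "proj_equiv_symbol_map 0 0 \<mu> (\<lambda>T. inv R (polynomial_form T))"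
    by (rule R.symbol_map) (use lie_equivariance_on_generators[OF linR m R] assms in simp)
  have "inv Q (polynomial_form (bidiff_op (R P0))) \<noteq> inv R (polynomial_form (bidiff_op (R P0)))"
    using P0 by (simp add: polynomial_form_bidiff_op R.inv_Q) (simp add: R_def Q.inv_Q)
  moreover have "bidiff_op (R P0) \<in> bidiff_ops" by (simp add: bidiff_ops_def)
  ultimately show ?thesis using s t by blast
qed

section \<open>The obstruction\<close>

text \<open>The symbols \<open>z h\<close> are constant and of degree one, so the symbol map fixes them. Therefore it
  maps \<open>lie_quadratic h - weighted_defect l1 l2 h\<close> applied to \<open>z h\<close> to \<open>lie_quadratic h\<close> applied to
  \<open>z h\<close>. Summing over \<open>h\<close> leaves \<open>c\<close> times the image of the constant symbol \<open>1\<close>, which is not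
  zero because its principal symbol is not.\<close>

lemma symbol_map_obstruction:
  fixes z :: "'n::finite \<Rightarrow> 'n symbol" and \<sigma> :: "'n bioperator \<Rightarrow> 'n symbol"
  assumes \<sigma>: "proj_equiv_symbol_map l1 l2 m \<sigma>" and m: "m = l1 + l2 + 1"
    and degree: "\<And>h. act deg_total (z h) = z h" and const: "\<And>h i. act (dX i) (z h) = 0"
    and sum: "(\<Sum>h\<in>UNIV. act (lie_quadratic h) (z h)) = 0"
    and defect: "(\<Sum>h\<in>UNIV. act (weighted_defect l1 l2 h) (z h)) = c *\<^sub>R 1"
  shows "c = 0"
proof -
  define s where "s P = \<sigma> (bidiff_op P)" for P
  have ops: "bidiff_op P \<in> bidiff_ops" for P :: "'n symbol" by (simp add: bidiff_ops_def)
  have add: "(\<lambda>f g. bidiff_op P f g + bidiff_op R f g) = bidiff_op (P + R)" for P R :: "'n symbol"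
    by (simp add: fun_eq_iff linear_add[OF linear_bidiff_op])
  have scale: "(\<lambda>f g. r *\<^sub>R bidiff_op P f g) = bidiff_op (r *\<^sub>R P)" for r and P :: "'n symbol"
    by (simp add: fun_eq_iff linear_cmul[OF linear_bidiff_op])
  have s_lin: "linear s"
  proof (rule linearI)
    show "s (P + R) = s P + s R" for P R
      using \<sigma> ops unfolding proj_equiv_symbol_map_def s_def add[symmetric] by blast
    show "s (r *\<^sub>R P) = r *\<^sub>R s P" for r P
      using \<sigma> ops unfolding proj_equiv_symbol_map_def s_def scale[symmetric] by blast
  qed
  have s_lie: "s (polynomial_form (lie_op l1 l2 m X (bidiff_op P))) = act (lie_endo 1 X) (s P)"
    if X: "X \<in> sl_fields" and op: "lie_op l1 l2 m X (bidiff_op P) \<in> bidiff_ops" for X P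
  proof -
    have "\<sigma> (lie_op l1 l2 m X (bidiff_op P)) = lie_symbol 1 X (\<sigma> (bidiff_op P))"
      using \<sigma> ops X m unfolding proj_equiv_symbol_map_def by simp
    moreover obtain R where "lie_op l1 l2 m X (bidiff_op P) = bidiff_op R"
      using op by (auto simp: bidiff_ops_def)
    ultimately show ?thesis by (simp add: s_def polynomial_form_bidiff_op lie_symbol_eq)
  qed
  have gen: "axis i 1 \<in> sl_fields" "axis i (coord j) \<in> sl_fields" "(\<chi> i. coord j * coord i) \<in> sl_fields" for i j :: 'n
    unfolding sl_fields_def by (intro span_base; force)+
  have s_dX: "s (act (dX i) P) = act (dX i) (s P)" for i P
    using s_lie[OF gen(1)[of i], of P] by (simp add: lie_op_translation ops polynomial_form_bidiff_op lie_endo_generators)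
  have s_G: "s (act (lie_linear i j) P) = act (lie_linear i j) (s P)" for i j P
    using s_lie[OF gen(2)[of i j], of P]
    by (simp add: lie_op_linear_field[OF m] ops polynomial_form_bidiff_op lie_endo_generators)
  have s_Q: "s (act (lie_quadratic h - weighted_defect l1 l2 h) P) = act (lie_quadratic h) (s P)" for h P
    using s_lie[OF gen(3)[of h], of P]
    by (simp add: lie_op_quadratic_field[OF m] ops polynomial_form_bidiff_op lie_endo_generators)
  have top: "homogeneous_component (total_order T) (\<sigma> T) = principal_symbol T" if "T \<in> bidiff_ops" for T
    using \<sigma> that unfolding proj_equiv_symbol_map_def by blast
  have s_top: "homogeneous_component (total_degree P) (s P) = homogeneous_component (total_degree P) P" for P
    using top[OF ops[of P]] by (simp add: s_def principal_symbol_def total_order_def polynomial_form_bidiff_op)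
  \<comment> \<open>The Euler field: its action detects the degree of symbols with constant coefficients.\<close>
  have trace: "(\<Sum>i\<in>UNIV. lie_linear i i) = (euler - deg_total + of_nat CARD('n) :: 'n symbol_endo)"
    by (simp add: lie_linear_def euler_def sum.distrib sum_subtractf sum_gl_vec)
  have fix_z: "s (z h) = z h" for h
  proof -
    have inv: "act (dX i) (s (z h)) = 0" for i
      using s_dX[of i "z h"] by (simp add: const linear_0[OF s_lin])
    have eul: "act euler P = 0" if "\<And>i. act (dX i) P = 0" for P :: "'n symbol"
      by (simp add: euler_def act_sum act_simps that act_zero)
    have "s (act (\<Sum>i\<in>UNIV. lie_linear i i) (z h)) = act (\<Sum>i\<in>UNIV. lie_linear i i) (s (z h))"
      by (simp add: act_sum linear_sum[OF s_lin] s_G)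
    then have "s (act (euler - deg_total + of_nat CARD('n)) (z h)) = act (euler - deg_total + of_nat CARD('n)) (s (z h))"
      unfolding trace .
    then have N: "act deg_total (s (z h)) = 1 *\<^sub>R s (z h)"
      by (simp add: act_simps act_of_nat eul inv const degree linear_add[OF s_lin] linear_diff[OF s_lin]
          linear_cmul[OF s_lin] linear_0[OF s_lin])
    have 1: "homogeneous_component 1 P = P" if "act deg_total P = 1 *\<^sub>R P" for P :: "'n symbol"
      by (rule poly_mapping_eqI) (use degree_eigen_lookup[OF that] in \<open>force simp: lookup_homogeneous_component\<close>)
    show ?thesis
    proof (cases "z h = 0")
      case False
      have z1: "act deg_total (z h) = 1 *\<^sub>R z h" by (simp add: degree)
      obtain a b where "Poly_Mapping.lookup (z h) (a, b) \<noteq> 0"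
        using False by (metis lookup_zero poly_mapping_eqI surj_pair)
      then have "total_degree (z h) = 1"
        using degree_eigen_lookup[OF z1] by (intro total_degree_eqI) force+
      then show ?thesis using s_top[of "z h"] 1[OF N] 1[OF z1] by simp
    qed (simp add: linear_0[OF s_lin])
  qed
  have "0 = (\<Sum>h\<in>UNIV. s (act (lie_quadratic h - weighted_defect l1 l2 h) (z h)))"
    using sum by (simp add: s_Q fix_z)
  also have "\<dots> = s ((\<Sum>h\<in>UNIV. act (lie_quadratic h) (z h)) - (\<Sum>h\<in>UNIV. act (weighted_defect l1 l2 h) (z h)))"
    by (simp add: linear_sum[OF s_lin, symmetric] act_simps sum_subtractf)
  also have "\<dots> = - (c *\<^sub>R s 1)"
    unfolding sum defect by (simp add: linear_neg[OF s_lin] linear_cmul[OF s_lin])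
  finally have "c *\<^sub>R s 1 = 0" by simp
  moreover have "s 1 \<noteq> 0"
  proof
    assume "s 1 = 0"
    moreover have "total_degree (1 :: 'n symbol) = 0"
      by (rule total_degree_eqI) (auto simp: lookup_one when_def zero_prod_def)
    ultimately have "homogeneous_component 0 (0 :: 'n symbol) = homogeneous_component 0 1"
      using s_top[of 1] by simp
    from arg_cong[OF this, of "\<lambda>P. Poly_Mapping.lookup P ({#}, {#})"] show False
      by (simp add: lookup_homogeneous_component lookup_one zero_prod_def)
  qed
  ultimately show "c = 0" by simp
qed

text \<open>At \<open>\<delta> = 1\<close> the Lie derivative of \<open>\<alpha>\<^sub>h\<close> along the quadratic field is
  \<open>n x\<^sup>h \<alpha>\<^sub>h - \<Sum>\<^sub>i x\<^sup>i \<alpha>\<^sub>i\<close>, whose sum over \<open>h\<close> is zero.\<close>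

lemma weights_vanish:
  fixes \<sigma> :: "'n::finite bioperator \<Rightarrow> 'n symbol"
  assumes \<sigma>: "proj_equiv_symbol_map l1 l2 m \<sigma>" and m: "m = l1 + l2 + 1"
  shows "l1 = 0" "l2 = 0"
proof -
  let ?q = "real (CARD('n) + 1)"
  have one: "(1 :: 'n symbol) = Poly_Mapping.single ({#}, {#}) 1"
    by (simp add: single_one[symmetric] zero_prod_def)
  have alpha: "alpha h = act (mA h) 1" and beta: "beta h = act (mB h) 1" for h :: 'n
    by (simp_all add: mA_def mB_def act_basic)
  have K: "act deg_total (alpha h) = alpha h" "act deg_total (beta h) = beta h"
    and K1: "act deg_alpha (alpha h) = alpha h" "act deg_alpha (beta h) = 0" "act deg_beta (alpha h) = 0" "act deg_beta (beta h) = beta h" for h :: 'n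
    by (simp_all add: deg_total_def alpha_def beta_def act_simps act_gl2_single)
  have dX: "act (dX i) (alpha h) = 0" "act (dX i) (beta h) = 0" for i h :: 'n
    by (simp_all add: alpha_def beta_def act_weyl_single pd_one)
  have d: "act (dA j) (alpha h) = (if j = h then 1 else 0)" "act (dB j) (alpha h) = 0"
    "act (dB j) (beta h) = (if j = h then 1 else 0)" "act (dA j) (beta h) = 0" for j h :: 'n
    by (simp_all add: alpha_def beta_def act_weyl_single one)
  have KL1: "act deg_alpha (1 :: 'n symbol) = 0" "act deg_beta (1 :: 'n symbol) = 0"
    by (simp_all add: one act_gl2_single)
  have gl: "act (gl_vec i h) (alpha h) = alpha i" "act (gl_vec i h) (beta h) = beta i" for i h :: 'n
    by (simp_all add: gl_vec_def act_simps d act_zero alpha[symmetric] beta[symmetric])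
  have eul: "act euler (alpha h) = 0" "act euler (beta h) = 0" for h :: 'n
    by (simp_all add: euler_def act_sum act_simps dX act_zero)
  have lieA: "act (lie_quadratic h) (alpha h) = real CARD('n) *\<^sub>R act (mX h) (alpha h) - (\<Sum>i\<in>UNIV. act (mX i) (alpha i))"
    and lieB: "act (lie_quadratic h) (beta h) = real CARD('n) *\<^sub>R act (mX h) (beta h) - (\<Sum>i\<in>UNIV. act (mX i) (beta i))" for h :: 'n
    by (simp_all add: lie_quadratic_def act_simps act_sum gl eul K act_of_nat act_scaleR)
  have "l1 * ?q * real CARD('n) = 0"
  proof (rule symbol_map_obstruction[OF \<sigma> m, of alpha])
    show "(\<Sum>h\<in>UNIV. act (lie_quadratic h) (alpha h)) = (0 :: 'n symbol)"
      by (simp add: lieA sum_subtractf scaleR_sum_right[symmetric] sum_constant_scaleR del: sum_constant)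
    show "(\<Sum>h\<in>UNIV. act (weighted_defect l1 l2 h) (alpha h)) = (l1 * ?q * real CARD('n)) *\<^sub>R (1 :: 'n symbol)"
      by (simp add: weighted_defect_def defect_def act_simps d KL1 act_zero sum_constant_scaleR mult.commute del: sum_constant)
  qed (simp_all add: K dX)
  then show "l1 = 0" by simp
  have "l2 * ?q * real CARD('n) = 0"
  proof (rule symbol_map_obstruction[OF \<sigma> m, of beta])
    show "(\<Sum>h\<in>UNIV. act (lie_quadratic h) (beta h)) = (0 :: 'n symbol)"
      by (simp add: lieB sum_subtractf scaleR_sum_right[symmetric] sum_constant_scaleR del: sum_constant)
    show "(\<Sum>h\<in>UNIV. act (weighted_defect l1 l2 h) (beta h)) = (l2 * ?q * real CARD('n)) *\<^sub>R (1 :: 'n symbol)"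
      by (simp add: weighted_defect_def defect_def act_simps d KL1 act_zero sum_constant_scaleR mult.commute del: sum_constant)
  qed (simp_all add: K dX)
  then show "l2 = 0" by simp
qed

theorem proposition14:
  fixes lambda1 lambda2 \<mu> \<delta> :: real
  assumes n: "CARD('n::finite) \<ge> 2"
    and \<delta>: "\<delta> = \<mu> - lambda1 - lambda2" "\<delta> = 1"
  shows "((\<exists>\<sigma> :: 'n bioperator \<Rightarrow> 'n symbol. proj_equiv_symbol_map lambda1 lambda2 \<mu> \<sigma>)
          \<longleftrightarrow> (lambda1, lambda2) = (0, 0))
       \<and> ((lambda1, lambda2) = (0, 0) \<longrightarrow>
          (\<exists>\<sigma> \<tau> :: 'n bioperator \<Rightarrow> 'n symbol.
             proj_equiv_symbol_map lambda1 lambda2 \<mu> \<sigma> \<and>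
             proj_equiv_symbol_map lambda1 lambda2 \<mu> \<tau> \<and>
             (\<exists>T\<in>bidiff_ops. \<sigma> T \<noteq> \<tau> T)))"
proof -
  have m: "\<mu> = lambda1 + lambda2 + 1" using \<delta> by simp
  have necessary: "(lambda1, lambda2) = (0, 0)"
    if "\<exists>\<sigma> :: 'n bioperator \<Rightarrow> 'n symbol. proj_equiv_symbol_map lambda1 lambda2 \<mu> \<sigma>"
    using that weights_vanish[OF _ m] by blast
  have sufficient: "\<exists>\<sigma> \<tau> :: 'n bioperator \<Rightarrow> 'n symbol.
             proj_equiv_symbol_map lambda1 lambda2 \<mu> \<sigma> \<and>
             proj_equiv_symbol_map lambda1 lambda2 \<mu> \<tau> \<and>
             (\<exists>T\<in>bidiff_ops. \<sigma> T \<noteq> \<tau> T)" if "(lambda1, lambda2) = (0, 0)"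
    using symbol_maps_not_unique[of \<mu>] that m by simp
  show ?thesis using necessary sufficient by blast
qed

end
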